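(* Let $N\ge1$, $\rho_0=\sum_{i=1}^Nh_0^i\delta_{x_0^i}$ and $\rho_1=\sum_{i=1}^Nh_1^i\delta_{x_1^i}$ with $h_0^i,h_1^i\ge0$ (some of which may be zero) and $x_0^i,x_1^i\in\bar\Omega$. Suppose that - for all $i\in\{1,\dots,N\}$, $|x_0^i-x_1^i|<\pi\delta$; - for all $i,j\in\{1,\dots,N\}$ with $i\ne j$, $\max_{\alpha,\beta\in\{0,1\}}|x_\alpha^i-x_\beta^j|>6\pi\delta$. For each $i$ let $\rho^i=h^i(t)\delta_{x^i(t)}\otimes dt$ be the geodesic for $WF_\delta$ between $h_0^i\delta_{x_0^i}$ and $h_1^i\delta_{x_1^i}$ (written explicitly in the context). Then $\rho=\sum_{i=1}^N\rho^i$ is a geodesic for $WF_\delta(\rho_0,\rho_1)$. This geodesic is unique if all masses $h_0^i,h_1^i$ are positive.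
   Context: Let $\Omega\subset\mathbb R^d$ ($d\ge 1$) be a nonempty open bounded convex set with closure $\bar\Omega$, and let $\delta>0$. For compact $X$, $\mathcal M(X)$ denotes the finite signed Radon measures on $X$ and $\mathcal M_+(X)$ the nonnegative ones; $\delta_x$ (with a point subscript) is the unit Dirac mass at $x$. For a family of measures $(\nu_t)$ on $\bar\Omega$, $\nu_t\otimes dt$ is the measure on $[0,1]\times\bar\Omega$ with $\int\varphi\,d(\nu_t\otimes dt)=\int_0^1\int\varphi(t,x)\,d\nu_t(x)\,dt$. Let $f_\delta:\mathbb R\times\mathbb R^d\times\mathbb R\to[0,+\infty]$ be $f_\delta(x,y,z)=\frac{|y|^2+\delta^2z^2}{2x}$ if $x>0$, $f_\delta(0,0,0)=0$, and $f_\delta=+\infty$ otherwise. For $\mu=(\rho,\omega,\zeta)\in\mathcal M([0,1]\times\bar\Omega)\times\mathcal M([0,1]\times\bar\Omega)^d\times\mathcal M([0,1]\times\bar\Omega)$ set $D_\delta(\mu)=\int_{[0,1]\times\bar\Omega}f_\delta\big(\frac{d\mu}{d\lambda}\big)\,d\lambda$, where $\lambda$ is any nonnegative measure with $|\mu|\ll\lambda$ (the value does not depend on $\lambda$). For $\rho_0,\rho_1\in\mathcal M_+(\bar\Omega)$, $\mathcal{CE}_0^1(\rho_0,\rho_1)$ is the set of triples $(\rho,\omega,\zeta)\in\mathcal M([0,1]\times\bar\Omega)\times\mathcal M([0,1]\times\bar\Omega)^d\times\mathcal M([0,1]\times\bar\Omega)$ such that for all $\varphi\in C^1([0,1]\times\bar\Omega)$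 $$\int\partial_t\varphi\,d\rho+\int\nabla\varphi\cdot d\omega+\int\varphi\,d\zeta=\int_{\bar\Omega}\varphi(1,\cdot)\,d\rho_1-\int_{\bar\Omega}\varphi(0,\cdot)\,d\rho_0 .$$ $WF_\delta(\rho_0,\rho_1)=\big(\inf_{\mathcal{CE}_0^1(\rho_0,\rho_1)}D_\delta\big)^{1/2}$. A geodesic for $WF_\delta(\rho_0,\rho_1)$ is a measure $\rho\in\mathcal M_+([0,1]\times\bar\Omega)$ for which there exist $\omega,\zeta$ such that $(\rho,\omega,\zeta)$ minimizes $D_\delta$ over $\mathcal{CE}_0^1(\rho_0,\rho_1)$. Geodesic between two Diracs $h_0\delta_{x_0}$, $h_1\delta_{x_1}$ with $|x_0-x_1|<\pi\delta$: if $h_0,h_1>0$ it is $h(t)\delta_{x(t)}\otimes dt$ with $h(t)=At^2-2Bt+h_0$, $h(t)x'(t)=\omega_0$, $x(0)=x_0$, where, with $\theta=\frac{|x_1-x_0|}{2\delta}$, $A=h_0+h_1-2\sqrt{h_0h_1}\cos\theta$, $B=h_0-\sqrt{h_0h_1}\cos\theta$, $\omega_0=2\delta\sqrt{h_0h_1}\sin\theta\,\frac{x_1-x_0}{|x_1-x_0|}$ ($\omega_0=0$ if $x_0=x_1$). If $h_0=0$ or $h_1=0$ it is $[t^2h_1\delta_{x_1}+(1-t)^2h_0\delta_{x_0}]\otimes dt$. *)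

theory Defs
  imports "HOL-Probability.Probability"
begin

section \<open>Signed measures\<close>

text \<open>Finite signed Borel measures concentrated on \<open>X\<close>, as countably additive real set
  functions. On a compact subset of a Euclidean space these are exactly the finite signed Radon
  measures. The library has no type of signed measures. The value on non-Borel sets is fixed to
  be \<open>0\<close> (as for \<^const>\<open>measure\<close>), so that equality of measures is equality of functions.\<close>

definition signed_measures :: "'b::topological_space set \<Rightarrow> ('b set \<Rightarrow> real) set" where
  "signed_measures X = {\<nu>.
     (\<forall>A. A \<notin> sets borel \<longrightarrow> \<nu> A = 0) \<and>
     (\<forall>A::nat \<Rightarrow> 'b set. range A \<subseteq> sets borel \<longrightarrow> disjoint_family A \<longrightarrow>
        (\<lambda>n. \<nu> (A n)) sums \<nu> (\<Union>n. A n)) \<and>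
     (\<forall>A \<in> sets borel. A \<inter> X = {} \<longrightarrow> \<nu> A = 0)}"

definition nonneg_measures :: "'b::topological_space set \<Rightarrow> ('b set \<Rightarrow> real) set" where
  "nonneg_measures X = {\<nu> \<in> signed_measures X. \<forall>A. 0 \<le> \<nu> A}"

definition vector_measures ::
    "'b::topological_space set \<Rightarrow> ('b set \<Rightarrow> 'a::euclidean_space) set" where
  "vector_measures X = {\<omega>. \<forall>b\<in>Basis. (\<lambda>A. \<omega> A \<bullet> b) \<in> signed_measures X}"

text \<open>Upper variation of a signed measure, i.e. the positive part of its Jordan decomposition;
  the negative part of \<open>\<nu>\<close> is the upper variation of \<open>-\<nu>\<close>.\<close>

definition upper_variation :: "('b::topological_space set \<Rightarrow> real) \<Rightarrow> 'b measure" where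
  "upper_variation \<nu> =
     measure_of UNIV (sets borel) (\<lambda>A. SUP B\<in>{B \<in> sets borel. B \<subseteq> A}. ennreal (\<nu> B))"

text \<open>The integrals run over \<open>X\<close> explicitly because integrands are only meaningful on \<open>X\<close>.\<close>

definition signed_integral ::
    "'b::topological_space set \<Rightarrow> ('b set \<Rightarrow> real) \<Rightarrow> ('b \<Rightarrow> real) \<Rightarrow> real" where
  "signed_integral X \<nu> f =
     (LINT x:X|upper_variation \<nu>. f x) - (LINT x:X|upper_variation (\<lambda>A. - \<nu> A). f x)"

definition vector_integral ::
    "'b::topological_space set \<Rightarrow> ('b set \<Rightarrow> 'a::euclidean_space) \<Rightarrow> ('b \<Rightarrow> 'a) \<Rightarrow> real" where
  "vector_integral X \<omega> g = (\<Sum>b\<in>Basis. signed_integral X (\<lambda>A. \<omega> A \<bullet> b) (\<lambda>x. g x \<bullet> b))"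

definition dirac :: "'b::topological_space \<Rightarrow> 'b set \<Rightarrow> real" where
  "dirac x = measure (return borel x)"

text \<open>The measure \<open>\<nu>\<^sub>t \<otimes> dt\<close>; the defining integral formula is stated for indicator functions.\<close>

definition tensor_dt ::
    "(real \<Rightarrow> 'a::euclidean_space set \<Rightarrow> real) \<Rightarrow> (real \<times> 'a) set \<Rightarrow> real" where
  "tensor_dt \<nu> A =
     (if A \<in> sets borel then (LINT t:{0..1}|lborel. \<nu> t {x. (t, x) \<in> A}) else 0)"

section \<open>The action functional\<close>

definition f_wf :: "real \<Rightarrow> real \<Rightarrow> 'a::euclidean_space \<Rightarrow> real \<Rightarrow> ennreal" where
  "f_wf \<delta> x y z =
     (if 0 < x then ennreal (((norm y)\<^sup>2 + \<delta>\<^sup>2 * z\<^sup>2) / (2 * x))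
      else if x = 0 \<and> y = 0 \<and> z = 0 then 0 else \<infinity>)"

text \<open>\<open>g = d\<nu>/dM\<close>. By Radon--Nikodym, for finite \<open>M\<close> such a \<open>g\<close> exists iff \<open>|\<nu>| \<lless> M\<close>.\<close>

definition has_density ::
    "('b::topological_space set \<Rightarrow> 'v::euclidean_space) \<Rightarrow> 'b measure \<Rightarrow> ('b \<Rightarrow> 'v) \<Rightarrow> bool" where
  "has_density \<nu> M g \<longleftrightarrow> integrable M g \<and> (\<forall>A\<in>sets borel. \<nu> A = (LINT p:A|M. g p))"

type_synonym 'a triple =
  "((real \<times> 'a) set \<Rightarrow> real) \<times> ((real \<times> 'a) set \<Rightarrow> 'a) \<times> ((real \<times> 'a) set \<Rightarrow> real)"

text \<open>The dominating measure \<open>M\<close> is arbitrary: as \<^const>\<open>f_wf\<close> is positively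
  \<open>1\<close>-homogeneous, the value does not depend on it.\<close>

definition action :: "real \<Rightarrow> 'a::euclidean_space set \<Rightarrow> 'a triple \<Rightarrow> ennreal" where
  "action \<delta> \<Omega> = (\<lambda>(\<rho>, \<omega>, \<zeta>). let X = {0..1} \<times> closure \<Omega> in
     (SOME c. \<exists>M r w z.
        finite_measure M \<and> sets M = sets borel \<and> emeasure M (- X) = 0 \<and>
        has_density \<rho> M r \<and> has_density \<omega> M w \<and> has_density \<zeta> M z \<and>
        c = (\<integral>\<^sup>+p\<in>X. f_wf \<delta> (r p) (w p) (z p) \<partial>M)))"

section \<open>Continuity equation with source and geodesics\<close>

text \<open>\<open>\<phi>\<close> is \<open>C\<^sup>1\<close> on the closed set \<open>X\<close>, up to the boundary, with time derivative \<open>\<phi>t\<close> and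
  spatial gradient \<open>\<phi>x\<close>. These are determined by \<open>\<phi>\<close> on a convex set with nonempty
  interior, such as \<open>[0,1] \<times> closure \<Omega>\<close>.\<close>

definition C1_with_derivs ::
    "(real \<times> 'a::euclidean_space) set \<Rightarrow> (real \<times> 'a \<Rightarrow> real) \<Rightarrow> (real \<times> 'a \<Rightarrow> real) \<Rightarrow>
     (real \<times> 'a \<Rightarrow> 'a) \<Rightarrow> bool" where
  "C1_with_derivs X \<phi> \<phi>t \<phi>x \<longleftrightarrow>
     continuous_on X \<phi>t \<and> continuous_on X \<phi>x \<and>
     (\<forall>p\<in>X. (\<phi> has_derivative (\<lambda>(s, v). \<phi>t p * s + \<phi>x p \<bullet> v)) (at p within X))"

definition CE ::
    "'a::euclidean_space set \<Rightarrow> ('a set \<Rightarrow> real) \<Rightarrow> ('a set \<Rightarrow> real) \<Rightarrow> 'a triple set" where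
  "CE \<Omega> \<rho>\<^sub>0 \<rho>\<^sub>1 = {(\<rho>, \<omega>, \<zeta>). let X = {0..1} \<times> closure \<Omega> in
     \<rho> \<in> signed_measures X \<and> \<omega> \<in> vector_measures X \<and> \<zeta> \<in> signed_measures X \<and>
     (\<forall>\<phi> \<phi>t \<phi>x. C1_with_derivs X \<phi> \<phi>t \<phi>x \<longrightarrow>
        signed_integral X \<rho> \<phi>t + vector_integral X \<omega> \<phi>x + signed_integral X \<zeta> \<phi> =
        signed_integral (closure \<Omega>) \<rho>\<^sub>1 (\<lambda>x. \<phi> (1, x)) -
        signed_integral (closure \<Omega>) \<rho>\<^sub>0 (\<lambda>x. \<phi> (0, x)))}"

text \<open>A geodesic for \<open>WF\<^sub>\<delta>(\<rho>\<^sub>0,\<rho>\<^sub>1)\<close>: the squared distance is the infimum of \<^const>\<open>action\<close> over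
  \<^const>\<open>CE\<close>, and \<open>\<rho>\<close> is the first component of a minimizer.\<close>

definition geodesic ::
    "real \<Rightarrow> 'a::euclidean_space set \<Rightarrow> ('a set \<Rightarrow> real) \<Rightarrow> ('a set \<Rightarrow> real) \<Rightarrow>
     ((real \<times> 'a) set \<Rightarrow> real) \<Rightarrow> bool" where
  "geodesic \<delta> \<Omega> \<rho>\<^sub>0 \<rho>\<^sub>1 \<rho> \<longleftrightarrow>
     \<rho> \<in> nonneg_measures ({0..1} \<times> closure \<Omega>) \<and>
     (\<exists>\<omega> \<zeta>. is_arg_min (action \<delta> \<Omega>) (\<lambda>\<mu>. \<mu> \<in> CE \<Omega> \<rho>\<^sub>0 \<rho>\<^sub>1) (\<rho>, \<omega>, \<zeta>))"

section \<open>The explicit geodesic between two Dirac masses\<close>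

definition half_angle :: "real \<Rightarrow> 'a::euclidean_space \<Rightarrow> 'a \<Rightarrow> real" where
  "half_angle \<delta> x\<^sub>0 x\<^sub>1 = norm (x\<^sub>1 - x\<^sub>0) / (2 * \<delta>)"

definition dirac_mass ::
    "real \<Rightarrow> real \<Rightarrow> 'a::euclidean_space \<Rightarrow> real \<Rightarrow> 'a \<Rightarrow> real \<Rightarrow> real" where
  "dirac_mass \<delta> h\<^sub>0 x\<^sub>0 h\<^sub>1 x\<^sub>1 t =
     (let \<theta> = half_angle \<delta> x\<^sub>0 x\<^sub>1;
          A = h\<^sub>0 + h\<^sub>1 - 2 * sqrt (h\<^sub>0 * h\<^sub>1) * cos \<theta>;
          B = h\<^sub>0 - sqrt (h\<^sub>0 * h\<^sub>1) * cos \<theta>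
      in A * t\<^sup>2 - 2 * B * t + h\<^sub>0)"

text \<open>\<^const>\<open>sgn\<close> of a vector is its normalization, with \<open>sgn 0 = 0\<close>.\<close>

definition dirac_momentum ::
    "real \<Rightarrow> real \<Rightarrow> 'a::euclidean_space \<Rightarrow> real \<Rightarrow> 'a \<Rightarrow> 'a" where
  "dirac_momentum \<delta> h\<^sub>0 x\<^sub>0 h\<^sub>1 x\<^sub>1 =
     (2 * \<delta> * sqrt (h\<^sub>0 * h\<^sub>1) * sin (half_angle \<delta> x\<^sub>0 x\<^sub>1)) *\<^sub>R sgn (x\<^sub>1 - x\<^sub>0)"

text \<open>The solution of \<open>h x' = \<omega>\<^sub>0\<close>, \<open>x(0) = x\<^sub>0\<close> on \<open>[0,1]\<close>; it is unique there since \<open>h > 0\<close>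
  when both masses are positive and \<open>|x\<^sub>0 - x\<^sub>1| < \<pi>\<delta>\<close>.\<close>

definition dirac_position ::
    "real \<Rightarrow> real \<Rightarrow> 'a::euclidean_space \<Rightarrow> real \<Rightarrow> 'a \<Rightarrow> real \<Rightarrow> 'a" where
  "dirac_position \<delta> h\<^sub>0 x\<^sub>0 h\<^sub>1 x\<^sub>1 =
     (SOME x. x 0 = x\<^sub>0 \<and>
        (\<forall>t\<in>{0..1}. \<exists>v. (x has_vector_derivative v) (at t within {0..1}) \<and>
           dirac_mass \<delta> h\<^sub>0 x\<^sub>0 h\<^sub>1 x\<^sub>1 t *\<^sub>R v = dirac_momentum \<delta> h\<^sub>0 x\<^sub>0 h\<^sub>1 x\<^sub>1))"

definition dirac_geodesic ::
    "real \<Rightarrow> real \<Rightarrow> 'a::euclidean_space \<Rightarrow> real \<Rightarrow> 'a \<Rightarrow> (real \<times> 'a) set \<Rightarrow> real" where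
  "dirac_geodesic \<delta> h\<^sub>0 x\<^sub>0 h\<^sub>1 x\<^sub>1 =
     (if 0 < h\<^sub>0 \<and> 0 < h\<^sub>1
      then tensor_dt (\<lambda>t A. dirac_mass \<delta> h\<^sub>0 x\<^sub>0 h\<^sub>1 x\<^sub>1 t * dirac (dirac_position \<delta> h\<^sub>0 x\<^sub>0 h\<^sub>1 x\<^sub>1 t) A)
      else tensor_dt (\<lambda>t A. t\<^sup>2 * h\<^sub>1 * dirac x\<^sub>1 A + (1 - t)\<^sup>2 * h\<^sub>0 * dirac x\<^sub>0 A))"

end

theory Submission
  imports Defs
begin

text \<open>\<^bold>\<open>The cone picture.\<close> For a moving Dirac mass put \<open>h = r^2\<close> and let \<open>\<theta>\<close> be the position divided by
\<open>2\<delta>\<close>. Along such a mass the integrand of the action is \<open>2\<delta>^2 (r'^2 + r^2 \<theta>'^2)\<close>: up to the factor it is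
the squared speed, in polar coordinates, of a point \<open>P(t)\<close> of the Euclidean plane. Two masses
at distance less than \<open>\<pi>\<delta>\<close> are two points \<open>P\<^sub>0\<close>, \<open>P\<^sub>1\<close> at an angle less than \<open>\<pi>/2\<close>; the optimal motion
is the segment from \<open>P\<^sub>0\<close> to \<open>P\<^sub>1\<close>, its cost is \<open>2\<delta>^2 |P\<^sub>1 - P\<^sub>0|^2\<close> (\<open>pair_cost\<close>
below), and the mass and position of the Dirac geodesic are the polar coordinates of
\<open>(1-t) P\<^sub>0 + t P\<^sub>1\<close>. When one mass is zero the segment is radial.

\<^bold>\<open>Minimality.\<close> The proof is by convex duality. A potential \<open>\<phi>\<close> with
\<open>\<phi>_t + (|\<nabla>\<phi>|^2 + \<phi>^2/\<delta>^2)/2 \<le> 0\<close> bounds the action from below by its boundary terms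
(\<open>action_lower_bound\<close>). In the plane a quadratic form \<open>P \<mapsto> P \<cdot> m(t)P\<close> yields equality when
\<open>m' = -m^2/(2\<delta>^2)\<close>, that is \<open>m(t) = 2\<delta>^2 (K-1)(1 + t(K-1))^(-1)\<close>, and the bound is attained by the
pair when \<open>K P\<^sub>0 = P\<^sub>1\<close>. Take \<open>K\<close> with eigenvalues \<open>\<kappa>\<close>, \<open>k\<close> and first eigenvector at angle
\<open>c/(2\<delta>)\<close>. On the unit circle the form is \<open>m_k + (m_\<kappa> - m_k) cos^2\<close>, with the angle measured from \<open>c\<close>.
Since \<open>cos^2\<close> vanishes to second order at \<open>\<pi>/2\<close>, this function of the distance to \<open>c\<close> stays \<open>C^1\<close> when
continued by the constant \<open>m_k(t)\<close> beyond distance \<open>\<pi>\<delta>\<close>, and it still solves the Hamilton-Jacobi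
equation. The equation \<open>K P\<^sub>0 = P\<^sub>1\<close> is solvable for every sufficiently large \<open>k\<close>. One value of \<open>k\<close>
therefore serves all pairs simultaneously, the balls of radius \<open>\<pi>\<delta>\<close> about the centres are disjoint
by the separation hypothesis, and the pieces fit together to a global solution that is optimal
for every pair (\<open>cert_hamilton_jacobi\<close>, \<open>dirac_pair.pair_value\<close>). For a pair with a vanishing mass
the optimal \<open>\<kappa>\<close> would be \<open>0\<close> or \<open>\<infinity>\<close>, and the bound is reached in the limit
(\<open>total_lower_bound\<close>). That the sum of the explicit curves has exactly this action is
\<open>superposition_minimal_candidate\<close>.

\<^bold>\<open>Uniqueness.\<close> If all masses are positive, the potentials \<open>\<phi>_k\<close> are exactly optimal for all large \<open>k\<close>,
and equality in the duality forces \<open>\<omega> = \<nabla>\<phi>_k \<rho>\<close> and \<open>\<zeta> = \<phi>_k \<rho>/\<delta>^2\<close> for every minimizer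
(\<open>action_optimal\<close>). Outside the balls \<open>\<phi>_k\<close> is strictly increasing in \<open>k\<close>, so \<open>\<rho>\<close> does not charge their complement
(\<open>minimizer.inside_some_ball\<close>). Inside a ball, \<open>\<rho>\<close> solves a linear transport equation with explicit
invariants, and an invariant that vanishes exactly on the sphere about the centre through the
moving point shows that \<open>\<rho>\<close> lives on that sphere (\<open>minimizer.on_sphere_AE\<close>). The centres for two
different \<open>k\<close> lie on a line through the moving point, so the two spheres touch at this point only
(\<open>spheres_tangent\<close>) and \<open>\<rho>\<close> is carried by the explicit curves. Finally the transport equation
determines its distribution in time (\<open>minimizer.marginal_eq\<close>).\<close>

section \<open>Jordan decomposition of signed measures\<close>

lemma signed_measures_sums:
  "\<nu> \<in> signed_measures X \<Longrightarrow> range A \<subseteq> sets borel \<Longrightarrow> disjoint_family A \<Longrightarrow>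
     (\<lambda>n. \<nu> (A n)) sums \<nu> (\<Union>n. A n)"
  unfolding signed_measures_def by blast

lemma signed_measures_null:
  "\<nu> \<in> signed_measures X \<Longrightarrow> A \<in> sets borel \<Longrightarrow> A \<inter> X = {} \<Longrightarrow> \<nu> A = 0"
  unfolding signed_measures_def by simp

lemma signed_measures_empty:
  assumes "\<nu> \<in> signed_measures X" shows "\<nu> {} = 0"
proof -
  have "(\<lambda>n. \<nu> ((\<lambda>_::nat. {}) n)) sums \<nu> (\<Union>n::nat. {})"
    using assms unfolding signed_measures_def disjoint_family_on_def
    by (force simp: image_subset_iff)
  then have "(\<lambda>n::nat. \<nu> {}) sums \<nu> {}" by simp
  then have "(\<lambda>n::nat. \<nu> {}) \<longlonglongrightarrow> 0" using summable_LIMSEQ_zero sums_summable by blast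
  then show ?thesis by (simp add: LIMSEQ_const_iff)
qed

lemma signed_measures_Un:
  assumes \<nu>: "\<nu> \<in> signed_measures X" and "A \<in> sets borel" "B \<in> sets borel" "A \<inter> B = {}"
  shows "\<nu> (A \<union> B) = \<nu> A + \<nu> B"
proof -
  have "disjoint_family (binaryset A B)"
    using assms by (auto simp: disjoint_family_on_def binaryset_def)
  moreover have "range (binaryset A B) \<subseteq> sets borel" using assms by (simp add: range_binaryset_eq)
  ultimately have "(\<lambda>n. \<nu> (binaryset A B n)) sums \<nu> (\<Union>n. binaryset A B n)"
    using \<nu> unfolding signed_measures_def by blast
  moreover have "(\<lambda>n. \<nu> (binaryset A B n)) sums (\<nu> A + \<nu> B)"
    by (rule binaryset_sums) (rule signed_measures_empty[OF \<nu>])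
  ultimately show ?thesis by (simp add: UN_binaryset_eq sums_unique2)
qed

lemma signed_measures_Diff:
  assumes \<nu>: "\<nu> \<in> signed_measures X" and "A \<in> sets borel" "B \<in> sets borel" "B \<subseteq> A"
  shows "\<nu> (A - B) = \<nu> A - \<nu> B"
proof -
  have "\<nu> (B \<union> (A - B)) = \<nu> B + \<nu> (A - B)"
    using assms by (intro signed_measures_Un[OF \<nu>]) auto
  moreover have "B \<union> (A - B) = A" using assms by auto
  ultimately show ?thesis by simp
qed

lemma signed_measures_uminus:
  "\<nu> \<in> signed_measures X \<Longrightarrow> (\<lambda>A. - \<nu> A) \<in> signed_measures X"
  unfolding signed_measures_def by (auto intro: sums_minus)

text \<open>If \<open>\<nu>\<close> is unbounded on the subsets of \<open>E\<close>, some \<open>A \<subseteq> E\<close> has \<open>|\<nu> A|\<close> so large that \<open>|\<nu> (E - A)|\<close> exceeds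
\<open>1\<close> as well, and \<open>\<nu>\<close> is still unbounded below one of the two halves. Iterating with that half leaves
infinitely many disjoint sets of measure at least \<open>1\<close> in absolute value, whose measures cannot be
summable.\<close>

lemma signed_measures_bounded:
  assumes \<nu>: "\<nu> \<in> signed_measures X"
  shows "\<exists>C. \<forall>A\<in>sets borel. \<bar>\<nu> A\<bar> \<le> C"
proof (rule ccontr)
  define unb where "unb E \<longleftrightarrow> E \<in> sets borel \<and> (\<forall>C. \<exists>A\<in>sets borel. A \<subseteq> E \<and> \<bar>\<nu> A\<bar> > C)" for E
  assume "\<not> ?thesis"
  then have inf0: "unb UNIV" unfolding unb_def by (auto simp: not_le)
  have step: "\<exists>E'. unb E' \<and> E' \<subseteq> E \<and> \<bar>\<nu> (E - E')\<bar> > 1" if E: "unb E" for E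
  proof -
    have Em: "E \<in> sets borel" using E unfolding unb_def by blast
    obtain A where A: "A \<in> sets borel" "A \<subseteq> E" "\<bar>\<nu> A\<bar> > 1 + \<bar>\<nu> E\<bar>"
      using E unfolding unb_def by blast
    have d: "\<nu> (E - A) = \<nu> E - \<nu> A" using signed_measures_Diff[OF \<nu> Em A(1,2)] .
    have "unb A \<or> unb (E - A)"
    proof (rule ccontr)
      assume "\<not> ?thesis"
      then have n: "\<not> unb A" "\<not> unb (E - A)" by auto
      have AE: "E - A \<in> sets borel" using A(1) Em by auto
      obtain C1 where C1: "\<forall>B\<in>sets borel. B \<subseteq> A \<longrightarrow> \<bar>\<nu> B\<bar> \<le> C1"
        using n(1) A(1) unfolding unb_def by (meson not_le)
      obtain C2 where C2: "\<forall>B\<in>sets borel. B \<subseteq> E - A \<longrightarrow> \<bar>\<nu> B\<bar> \<le> C2"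
        using n(2) AE unfolding unb_def by (meson not_le)
      obtain B where B: "B \<in> sets borel" "B \<subseteq> E" "\<bar>\<nu> B\<bar> > C1 + C2"
        using E unfolding unb_def by blast
      have "\<nu> ((B \<inter> A) \<union> (B - A)) = \<nu> (B \<inter> A) + \<nu> (B - A)"
        using A B by (intro signed_measures_Un[OF \<nu>]) auto
      moreover have "\<nu> ((B \<inter> A) \<union> (B - A)) = \<nu> B" by (rule arg_cong[of _ _ \<nu>]) blast
      moreover have "\<bar>\<nu> (B \<inter> A)\<bar> \<le> C1" "\<bar>\<nu> (B - A)\<bar> \<le> C2"
        using C1[rule_format, of "B \<inter> A"] C2[rule_format, of "B - A"] A(1) B(1,2)
        by (simp_all add: sets.Int sets.Diff Diff_mono)
      ultimately show False using B(3) by linarith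
    qed
    then show ?thesis
    proof
      assume "unb A"
      moreover have "\<bar>\<nu> (E - A)\<bar> > 1" using d A(3) by linarith
      ultimately show ?thesis using A by blast
    next
      assume "unb (E - A)"
      moreover have "E - (E - A) = A" using A by auto
      moreover have "\<bar>\<nu> A\<bar> > 1" using A by linarith
      ultimately show ?thesis by (intro exI[of _ "E - A"]) auto
    qed
  qed
  obtain F :: "nat \<Rightarrow> 'a set" where F: "\<And>n. unb (F n)" "\<And>n. F (Suc n) \<subseteq> F n \<and> \<bar>\<nu> (F n - F (Suc n))\<bar> > 1"
  proof -
    have "\<exists>f. \<forall>n. unb (f n) \<and> (f (Suc n) \<subseteq> f n \<and> \<bar>\<nu> (f n - f (Suc n))\<bar> > 1)"
    proof (rule dependent_nat_choice)
      show "\<exists>x. unb x" using inf0 by blast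
      show "\<exists>y. unb y \<and> y \<subseteq> x \<and> \<bar>\<nu> (x - y)\<bar> > 1" if "unb x" for x and n :: nat using step[OF that] by blast
    qed
    then show ?thesis using that by blast
  qed
  define D where "D n = F n - F (Suc n)" for n
  have Fm: "F n \<in> sets borel" for n using F(1) unfolding unb_def by blast
  have mono: "F n \<subseteq> F m" if "m \<le> n" for m n
    using that F(2) by (rule_tac lift_Suc_antimono_le[of F]) auto
  have "disjoint_family D"
    unfolding disjoint_family_on_def
  proof (intro ballI impI)
    fix m n :: nat assume "m \<noteq> n"
    then consider "Suc m \<le> n" | "Suc n \<le> m" by linarith
    then show "D m \<inter> D n = {}" unfolding D_def by cases (use mono in blast)+
  qed
  moreover have "range D \<subseteq> sets borel" using Fm unfolding D_def by auto
  ultimately have "(\<lambda>n. \<nu> (D n)) sums \<nu> (\<Union>n. D n)"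
    using \<nu> unfolding signed_measures_def by blast
  then have "(\<lambda>n. \<nu> (D n)) \<longlonglongrightarrow> 0" using summable_LIMSEQ_zero sums_summable by blast
  then have "\<exists>n. \<bar>\<nu> (D n)\<bar> < 1" using LIMSEQ_D[of "\<lambda>n. \<nu> (D n)" 0 1] by force
  then show False using F(2) unfolding D_def by (meson less_asym)
qed

lemma ennreal_add_le: "ennreal (a + b) \<le> ennreal a + ennreal b"
proof (cases "0 \<le> a \<and> 0 \<le> b")
  case False
  then consider "a < 0" | "b < 0" by linarith
  then show ?thesis
    by cases (auto simp: ennreal_neg intro!: ennreal_leI)
qed (simp add: ennreal_plus)

lemma ennreal_sum_le: "ennreal (\<Sum>i<(n::nat). f i) \<le> (\<Sum>i<n. ennreal (f i))"
proof (induction n)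
  case (Suc n)
  show ?case using order_trans[OF ennreal_add_le add_mono[OF Suc order_refl]] by simp
qed simp

lemma sets_upper_variation [simp]: "sets (upper_variation \<nu>) = sets borel"
  unfolding upper_variation_def by (subst sets_measure_of) (use sets.sigma_sets_eq[of borel] in auto)

text \<open>\<open>measure_of\<close> returns the prescribed set function only if it is countably additive. Superadditivity of
the supremum comes from uniting subsets of disjoint sets, subadditivity from cutting a subset of
the union into its traces.\<close>

lemma emeasure_upper_variation:
  assumes \<nu>: "\<nu> \<in> signed_measures X" and A: "A \<in> sets borel"
  shows "emeasure (upper_variation \<nu>) A = (SUP B\<in>{B \<in> sets borel. B \<subseteq> A}. ennreal (\<nu> B))"
proof -
  define u where "u A = (SUP B\<in>{B \<in> sets borel. B \<subseteq> A}. ennreal (\<nu> B))" for A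
  have uI: "ennreal (\<nu> B) \<le> u A" if "B \<in> sets borel" "B \<subseteq> A" for A B
    unfolding u_def using that by (intro SUP_upper) auto
  have add: "u A + u B \<le> u C" if d: "A \<inter> B = {}" and s: "A \<union> B \<subseteq> C" for A B C
  proof -
    have "ennreal (\<nu> S) + ennreal (\<nu> T) \<le> u C"
      if "S \<in> sets borel" "S \<subseteq> A" "T \<in> sets borel" "T \<subseteq> B" for S T
    proof -
      have "\<nu> (S \<union> T) = \<nu> S + \<nu> T"
        using that d by (intro signed_measures_Un[OF \<nu>]) auto
      then have 1: "ennreal (\<nu> S + \<nu> T) \<le> u C"
        using uI[of "S \<union> T" C] that s by auto
      have 2: "ennreal (\<nu> S) \<le> u C" "ennreal (\<nu> T) \<le> u C"
        using that s by (auto intro!: uI)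
      show ?thesis
      proof (cases "0 \<le> \<nu> S \<and> 0 \<le> \<nu> T")
        case True then show ?thesis using 1 by (simp add: ennreal_plus)
      next
        case False
        then consider "\<nu> S < 0" | "\<nu> T < 0" by linarith
        then show ?thesis using 2 by cases (auto simp: ennreal_neg)
      qed
    qed
    note * = this
    have "ennreal (\<nu> S) + u B \<le> u C" if "S \<in> sets borel" "S \<subseteq> A" for S
      unfolding u_def[of B]
      using *[OF that] by (subst ennreal_SUP_add_right) (auto intro!: SUP_least)
    then show ?thesis
      unfolding u_def[of A]
      by (subst ennreal_SUP_add_left[symmetric]) (auto intro!: SUP_least)
  qed
  have ca: "countably_additive (sets borel) u"
    unfolding countably_additive_def
  proof (intro allI impI antisym)
    fix A :: "nat \<Rightarrow> 'a set"
    assume A: "range A \<subseteq> sets borel" "disjoint_family A" "\<Union> (range A) \<in> sets borel"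
    have "(\<Sum>i<n. u (A i)) \<le> u (\<Union>i<n. A i)" for n
    proof (induction n)
      case (Suc n)
      have "(\<Sum>i<Suc n. u (A i)) \<le> u (\<Union>i<n. A i) + u (A n)"
        unfolding sum.lessThan_Suc by (rule add_right_mono[OF Suc])
      also have "\<dots> \<le> u (\<Union>i<Suc n. A i)"
      proof (rule add)
        have "A i \<inter> A n = {}" if "i < n" for i
          using A(2) that by (intro disjoint_family_onD) auto
        then show "(\<Union>i<n. A i) \<inter> A n = {}" by blast
        show "(\<Union>i<n. A i) \<union> A n \<subseteq> (\<Union>i<Suc n. A i)" by (auto simp: lessThan_Suc)
      qed
      finally show ?case .
    qed simp
    moreover have "u (\<Union>i<n. A i) \<le> u (\<Union> (range A))" for n
      unfolding u_def by (rule SUP_subset_mono) blast+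
    ultimately have "(\<Sum>i<n. u (A i)) \<le> u (\<Union> (range A))" for n
      by (rule order_trans)
    then show "(\<Sum>i. u (A i)) \<le> u (\<Union> (range A))"
      by (intro suminf_le_const) auto
    show "u (\<Union> (range A)) \<le> (\<Sum>i. u (A i))"
      unfolding u_def[of "\<Union> (range A)"]
    proof (rule SUP_least, clarify)
      fix B assume B: "B \<in> sets borel" "B \<subseteq> \<Union> (range A)"
      have "(\<lambda>n. \<nu> (B \<inter> A n)) sums \<nu> (\<Union>n. B \<inter> A n)"
      proof -
        have "range (\<lambda>n. B \<inter> A n) \<subseteq> sets borel" using A B by auto
        moreover have "disjoint_family (\<lambda>n. B \<inter> A n)"
          using A(2) by (auto simp: disjoint_family_on_def)
        ultimately show ?thesis by (rule signed_measures_sums[OF \<nu>])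
      qed
      moreover have "(\<Union>n. B \<inter> A n) = B" using B by auto
      ultimately have "(\<lambda>n. \<Sum>i<n. \<nu> (B \<inter> A i)) \<longlonglongrightarrow> \<nu> B" unfolding sums_def by simp
      then have "(\<lambda>n. ennreal (\<Sum>i<n. \<nu> (B \<inter> A i))) \<longlonglongrightarrow> ennreal (\<nu> B)"
        by (rule tendsto_ennrealI)
      moreover have "ennreal (\<Sum>i<n. \<nu> (B \<inter> A i)) \<le> (\<Sum>i. u (A i))" for n
      proof -
        have "ennreal (\<Sum>i<n. \<nu> (B \<inter> A i)) \<le> (\<Sum>i<n. ennreal (\<nu> (B \<inter> A i)))"
          by (rule ennreal_sum_le)
        also have "\<dots> \<le> (\<Sum>i<n. u (A i))"
          using A B by (intro sum_mono uI) auto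
        also have "\<dots> \<le> (\<Sum>i. u (A i))" by (intro sum_le_suminf) auto
        finally show ?thesis .
      qed
      ultimately show "ennreal (\<nu> B) \<le> (\<Sum>i. u (A i))"
        by (intro LIMSEQ_le_const2) auto
    qed
  qed
  have emp: "u {} = 0" unfolding u_def using signed_measures_empty[OF \<nu>]
    by (intro antisym SUP_least) auto
  have eq: "upper_variation \<nu> = measure_of UNIV (sets borel) u"
    unfolding upper_variation_def u_def by simp
  have "emeasure (upper_variation \<nu>) A = u A"
    by (rule emeasure_measure_of[OF eq]) (use ca emp A in \<open>auto simp: positive_def\<close>)
  then show ?thesis unfolding u_def .
qed

lemma finite_upper_variation:
  assumes \<nu>: "\<nu> \<in> signed_measures X"
  shows "finite_measure (upper_variation \<nu>)"
proof
  obtain C where C: "\<And>A. A \<in> sets borel \<Longrightarrow> \<bar>\<nu> A\<bar> \<le> C"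
    using signed_measures_bounded[OF \<nu>] by blast
  have "space (upper_variation \<nu>) = UNIV" using sets_eq_imp_space_eq[OF sets_upper_variation] by simp
  moreover have "(SUP B\<in>{B \<in> sets borel. B \<subseteq> UNIV}. ennreal (\<nu> B)) \<le> ennreal C"
    using C by (intro SUP_least ennreal_leI) (auto simp: abs_le_iff)
  ultimately have "emeasure (upper_variation \<nu>) (space (upper_variation \<nu>)) \<le> ennreal C"
    using emeasure_upper_variation[OF \<nu>, of UNIV] by simp
  then show "emeasure (upper_variation \<nu>) (space (upper_variation \<nu>)) \<noteq> \<infinity>"
    by (metis ennreal_neq_top infinity_ennreal_def neq_top_trans)
qed

text \<open>Passing from \<open>B\<close> to \<open>A - B\<close> turns the supremum of \<open>\<nu>\<close> over subsets of \<open>A\<close> into that of \<open>-\<nu>\<close>, shifted by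
\<open>\<nu> A\<close>.\<close>

lemma jordan_decomposition:
  assumes \<nu>: "\<nu> \<in> signed_measures X" and A: "A \<in> sets borel"
  shows "\<nu> A = measure (upper_variation \<nu>) A - measure (upper_variation (\<lambda>A. - \<nu> A)) A"
proof -
  have *: "measure (upper_variation \<nu>) A \<le> \<nu> A + measure (upper_variation (\<lambda>A. - \<nu> A)) A"
    if \<nu>: "\<nu> \<in> signed_measures X" for \<nu>
  proof -
    note \<nu>' = signed_measures_uminus[OF \<nu>]
    have em: "emeasure (upper_variation \<nu>') A = ennreal (measure (upper_variation \<nu>') A)"
      if "\<nu>' \<in> signed_measures X" for \<nu>'
      using finite_measure.emeasure_eq_measure[OF finite_upper_variation[OF that]] .
    have le: "\<nu>' B \<le> measure (upper_variation \<nu>') A"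
      if "\<nu>' \<in> signed_measures X" "B \<in> sets borel" "B \<subseteq> A" for \<nu>' B
    proof -
      have "ennreal (\<nu>' B) \<le> emeasure (upper_variation \<nu>') A"
        unfolding emeasure_upper_variation[OF that(1) A] using that by (intro SUP_upper) auto
      then show ?thesis using em[OF that(1)] by (metis ennreal_le_iff measure_nonneg)
    qed
    have "ennreal (\<nu> B) \<le> ennreal (\<nu> A + measure (upper_variation (\<lambda>A. - \<nu> A)) A)"
      if "B \<in> sets borel" "B \<subseteq> A" for B
    proof (rule ennreal_leI)
      have "- \<nu> (A - B) \<le> measure (upper_variation (\<lambda>A. - \<nu> A)) A"
        using le[OF \<nu>', of "A - B"] A that by (simp add: sets.Diff)
      then show "\<nu> B \<le> \<nu> A + measure (upper_variation (\<lambda>A. - \<nu> A)) A"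
        using signed_measures_Diff[OF \<nu> A that] by linarith
    qed
    then have "emeasure (upper_variation \<nu>) A \<le> ennreal (\<nu> A + measure (upper_variation (\<lambda>A. - \<nu> A)) A)"
      unfolding emeasure_upper_variation[OF \<nu> A] by (intro SUP_least) auto
    moreover have "0 \<le> \<nu> A + measure (upper_variation (\<lambda>A. - \<nu> A)) A"
      using le[OF \<nu>' A order_refl] by linarith
    ultimately show ?thesis using em[OF \<nu>] by (metis ennreal_le_iff)
  qed
  from *[OF signed_measures_uminus[OF \<nu>]]
  have "measure (upper_variation (\<lambda>A. - \<nu> A)) A \<le> - \<nu> A + measure (upper_variation \<nu>) A"
    by (simp only: minus_minus)
  with *[OF \<nu>] show ?thesis by linarith
qed

section \<open>Measures given by a density\<close>

lemma has_density_integrable: "has_density \<nu> M g \<Longrightarrow> integrable M g"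
  unfolding has_density_def by simp

lemma has_density_eq: "has_density \<nu> M g \<Longrightarrow> A \<in> sets borel \<Longrightarrow> \<nu> A = (LINT p:A|M. g p)"
  unfolding has_density_def by simp

text \<open>The supremum of \<open>\<nu> B\<close> over \<open>B \<subseteq> A\<close> is attained at \<open>A \<inter> {g \<ge> 0\<close>}. The coercion to \<open>ennreal\<close> truncates
negative values, so the density on the right is the positive part of \<open>g\<close>.\<close>

lemma upper_variation_density:
  fixes g :: "'b::topological_space \<Rightarrow> real"
  assumes dens: "has_density \<nu> M g" and sets[measurable_cong]: "sets M = sets borel"
  shows "upper_variation \<nu> = density M (\<lambda>x. ennreal (g x))"
proof -
  have sp: "space M = UNIV" using sets_eq_imp_space_eq[OF sets] by simp
  have int: "integrable M g" and \<nu>: "\<And>A. A \<in> sets borel \<Longrightarrow> \<nu> A = (LINT x:A|M. g x)"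
    using dens unfolding has_density_def by auto
  note [measurable] = borel_measurable_integrable[OF int]
  let ?P = "{x. 0 \<le> g x}"
  have P[measurable]: "?P \<in> sets borel"
    using measurable_sets[OF borel_measurable_integrable[OF int], of "{0..}"] sets sp by (simp add: vimage_def)
  have pos: "(\<integral>\<^sup>+x\<in>A. ennreal (g x) \<partial>M) = ennreal (LINT x:A \<inter> ?P|M. g x)"
    if [measurable]: "A \<in> sets borel" for A
  proof -
    have "(\<integral>\<^sup>+x\<in>A. ennreal (g x) \<partial>M) = (\<integral>\<^sup>+x\<in>A \<inter> ?P. ennreal (g x) \<partial>M)"
      by (intro nn_integral_cong) (auto simp: indicator_def ennreal_neg)
    also have "\<dots> = ennreal (LINT x:A \<inter> ?P|M. g x)"
      by (rule nn_set_integral_eq_set_integral[OF int]) (auto simp: sets)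
    finally show ?thesis .
  qed
  have eq: "(SUP B\<in>{B \<in> sets borel. B \<subseteq> A}. ennreal (\<nu> B)) = emeasure (density M (\<lambda>x. ennreal (g x))) A"
    if A: "A \<in> sets borel" for A
  proof -
    have e: "emeasure (density M (\<lambda>x. ennreal (g x))) A = ennreal (\<nu> (A \<inter> ?P))"
      using A P by (subst emeasure_density) (auto simp: pos \<nu> sets)
    have "\<nu> B \<le> \<nu> (A \<inter> ?P)" if "B \<in> sets borel" "B \<subseteq> A" for B
      unfolding \<nu>[OF that(1)] \<nu>[OF sets.Int[OF A P]] set_lebesgue_integral_def
      by (intro integral_mono integrable_mult_indicator int)
         (use A P that in \<open>auto simp: sets indicator_def\<close>)
    then show ?thesis unfolding e using A P
      by (intro antisym SUP_least SUP_upper ennreal_leI) auto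
  qed
  have "upper_variation \<nu> = measure_of UNIV (sets borel) (emeasure (density M (\<lambda>x. ennreal (g x))))"
    unfolding upper_variation_def
    by (rule measure_of_eq) (auto simp: eq sets.sigma_sets_eq[of borel, simplified])
  also have "\<dots> = density M (\<lambda>x. ennreal (g x))"
    using measure_of_of_measure[of "density M (\<lambda>x. ennreal (g x))"] by (simp add: sets sp)
  finally show ?thesis .
qed

lemma integral_density_positive_part:
  fixes f :: "'b \<Rightarrow> 'c::{banach, second_countable_topology}"
  assumes [measurable]: "f \<in> borel_measurable M" "g \<in> borel_measurable M"
  shows "integral\<^sup>L (density M (\<lambda>x. ennreal (g x))) f = (LINT x|M. max 0 (g x) *\<^sub>R f x)"
proof -
  have "density M (\<lambda>x. ennreal (g x)) = density M (\<lambda>x. ennreal (max 0 (g x)))"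
    by (intro arg_cong[of _ _ "density M"] ext) (auto simp: max_def ennreal_neg)
  then show ?thesis by (simp only:) (subst integral_density, auto)
qed

lemma has_density_uminus: "has_density \<nu> M g \<Longrightarrow> has_density (\<lambda>A. - \<nu> A) M (\<lambda>x. - g x)"
  unfolding has_density_def set_lebesgue_integral_def by auto

lemma set_integrable_continuous_mult:
  fixes f :: "'b::topological_space \<Rightarrow> real" and g :: "'b \<Rightarrow> real"
  assumes int: "integrable M g" and sets: "sets M = sets borel"
    and X: "compact X" "X \<in> sets borel" "continuous_on X f"
  shows "integrable M (\<lambda>x. (indicator X x *\<^sub>R f x) * g x)"
proof -
  have m: "(\<lambda>x. indicator X x *\<^sub>R f x) \<in> borel_measurable M"
    unfolding measurable_cong_sets[OF sets refl] by (rule borel_measurable_continuous_on_indicator[OF X(2,3)])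
  obtain C where C: "\<And>x. x \<in> X \<Longrightarrow> \<bar>f x\<bar> \<le> C"
    using compact_imp_bounded[OF compact_continuous_image[OF X(3,1)]] unfolding bounded_iff by auto
  have le: "\<bar>indicator X x *\<^sub>R f x\<bar> \<le> max C 0" for x
    using C[of x] by (cases "x \<in> X") auto
  show ?thesis
  proof (rule Bochner_Integration.integrable_bound)
    show "integrable M (\<lambda>x. max C 0 * g x)" by (rule integrable_mult_right[OF int])
    show "(\<lambda>x. (indicator X x *\<^sub>R f x) * g x) \<in> borel_measurable M"
      by (rule borel_measurable_times[OF m borel_measurable_integrable[OF int]])
    have "norm ((indicator X x *\<^sub>R f x) * g x) \<le> norm (max C 0 * g x)" for x
      unfolding norm_mult using le[of x] by (intro mult_right_mono) auto
    then show "AE x in M. norm ((indicator X x *\<^sub>R f x) * g x) \<le> norm (max C 0 * g x)" by simp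
  qed
qed

text \<open>This reduces the pairings in the continuity equation to ordinary Bochner integrals.\<close>

lemma signed_integral_density:
  fixes f :: "'b::topological_space \<Rightarrow> real"
  assumes dens: "has_density \<nu> M g" and sets: "sets M = sets borel"
    and X: "compact X" "X \<in> sets borel" "continuous_on X f"
  shows "set_integrable M X (\<lambda>x. f x * g x)"
    and "signed_integral X \<nu> f = (LINT x:X|M. f x * g x)"
proof -
  have int: "integrable M g" using dens unfolding has_density_def by auto
  let ?f = "\<lambda>x. indicator X x *\<^sub>R f x"
  have m[measurable]: "?f \<in> borel_measurable M"
    unfolding measurable_cong_sets[OF sets refl] by (rule borel_measurable_continuous_on_indicator[OF X(2,3)])
  note [measurable] = borel_measurable_integrable[OF int]
  note I = set_integrable_continuous_mult[OF int sets X]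
  then show "set_integrable M X (\<lambda>x. f x * g x)"
    unfolding set_integrable_def by (simp add: mult.assoc)
  have Ip: "integrable M (\<lambda>x. max 0 (h x) *\<^sub>R ?f x)" if h: "integrable M h" for h
  proof -
    have "integrable M (\<lambda>x. max 0 (h x))" using h by simp
    then show ?thesis using set_integrable_continuous_mult[OF _ sets X] by (simp add: mult.commute)
  qed
  have "signed_integral X \<nu> f = (LINT x|M. max 0 (g x) *\<^sub>R ?f x) - (LINT x|M. max 0 (- g x) *\<^sub>R ?f x)"
    unfolding signed_integral_def upper_variation_density[OF dens sets]
      upper_variation_density[OF has_density_uminus[OF dens] sets] set_lebesgue_integral_def
    by (subst (1 2) integral_density_positive_part) (use m in auto)
  also have "\<dots> = (LINT x|M. max 0 (g x) *\<^sub>R ?f x - max 0 (- g x) *\<^sub>R ?f x)"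
    by (intro Bochner_Integration.integral_diff[symmetric] Ip) (use int in auto)
  also have "\<dots> = (LINT x:X|M. f x * g x)"
    unfolding set_lebesgue_integral_def
    by (intro Bochner_Integration.integral_cong) (auto simp: max_def)
  finally show "signed_integral X \<nu> f = (LINT x:X|M. f x * g x)" .
qed

lemma set_lebesgue_integral_inner:
  fixes w :: "'b \<Rightarrow> 'a::euclidean_space"
  assumes "integrable M w" "A \<in> sets M"
  shows "(LINT x:A|M. w x \<bullet> b) = (LINT x:A|M. w x) \<bullet> b"
proof -
  have "integrable M (\<lambda>x. indicator A x *\<^sub>R w x)"
    using assms by (intro integrable_mult_indicator) auto
  from integral_inner_left[OF this, of b] show ?thesis
    unfolding set_lebesgue_integral_def by simp
qed

lemma has_density_inner:
  fixes w :: "'b::topological_space \<Rightarrow> 'a::euclidean_space"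
  assumes "has_density \<omega> M w" "sets M = sets borel"
  shows "has_density (\<lambda>A. \<omega> A \<bullet> b) M (\<lambda>x. w x \<bullet> b)"
  using assms unfolding has_density_def by (auto simp: set_lebesgue_integral_inner)

lemma vector_integral_density:
  fixes f :: "'b::topological_space \<Rightarrow> 'a::euclidean_space"
  assumes dens: "has_density \<omega> M w" and sets: "sets M = sets borel"
    and X: "compact X" "X \<in> sets borel" "continuous_on X f"
  shows "set_integrable M X (\<lambda>x. f x \<bullet> w x)"
    and "vector_integral X \<omega> f = (LINT x:X|M. f x \<bullet> w x)"
proof -
  have c: "continuous_on X (\<lambda>x. f x \<bullet> b)" for b by (intro continuous_intros X)
  note d = has_density_inner[OF dens sets]
  note I = signed_integral_density[OF d sets X(1,2) c]
  have e: "f x \<bullet> w x = (\<Sum>b\<in>Basis. (f x \<bullet> b) * (w x \<bullet> b))" for x by (rule euclidean_inner)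
  show "set_integrable M X (\<lambda>x. f x \<bullet> w x)"
    unfolding e using I(1) unfolding set_integrable_def scaleR_sum_right by (intro Bochner_Integration.integrable_sum) auto
  show "vector_integral X \<omega> f = (LINT x:X|M. f x \<bullet> w x)"
    unfolding e vector_integral_def I(2) using I(1)
    unfolding set_integrable_def set_lebesgue_integral_def scaleR_sum_right
    by (intro Bochner_Integration.integral_sum[symmetric]) auto
qed

lemma exists_add_measure:
  fixes M N :: "'b::topological_space measure"
  assumes "finite_measure M" "finite_measure N" and sM: "sets M = sets borel" and sN: "sets N = sets borel"
  obtains K where "finite_measure K" "sets K = sets borel"
    "\<And>A. A \<in> sets borel \<Longrightarrow> emeasure K A = emeasure M A + emeasure N A"
proof -
  define K where "K = measure_of UNIV (sets borel) (\<lambda>A. emeasure M A + emeasure N A)"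
  have K: "sets K = sets borel"
    unfolding K_def by (subst sets_measure_of) (use sets.sigma_sets_eq[of borel] in auto)
  have e: "emeasure K A = emeasure M A + emeasure N A" if A: "A \<in> sets borel" for A
  proof (rule emeasure_measure_of[OF K_def])
    show "countably_additive (sets K) (\<lambda>A. emeasure M A + emeasure N A)"
      unfolding K countably_additive_def
    proof (intro allI impI)
      fix A :: "nat \<Rightarrow> 'b set"
      assume A: "range A \<subseteq> sets borel" "disjoint_family A"
      have "(\<Sum>i. emeasure M (A i) + emeasure N (A i)) = (\<Sum>i. emeasure M (A i)) + (\<Sum>i. emeasure N (A i))"
        by (rule suminf_add[symmetric]) auto
      then show "(\<Sum>i. emeasure M (A i) + emeasure N (A i)) = emeasure M (\<Union> (range A)) + emeasure N (\<Union> (range A))"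
        using A sM sN by (simp add: suminf_emeasure)
    qed
  qed (use A K in \<open>auto simp: positive_def\<close>)
  have "finite_measure K"
  proof
    have "emeasure K (space K) = emeasure M UNIV + emeasure N UNIV"
      using e[of UNIV] sets_eq_imp_space_eq[OF K] by simp
    then show "emeasure K (space K) \<noteq> \<infinity>"
      using finite_measure.emeasure_finite[OF assms(1)] finite_measure.emeasure_finite[OF assms(2)]
      by (simp add: ennreal_add_eq_top)
  qed
  then show ?thesis using that K e by blast
qed

text \<open>Radon--Nikodym with a finite, everywhere nonnegative density.\<close>

lemma density_of_le_measure:
  fixes M N :: "'b::topological_space measure"
  assumes fM: "finite_measure M" and fN: "finite_measure N"
    and sM: "sets M = sets borel" and sN: "sets N = sets borel"
    and le: "\<And>A. A \<in> sets borel \<Longrightarrow> emeasure N A \<le> emeasure M A"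
  obtains D where "D \<in> borel_measurable M" "\<And>x. 0 \<le> D x" "N = density M (\<lambda>x. ennreal (D x))"
proof -
  interpret M: finite_measure M by fact
  have ac: "absolutely_continuous M N"
    unfolding absolutely_continuous_def
  proof
    fix A assume "A \<in> null_sets M"
    then show "A \<in> null_sets N"
      using le[of A] sM sN by (auto simp: null_sets_def)
  qed
  have s: "sets N = sets M" using sM sN by simp
  obtain D where D: "D \<in> borel_measurable M" "AE x in M. RN_deriv M N x = ennreal (D x)" "\<And>x. 0 \<le> D x"
    using M.real_RN_deriv[OF fN ac s] by metis
  have "N = density M (RN_deriv M N)" using M.density_RN_deriv[OF ac s] by simp
  also have "\<dots> = density M (\<lambda>x. ennreal (D x))"
    using D by (intro density_cong) auto
  finally show ?thesis using that D by blast
qed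

text \<open>Change of the reference measure; with \<open>density_of_le_measure\<close> every density can be moved to a
larger measure.\<close>

lemma has_density_density:
  fixes g :: "'b::topological_space \<Rightarrow> 'v::euclidean_space"
  assumes sM: "sets M = sets borel"
    and D[measurable]: "D \<in> borel_measurable M" and D0: "\<And>x. 0 \<le> D x"
    and g: "has_density \<nu> (density M (\<lambda>x. ennreal (D x))) g"
  shows "has_density \<nu> M (\<lambda>x. D x *\<^sub>R g x)"
proof -
  have int: "integrable (density M (\<lambda>x. ennreal (D x))) g" using g unfolding has_density_def by auto
  have [measurable]: "g \<in> borel_measurable M" using borel_measurable_integrable[OF int] by simp
  have "integrable M (\<lambda>x. D x *\<^sub>R g x)"
    using int by (subst (asm) integrable_density) (use D0 in auto)
  moreover have "(LINT p:A|density M (\<lambda>x. ennreal (D x)). g p) = (LINT p:A|M. D p *\<^sub>R g p)"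
    if "A \<in> sets borel" for A
  proof -
    have [measurable]: "A \<in> sets M" using that sM by simp
    show ?thesis
      unfolding set_lebesgue_integral_def
      by (subst integral_density) (use D0 in \<open>auto simp: mult.commute\<close>)
  qed
  ultimately show ?thesis using g unfolding has_density_def by auto
qed

text \<open>The total variation, obtained by adding the two parts of the Jordan decomposition, dominates \<open>\<nu>\<close> and
does not charge the complement of \<open>X\<close>.\<close>

lemma signed_measure_has_density:
  assumes \<nu>: "\<nu> \<in> signed_measures X" and X: "X \<in> sets borel"
  obtains M g where "finite_measure M" "sets M = sets borel" "emeasure M (- X) = 0" "has_density \<nu> M g"
proof -
  let ?U = "upper_variation \<nu>" and ?V = "upper_variation (\<lambda>A. - \<nu> A)"
  note \<nu>' = signed_measures_uminus[OF \<nu>]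
  obtain M where M: "finite_measure M" "sets M = sets borel"
    "\<And>A. A \<in> sets borel \<Longrightarrow> emeasure M A = emeasure ?U A + emeasure ?V A"
    by (rule exists_add_measure[OF finite_upper_variation[OF \<nu>] finite_upper_variation[OF \<nu>']
          sets_upper_variation sets_upper_variation]) (rule that)
  have null: "emeasure (upper_variation \<eta>) (- X) = 0" if \<eta>: "\<eta> \<in> signed_measures X" for \<eta>
  proof -
    have "ennreal (\<eta> B) \<le> 0" if "B \<in> sets borel" "B \<subseteq> - X" for B
    proof -
      have "B \<inter> X = {}" using that by blast
      then have "\<eta> B = 0" by (rule signed_measures_null[OF \<eta> that(1)])
      then show ?thesis by simp
    qed
    then have "emeasure (upper_variation \<eta>) (- X) \<le> 0"
      unfolding emeasure_upper_variation[OF \<eta> borel_comp[OF X]] by (intro SUP_least) auto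
    then show ?thesis by simp
  qed
  have dens: "\<exists>D. integrable M D \<and> (\<forall>A\<in>sets borel. measure (upper_variation \<eta>) A = (LINT x:A|M. D x))"
    if \<eta>: "\<eta> \<in> signed_measures X" and le: "\<And>A. A \<in> sets borel \<Longrightarrow> emeasure (upper_variation \<eta>) A \<le> emeasure M A" for \<eta>
  proof -
    obtain D where D: "D \<in> borel_measurable M" "\<And>x. 0 \<le> D x" "upper_variation \<eta> = density M (\<lambda>x. ennreal (D x))"
      by (rule density_of_le_measure[OF M(1) finite_upper_variation[OF \<eta>] M(2) sets_upper_variation le])
        (assumption, rule that)
    have one: "has_density (measure (upper_variation \<eta>)) (upper_variation \<eta>) (\<lambda>x. 1::real)"
      unfolding has_density_def
    proof (intro conjI ballI)
      show "integrable (upper_variation \<eta>) (\<lambda>x. 1::real)"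
        by (rule finite_measure.integrable_const[OF finite_upper_variation[OF \<eta>]])
      fix A :: "'a set" assume "A \<in> sets borel"
      moreover have "space (upper_variation \<eta>) = UNIV"
        using sets_eq_imp_space_eq[OF sets_upper_variation] by simp
      ultimately show "measure (upper_variation \<eta>) A = (LINT p:A|upper_variation \<eta>. 1)"
        unfolding set_lebesgue_integral_def by simp
    qed
    have "has_density (measure (upper_variation \<eta>)) M (\<lambda>x. D x *\<^sub>R 1)"
      by (rule has_density_density[OF M(2) D(1,2)]) (use one in \<open>simp only: D(3)[symmetric]\<close>)
    then show ?thesis
      unfolding has_density_def by (intro exI[of _ "\<lambda>x. D x *\<^sub>R 1"])
  qed
  have leU: "emeasure ?U A \<le> emeasure M A" and leV: "emeasure ?V A \<le> emeasure M A"
    if "A \<in> sets borel" for A using M(3)[OF that] by simp_all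
  obtain D1 where D1: "integrable M D1" "\<forall>A\<in>sets borel. measure ?U A = (LINT x:A|M. D1 x)"
    using dens[OF \<nu> leU] by blast
  obtain D2 where D2: "integrable M D2" "\<forall>A\<in>sets borel. measure ?V A = (LINT x:A|M. D2 x)"
    using dens[OF \<nu>' leV] by blast
  have d: "has_density \<nu> M (\<lambda>x. D1 x - D2 x)"
    unfolding has_density_def
  proof (intro conjI ballI)
    fix A assume A: "A \<in> sets (borel :: 'a measure)"
    have "set_integrable M A D1" "set_integrable M A D2"
      using D1 D2 A M(2) unfolding set_integrable_def by (auto intro!: integrable_mult_indicator simp del: real_scaleR_def)
    note i = set_integral_diff(2)[OF this]
    have U: "measure ?U A = (LINT x:A|M. D1 x)" and V: "measure ?V A = (LINT x:A|M. D2 x)"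
      using D1(2) D2(2) A by blast+
    show "\<nu> A = (LINT p:A|M. D1 p - D2 p)"
      unfolding i U[symmetric] V[symmetric] by (rule jordan_decomposition[OF \<nu> A])
  qed (rule Bochner_Integration.integrable_diff[OF D1(1) D2(1)])
  have nX: "emeasure M (- X) = 0"
    unfolding M(3)[OF borel_comp[OF X]] null[OF \<nu>] null[OF \<nu>'] by simp
  show ?thesis by (rule that[OF M(1,2) nX d])
qed

section \<open>Independence of the action from the dominating measure\<close>

lemma has_density_le_measure:
  fixes M N :: "'b::topological_space measure" and g :: "'b \<Rightarrow> 'v::euclidean_space"
  assumes fM: "finite_measure M" and fN: "finite_measure N"
    and sM: "sets M = sets borel" and sN: "sets N = sets borel"
    and le: "\<And>A. A \<in> sets borel \<Longrightarrow> emeasure N A \<le> emeasure M A"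
    and g: "has_density \<nu> N g"
  shows "\<exists>g'::'b \<Rightarrow> 'v. has_density \<nu> M g'"
proof -
  obtain D where D: "D \<in> borel_measurable M" "\<And>x. 0 \<le> D x" "N = density M (\<lambda>x. ennreal (D x))"
    by (rule density_of_le_measure[OF fM fN sM sN le]) (assumption, rule that)
  show ?thesis by (rule exI, rule has_density_density[OF sM D(1,2) g[unfolded D(3)]])
qed

lemma common_dominating_measure:
  assumes "finite S" "S \<subseteq> signed_measures X" and X: "X \<in> sets borel"
  shows "\<exists>M. finite_measure M \<and> sets M = sets borel \<and> emeasure M (- X) = 0 \<and>
             (\<forall>\<nu>\<in>S. \<exists>g::_ \<Rightarrow> real. has_density \<nu> M g)"
  using assms(1,2)
proof (induction S rule: finite_induct)
  case empty
  show ?case by (intro exI[of _ "null_measure borel"]) (auto intro!: finite_measureI)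
next
  case (insert \<nu> S)
  then obtain M where M: "finite_measure M" "sets M = sets borel" "emeasure M (- X) = 0"
    and MS: "\<forall>\<nu>\<in>S. \<exists>g::_ \<Rightarrow> real. has_density \<nu> M g" by auto
  have "\<nu> \<in> signed_measures X" using insert by auto
  from this obtain N g where N: "finite_measure N" "sets N = sets borel" "emeasure N (- X) = 0"
    and g: "has_density \<nu> N (g :: _ \<Rightarrow> real)"
    by (rule signed_measure_has_density[OF _ X]) (rule that)
  obtain K where K: "finite_measure K" "sets K = sets borel"
    "\<And>A. A \<in> sets borel \<Longrightarrow> emeasure K A = emeasure M A + emeasure N A"
    by (rule exists_add_measure[OF M(1) N(1) M(2) N(2)]) (rule that)
  have leM: "emeasure M A \<le> emeasure K A" and leN: "emeasure N A \<le> emeasure K A"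
    if "A \<in> sets borel" for A using K(3)[OF that] by simp_all
  have "\<exists>g::_ \<Rightarrow> real. has_density \<eta> K g" if "\<eta> \<in> insert \<nu> S" for \<eta>
  proof (cases "\<eta> = \<nu>")
    case True
    show ?thesis unfolding True by (rule has_density_le_measure[OF K(1) N(1) K(2) N(2) leN g])
  next
    case False
    then have "\<eta> \<in> S" using that by simp
    from bspec[OF MS this] obtain g' where "has_density \<eta> M (g' :: _ \<Rightarrow> real)" by (rule exE)
    from has_density_le_measure[OF K(1) M(1) K(2) M(2) leM this] show ?thesis by simp
  qed
  moreover have "emeasure K (- X) = 0"
    unfolding K(3)[OF borel_comp[OF X]] M(3) N(3) by simp
  ultimately show ?case using K(1,2) by (intro exI[of _ K]) simp
qed

text \<open>One admissible choice in the definition of \<open>action\<close>. It exists for every triple of finite measures,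
so that the action of a competitor is never an arbitrary value (\<open>triple_density_exists\<close>).\<close>

definition triple_density ::
  "(real \<times> 'a::euclidean_space) set \<Rightarrow> (real \<times> 'a) measure \<Rightarrow> (real \<times> 'a \<Rightarrow> real) \<Rightarrow>
     (real \<times> 'a \<Rightarrow> 'a) \<Rightarrow> (real \<times> 'a \<Rightarrow> real) \<Rightarrow> 'a triple \<Rightarrow> bool" where
  "triple_density X M r w z = (\<lambda>(\<rho>, \<omega>, \<zeta>).
     finite_measure M \<and> sets M = sets borel \<and> emeasure M (- X) = 0 \<and>
     has_density \<rho> M r \<and> has_density \<omega> M w \<and> has_density \<zeta> M z)"

lemma triple_density_exists:
  fixes X :: "(real \<times> 'a::euclidean_space) set"
  assumes \<rho>: "\<rho> \<in> signed_measures X" and \<omega>: "\<omega> \<in> vector_measures X" and \<zeta>: "\<zeta> \<in> signed_measures X"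
    and X: "X \<in> sets borel"
  shows "\<exists>M r w z. triple_density X M r w z (\<rho>, \<omega>, \<zeta>)"
proof -
  let ?c = "\<lambda>b A. \<omega> A \<bullet> b"
  define S where "S = insert \<rho> (insert \<zeta> (?c ` Basis))"
  have "finite S" "S \<subseteq> signed_measures X"
    using \<rho> \<zeta> \<omega> unfolding S_def vector_measures_def by auto
  from common_dominating_measure[OF this X] obtain M
    where M: "finite_measure M" "sets M = sets borel" "emeasure M (- X) = 0"
      and d: "\<forall>\<nu>\<in>S. \<exists>g::_ \<Rightarrow> real. has_density \<nu> M g" by (elim exE conjE) (rule that)
  have "\<rho> \<in> S" "\<zeta> \<in> S" and cS: "\<And>b. b \<in> Basis \<Longrightarrow> ?c b \<in> S" unfolding S_def by simp_all
  from bspec[OF d this(1)] obtain r where r: "has_density \<rho> M (r :: _ \<Rightarrow> real)" by (rule exE)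
  from bspec[OF d \<open>\<zeta> \<in> S\<close>] obtain z where z: "has_density \<zeta> M (z :: _ \<Rightarrow> real)" by (rule exE)
  have "\<forall>b\<in>Basis. \<exists>g::_ \<Rightarrow> real. has_density (?c b) M g" by (intro ballI bspec[OF d] cS)
  from bchoice[OF this] obtain g
    where "\<forall>b\<in>Basis. has_density (?c b) M (g b :: _ \<Rightarrow> real)" by (rule exE)
  then have g: "has_density (?c b) M (g b)" if "b \<in> Basis" for b using that by (rule bspec)
  define w where "w x = (\<Sum>b\<in>Basis. g b x *\<^sub>R b)" for x
  have gi: "integrable M (g b)" if "b \<in> Basis" for b by (rule has_density_integrable[OF g[OF that]])
  have wi: "integrable M w"
    unfolding w_def by (rule Bochner_Integration.integrable_sum, rule integrable_scaleR_left, rule gi)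
  have wb: "w x \<bullet> b = g b x" if "b \<in> Basis" for b x
    unfolding w_def using that by (rule inner_sum_left_Basis)
  have "has_density \<omega> M w"
    unfolding has_density_def
  proof (intro conjI wi ballI, rule euclidean_eqI)
    fix A and b :: 'a assume A: "A \<in> sets (borel :: (real \<times> 'a) measure)" and b: "b \<in> Basis"
    have "\<omega> A \<bullet> b = (LINT x:A|M. g b x)" by (rule has_density_eq[OF g[OF b] A])
    also have "\<dots> = (LINT x:A|M. w x \<bullet> b)" using wb[OF b] by simp
    also have "\<dots> = (LINT x:A|M. w x) \<bullet> b"
      using A M(2) by (intro set_lebesgue_integral_inner[OF wi]) simp
    finally show "\<omega> A \<bullet> b = (LINT x:A|M. w x) \<bullet> b" .
  qed
  then show ?thesis using M r z unfolding triple_density_def prod.case by (intro exI conjI)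
qed

lemma f_wf_scale:
  assumes "0 \<le> d"
  shows "f_wf \<delta> (d * x) (d *\<^sub>R y) (d * z) = ennreal d * f_wf \<delta> x y z"
proof (cases "d = 0")
  case True
  then show ?thesis by (simp add: f_wf_def)
next
  case False
  then have d: "0 < d" using assms by simp
  show ?thesis
  proof (cases "0 < x")
    case True
    have "((norm (d *\<^sub>R y))\<^sup>2 + \<delta>\<^sup>2 * (d * z)\<^sup>2) / (2 * (d * x)) = d * (((norm y)\<^sup>2 + \<delta>\<^sup>2 * z\<^sup>2) / (2 * x))"
      using d True by (simp add: field_simps power2_eq_square)
    moreover have "0 \<le> ((norm y)\<^sup>2 + \<delta>\<^sup>2 * z\<^sup>2) / (2 * x)" using True by simp
    ultimately show ?thesis
      using d True by (simp only: f_wf_def if_True mult_pos_pos ennreal_mult[OF assms])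
  next
    case False
    then show ?thesis
      using d by (simp add: f_wf_def zero_less_mult_iff ennreal_mult_eq_top_iff ennreal_mult_top)
  qed
qed

lemma borel_measurable_f_wf:
  fixes w :: "'b \<Rightarrow> 'a::euclidean_space"
  assumes [measurable]: "r \<in> borel_measurable M" "w \<in> borel_measurable M" "z \<in> borel_measurable M"
  shows "(\<lambda>p. f_wf \<delta> (r p) (w p) (z p)) \<in> borel_measurable M"
  unfolding f_wf_def by measurable

text \<open>Replacing \<open>M\<close> by a larger measure multiplies all three densities by \<open>D = dM/dK\<close>, and by homogeneity
of \<open>f_wf\<close> this factor is exactly the one that relates the two integrals.\<close>

lemma action_integral_le_measure:
  assumes d: "triple_density X M r w z \<mu>" and X: "X \<in> sets borel"
    and K: "finite_measure K" "sets K = sets borel"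
    and le: "\<And>A. A \<in> sets borel \<Longrightarrow> emeasure M A \<le> emeasure K A"
  shows "\<exists>r' w' z'. has_density (fst \<mu>) K r' \<and> has_density (fst (snd \<mu>)) K w' \<and>
    has_density (snd (snd \<mu>)) K z' \<and>
    (\<integral>\<^sup>+p\<in>X. f_wf \<delta> (r p) (w p) (z p) \<partial>M) = (\<integral>\<^sup>+p\<in>X. f_wf \<delta> (r' p) (w' p) (z' p) \<partial>K)"
proof -
  have M: "finite_measure M" "sets M = sets borel" and
    h: "has_density (fst \<mu>) M r" "has_density (fst (snd \<mu>)) M w" "has_density (snd (snd \<mu>)) M z"
    using d unfolding triple_density_def by (auto split: prod.splits)
  obtain D where D: "D \<in> borel_measurable K" "\<And>x. 0 \<le> D x" "M = density K (\<lambda>x. ennreal (D x))"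
    by (rule density_of_le_measure[OF K(1) M(1) K(2) M(2) le]) (assumption, rule that)
  note [measurable] = D(1)
  have "r \<in> borel_measurable M" "w \<in> borel_measurable M" "z \<in> borel_measurable M"
    by (intro borel_measurable_integrable has_density_integrable[OF h(1)]
        has_density_integrable[OF h(2)] has_density_integrable[OF h(3)])+
  then have rwz: "r \<in> borel_measurable K" "w \<in> borel_measurable K" "z \<in> borel_measurable K"
    unfolding D(3) by simp_all
  have Xm: "X \<in> sets K" using X K(2) by simp
  note [measurable] = borel_measurable_f_wf[OF rwz, of \<delta>] Xm
  have "(\<integral>\<^sup>+p\<in>X. f_wf \<delta> (r p) (w p) (z p) \<partial>M) =
        (\<integral>\<^sup>+p. ennreal (D p) * (f_wf \<delta> (r p) (w p) (z p) * indicator X p) \<partial>K)"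
    unfolding D(3) by (rule nn_integral_density) measurable
  also have "\<dots> = (\<integral>\<^sup>+p\<in>X. f_wf \<delta> (D p * r p) (D p *\<^sub>R w p) (D p * z p) \<partial>K)"
    by (simp only: f_wf_scale[OF D(2)] mult.assoc)
  finally show ?thesis
    using has_density_density[OF K(2) D(1,2) h(1)[unfolded D(3)]]
      has_density_density[OF K(2) D(1,2) h(2)[unfolded D(3)]]
      has_density_density[OF K(2) D(1,2) h(3)[unfolded D(3)]]
    unfolding real_scaleR_def by blast
qed

lemma has_density_unique:
  fixes g g' :: "'b::topological_space \<Rightarrow> 'v::euclidean_space"
  assumes K: "finite_measure K" "sets K = sets borel" and "has_density \<nu> K g" "has_density \<nu> K g'"
  shows "AE p in K. g p = g' p"
proof -
  interpret finite_measure K by fact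
  show ?thesis
    by (rule density_unique_banach) (use assms in \<open>simp_all add: has_density_def\<close>)
qed

text \<open>Both dominating measures are compared with their sum, for which the densities are unique almost
everywhere.\<close>

lemma action_integral_unique:
  assumes 1: "triple_density X M1 r1 w1 z1 \<mu>" and 2: "triple_density X M2 r2 w2 z2 \<mu>"
    and X: "X \<in> sets borel"
  shows "(\<integral>\<^sup>+p\<in>X. f_wf \<delta> (r1 p) (w1 p) (z1 p) \<partial>M1) = (\<integral>\<^sup>+p\<in>X. f_wf \<delta> (r2 p) (w2 p) (z2 p) \<partial>M2)"
proof -
  have M1: "finite_measure M1" "sets M1 = sets borel" and M2: "finite_measure M2" "sets M2 = sets borel"
    using 1 2 unfolding triple_density_def by (auto split: prod.splits)
  obtain K where K: "finite_measure K" "sets K = sets borel"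
    "\<And>A. A \<in> sets borel \<Longrightarrow> emeasure K A = emeasure M1 A + emeasure M2 A"
    by (rule exists_add_measure[OF M1(1) M2(1) M1(2) M2(2)]) (rule that)
  have le1: "emeasure M1 A \<le> emeasure K A" and le2: "emeasure M2 A \<le> emeasure K A"
    if "A \<in> sets borel" for A using K(3)[OF that] by simp_all
  obtain r w z where a: "has_density (fst \<mu>) K r" "has_density (fst (snd \<mu>)) K w"
    "has_density (snd (snd \<mu>)) K z"
    "(\<integral>\<^sup>+p\<in>X. f_wf \<delta> (r1 p) (w1 p) (z1 p) \<partial>M1) = (\<integral>\<^sup>+p\<in>X. f_wf \<delta> (r p) (w p) (z p) \<partial>K)"
    using action_integral_le_measure[OF 1 X K(1,2) le1] by blast
  obtain r' w' z' where b: "has_density (fst \<mu>) K r'" "has_density (fst (snd \<mu>)) K w'"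
    "has_density (snd (snd \<mu>)) K z'"
    "(\<integral>\<^sup>+p\<in>X. f_wf \<delta> (r2 p) (w2 p) (z2 p) \<partial>M2) = (\<integral>\<^sup>+p\<in>X. f_wf \<delta> (r' p) (w' p) (z' p) \<partial>K)"
    using action_integral_le_measure[OF 2 X K(1,2) le2] by blast
  note u = has_density_unique[OF K(1,2)]
  have "AE p in K. f_wf \<delta> (r p) (w p) (z p) * indicator X p = f_wf \<delta> (r' p) (w' p) (z' p) * indicator X p"
    using u[OF a(1) b(1)] u[OF a(2) b(2)] u[OF a(3) b(3)] by eventually_elim simp
  then show ?thesis unfolding a(4) b(4) by (rule nn_integral_cong_AE)
qed

lemma action_eq:
  assumes d: "triple_density ({0..1} \<times> closure \<Omega>) M r w z \<mu>"
  shows "action \<delta> \<Omega> \<mu> = (\<integral>\<^sup>+p\<in>{0..1} \<times> closure \<Omega>. f_wf \<delta> (r p) (w p) (z p) \<partial>M)"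
proof -
  obtain \<rho> \<omega> \<zeta> where \<mu>: "\<mu> = (\<rho>, \<omega>, \<zeta>)" by (cases \<mu>)
  have X: "{0..1::real} \<times> closure \<Omega> \<in> sets borel"
    by (intro borel_closed closed_Times closed_closure closed_atLeastAtMost)
  let ?P = "\<lambda>c. \<exists>M r w z. triple_density ({0..1} \<times> closure \<Omega>) M r w z \<mu> \<and>
      c = (\<integral>\<^sup>+p\<in>{0..1} \<times> closure \<Omega>. f_wf \<delta> (r p) (w p) (z p) \<partial>M)"
  have "action \<delta> \<Omega> \<mu> = (SOME c. ?P c)"
    unfolding action_def triple_density_def \<mu> Let_def by (simp only: prod.case conj_assoc)
  also have "\<dots> = (\<integral>\<^sup>+p\<in>{0..1} \<times> closure \<Omega>. f_wf \<delta> (r p) (w p) (z p) \<partial>M)"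
  proof (rule some_equality)
    show "?P (\<integral>\<^sup>+p\<in>{0..1} \<times> closure \<Omega>. f_wf \<delta> (r p) (w p) (z p) \<partial>M)" using d by blast
    fix c assume "?P c"
    then obtain M' r' w' z' where "triple_density ({0..1} \<times> closure \<Omega>) M' r' w' z' \<mu>"
      "c = (\<integral>\<^sup>+p\<in>{0..1} \<times> closure \<Omega>. f_wf \<delta> (r' p) (w' p) (z' p) \<partial>M')" by blast
    then show "c = (\<integral>\<^sup>+p\<in>{0..1} \<times> closure \<Omega>. f_wf \<delta> (r p) (w p) (z p) \<partial>M)"
      using action_integral_unique[OF _ d X] by simp
  qed
  finally show ?thesis .
qed

section \<open>Calculus of continuously differentiable test functions\<close>

lemma C1_continuous_on: "C1_with_derivs X \<phi> \<phi>t \<phi>x \<Longrightarrow> continuous_on X \<phi>"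
  unfolding C1_with_derivs_def by (auto intro: has_derivative_continuous_on)

lemma C1_add:
  assumes f: "C1_with_derivs X f ft fx" and g: "C1_with_derivs X g gt gx"
  shows "C1_with_derivs X (\<lambda>p. f p + g p) (\<lambda>p. ft p + gt p) (\<lambda>p. fx p + gx p)"
  unfolding C1_with_derivs_def
proof (intro conjI ballI)
  show "continuous_on X (\<lambda>p. ft p + gt p)" "continuous_on X (\<lambda>p. fx p + gx p)"
    using f g unfolding C1_with_derivs_def by (simp_all add: continuous_on_add)
  fix p assume p: "p \<in> X"
  have "(f has_derivative (\<lambda>(s, v). ft p * s + fx p \<bullet> v)) (at p within X)"
    "(g has_derivative (\<lambda>(s, v). gt p * s + gx p \<bullet> v)) (at p within X)"
    using f g p unfolding C1_with_derivs_def by simp_all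
  from has_derivative_add[OF this]
  show "((\<lambda>p. f p + g p) has_derivative (\<lambda>(s, v). (ft p + gt p) * s + (fx p + gx p) \<bullet> v)) (at p within X)"
    by (rule has_derivative_eq_rhs) (auto simp: algebra_simps)
qed

lemma C1_mult:
  assumes f: "C1_with_derivs X f ft fx" and g: "C1_with_derivs X g gt gx"
  shows "C1_with_derivs X (\<lambda>p. f p * g p) (\<lambda>p. f p * gt p + ft p * g p) (\<lambda>p. f p *\<^sub>R gx p + g p *\<^sub>R fx p)"
  unfolding C1_with_derivs_def
proof (intro conjI ballI)
  note c = C1_continuous_on[OF f] C1_continuous_on[OF g]
  have d: "continuous_on X ft" "continuous_on X gt" "continuous_on X fx" "continuous_on X gx"
    using f g unfolding C1_with_derivs_def by simp_all
  show "continuous_on X (\<lambda>p. f p * gt p + ft p * g p)" "continuous_on X (\<lambda>p. f p *\<^sub>R gx p + g p *\<^sub>R fx p)"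
    using c d by (simp_all add: continuous_on_add continuous_on_mult continuous_on_scaleR)
  fix p assume p: "p \<in> X"
  have "(f has_derivative (\<lambda>(s, v). ft p * s + fx p \<bullet> v)) (at p within X)"
    "(g has_derivative (\<lambda>(s, v). gt p * s + gx p \<bullet> v)) (at p within X)"
    using f g p unfolding C1_with_derivs_def by simp_all
  from has_derivative_mult[OF this]
  show "((\<lambda>p. f p * g p) has_derivative
    (\<lambda>(s, v). (f p * gt p + ft p * g p) * s + (f p *\<^sub>R gx p + g p *\<^sub>R fx p) \<bullet> v)) (at p within X)"
    by (rule has_derivative_eq_rhs) (auto simp: algebra_simps inner_add_left)
qed

lemma C1_sum:
  assumes "\<And>i. i \<in> I \<Longrightarrow> C1_with_derivs X (f i) (ft i) (fx i)"
  shows "C1_with_derivs X (\<lambda>p. \<Sum>i\<in>I. f i p) (\<lambda>p. \<Sum>i\<in>I. ft i p) (\<lambda>p. \<Sum>i\<in>I. fx i p)"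
  unfolding C1_with_derivs_def
proof (intro conjI ballI)
  show "continuous_on X (\<lambda>p. \<Sum>i\<in>I. ft i p)" "continuous_on X (\<lambda>p. \<Sum>i\<in>I. fx i p)"
    using assms unfolding C1_with_derivs_def by (auto intro!: continuous_on_sum)
  fix p assume p: "p \<in> X"
  have "((\<lambda>p. \<Sum>i\<in>I. f i p) has_derivative (\<lambda>q. \<Sum>i\<in>I. (case q of (s, v) \<Rightarrow> ft i p * s + fx i p \<bullet> v))) (at p within X)"
    using assms p unfolding C1_with_derivs_def by (auto intro!: has_derivative_sum)
  then show "((\<lambda>p. \<Sum>i\<in>I. f i p) has_derivative
      (\<lambda>(s, v). (\<Sum>i\<in>I. ft i p) * s + (\<Sum>i\<in>I. fx i p) \<bullet> v)) (at p within X)"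
    by (rule has_derivative_eq_rhs) (auto simp: sum.distrib sum_distrib_right inner_sum_left)
qed

lemma C1_time:
  assumes d: "\<And>t. t \<in> T \<Longrightarrow> (f has_real_derivative f' t) (at t within T)" and c: "continuous_on T f'"
  shows "C1_with_derivs (T \<times> S) (\<lambda>p. f (fst p)) (\<lambda>p. f' (fst p)) (\<lambda>p. 0 :: 'a::euclidean_space)"
  unfolding C1_with_derivs_def
proof (intro conjI ballI)
  show "continuous_on (T \<times> S) (\<lambda>p. f' (fst p))"
    by (rule continuous_on_compose2[OF c]) (auto intro: continuous_intros)
  show "continuous_on (T \<times> S) (\<lambda>p. 0 :: 'a)" by (rule continuous_on_const)
  fix p assume p: "p \<in> T \<times> S"
  have "(f has_derivative (\<lambda>s. f' (fst p) * s)) (at (fst p) within fst ` (T \<times> S))"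
    using d[of "fst p"] p unfolding has_field_derivative_def by (auto intro: has_derivative_subset)
  then have "((\<lambda>q. f (fst q)) has_derivative (\<lambda>q. f' (fst p) * fst q)) (at p within T \<times> S)"
    by (rule has_derivative_in_compose[OF has_derivative_fst[OF has_derivative_ident]])
  then show "((\<lambda>q. f (fst q)) has_derivative (\<lambda>(s, v). f' (fst p) * s + 0 \<bullet> v)) (at p within T \<times> S)"
    by (rule has_derivative_eq_rhs) (auto simp: fun_eq_iff)
qed

lemma C1_space:
  fixes f :: "'a::euclidean_space \<Rightarrow> real"
  assumes d: "\<And>x. (f has_derivative (\<lambda>v. f' x \<bullet> v)) (at x)" and c: "continuous_on UNIV f'"
  shows "C1_with_derivs X (\<lambda>p. f (snd p)) (\<lambda>p. 0) (\<lambda>p. f' (snd p))"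
  unfolding C1_with_derivs_def
proof (intro conjI ballI)
  show "continuous_on X (\<lambda>p. f' (snd p))"
    by (rule continuous_on_compose2[OF c]) (auto intro: continuous_intros)
  show "continuous_on X (\<lambda>p. 0 :: real)" by (rule continuous_on_const)
  fix p :: "real \<times> 'a"
  have "((\<lambda>q. f (snd q)) has_derivative (\<lambda>q. f' (snd p) \<bullet> snd q)) (at p within X)"
    by (rule has_derivative_compose[OF has_derivative_snd[OF has_derivative_ident] d])
  then show "((\<lambda>q. f (snd q)) has_derivative (\<lambda>(s, v). 0 * s + f' (snd p) \<bullet> v)) (at p within X)"
    by (rule has_derivative_eq_rhs) (auto simp: fun_eq_iff)
qed

section \<open>Radial bumps\<close>

text \<open>\<open>cos^2\<close> of the angle \<open>|x - c|/(2\<delta>)\<close>, continued by \<open>0\<close> beyond \<open>\<pi>/2\<close>, in the double-angle form, which is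
smooth at the centre.\<close>

definition bump :: "real \<Rightarrow> 'a::euclidean_space \<Rightarrow> 'a \<Rightarrow> real" where
  "bump \<delta> c x = (1 + cos (min (norm (x - c) / \<delta>) pi)) / 2"

definition bump_grad :: "real \<Rightarrow> 'a::euclidean_space \<Rightarrow> 'a \<Rightarrow> 'a" where
  "bump_grad \<delta> c x = (- sin (min (norm (x - c) / \<delta>) pi) / (2 * \<delta>)) *\<^sub>R sgn (x - c)"

lemma bump_nonneg: "0 \<le> bump \<delta> c x"
proof -
  have "0 \<le> (1 + cos m) / 2" for m :: real using cos_ge_minus_one[of m] by argo
  then show ?thesis unfolding bump_def .
qed

lemma bump_outside:
  assumes "0 < \<delta>" "pi * \<delta> \<le> norm (x - c)"
  shows "bump \<delta> c x = 0" "bump_grad \<delta> c x = 0"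
proof -
  have "min (norm (x - c) / \<delta>) pi = pi" using assms by (simp add: min_def field_simps)
  then show "bump \<delta> c x = 0" "bump_grad \<delta> c x = 0" unfolding bump_def bump_grad_def by simp_all
qed

text \<open>This identity makes the Hamilton-Jacobi and transport equations polynomial identities in \<open>bump\<close>.\<close>

lemma bump_grad_inner:
  assumes "0 < \<delta>"
  shows "bump_grad \<delta> c x \<bullet> bump_grad \<delta> c x = bump \<delta> c x * (1 - bump \<delta> c x) / \<delta>\<^sup>2"
proof (cases "x = c")
  case True
  then show ?thesis unfolding bump_def bump_grad_def by (simp add: min_def)
next
  case False
  define m where "m = min (norm (x - c) / \<delta>) pi"
  have "sgn (x - c) \<bullet> sgn (x - c) = 1"
    using False by (simp add: dot_square_norm norm_sgn)
  then have "bump_grad \<delta> c x \<bullet> bump_grad \<delta> c x = (sin m)\<^sup>2 / (4 * \<delta>\<^sup>2)"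
    unfolding bump_grad_def m_def[symmetric] by (simp add: power2_eq_square)
  also have "\<dots> = (1 + cos m) / 2 * (1 - (1 + cos m) / 2) / \<delta>\<^sup>2"
    unfolding sin_squared_eq using assms by (simp add: field_simps power2_eq_square)
  finally show ?thesis unfolding bump_def m_def .
qed

text \<open>This covers the two kinds of points where the bump is not a composition of smooth functions, the
centre and the boundary of the ball: a maximum and a minimum of the profile, both quadratic.\<close>

lemma has_derivative_zero_quadratic:
  fixes f :: "'a::real_normed_vector \<Rightarrow> real"
  assumes "\<And>y. \<bar>f y - f x\<bar> \<le> C * (norm (y - x))\<^sup>2"
  shows "(f has_derivative (\<lambda>_. 0)) (at x)"
  unfolding has_derivative_iff_norm
proof
  show "bounded_linear (\<lambda>_::'a. 0::real)" by (rule bounded_linear_zero)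
  have lim: "((\<lambda>y. C * norm (y - x)) \<longlongrightarrow> 0) (at x)"
    by (intro tendsto_eq_intros | simp)+
  show "((\<lambda>y. norm (f y - f x - 0) / norm (y - x)) \<longlongrightarrow> 0) (at x)"
  proof (rule Lim_null_comparison[OF _ lim])
    have "norm (norm (f y - f x - 0) / norm (y - x)) \<le> C * norm (y - x)" for y
    proof (cases "y = x")
      case False
      then show ?thesis using assms[of y] by (simp add: field_simps power2_eq_square)
    qed simp
    then show "\<forall>\<^sub>F y in at x. norm (norm (f y - f x - 0) / norm (y - x)) \<le> C * norm (y - x)" by simp
  qed
qed

lemma one_minus_cos_le: "1 - cos (t::real) \<le> t\<^sup>2 / 2"
proof -
  have "1 - cos t = 2 * (sin (t / 2))\<^sup>2" using cos_double_sin[of "t / 2"] by simp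
  also have "(sin (t / 2))\<^sup>2 \<le> (t / 2)\<^sup>2"
    using abs_sin_x_le_abs_x[of "t / 2"] by (rule abs_le_square_iff[THEN iffD1])
  finally show ?thesis by (simp add: power2_eq_square)
qed

lemma bump_has_derivative:
  fixes c :: "'a::euclidean_space"
  assumes \<delta>: "0 < \<delta>"
  shows "(bump \<delta> c has_derivative (\<lambda>v. bump_grad \<delta> c x \<bullet> v)) (at x)"
proof -
  consider "x = c" | "pi * \<delta> \<le> norm (x - c)" | "x \<noteq> c" "norm (x - c) < pi * \<delta>" by linarith
  then show ?thesis
  proof cases
    case 1
    have "\<bar>bump \<delta> c y - bump \<delta> c x\<bar> \<le> 1 / (4 * \<delta>\<^sup>2) * (norm (y - x))\<^sup>2" for y
    proof -
      define m where "m = min (norm (y - c) / \<delta>) pi"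
      have m: "0 \<le> m" "m \<le> norm (y - c) / \<delta>" unfolding m_def using \<delta> by simp_all
      have "\<bar>bump \<delta> c y - bump \<delta> c x\<bar> = (1 - cos m) / 2"
        unfolding bump_def m_def 1 using cos_le_one[of "min (norm (y - c) / \<delta>) pi"]
        by (simp add: min_def)
      also have "\<dots> \<le> (norm (y - c) / \<delta>)\<^sup>2 / 4"
        using one_minus_cos_le[of m] power_mono[OF m(2,1), of 2] by simp
      finally show ?thesis unfolding 1 by (simp add: power_divide)
    qed
    from has_derivative_zero_quadratic[OF this] show ?thesis
      unfolding bump_grad_def 1 by simp
  next
    case 2
    have "\<bar>bump \<delta> c y - bump \<delta> c x\<bar> \<le> 1 / (4 * \<delta>\<^sup>2) * (norm (y - x))\<^sup>2" for y
    proof -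
      define m where "m = min (norm (y - c) / \<delta>) pi"
      have "norm (x - c) - norm (y - c) \<le> norm (y - x)"
        using norm_triangle_ineq2[of "x - c" "y - c"] by (simp add: norm_minus_commute)
      then have "(pi * \<delta> - norm (y - c)) / \<delta> \<le> norm (y - x) / \<delta>"
        using 2 \<delta> by (intro divide_right_mono) auto
      then have "pi - norm (y - c) / \<delta> \<le> norm (y - x) / \<delta>" using \<delta> by (simp add: diff_divide_distrib)
      moreover have "0 \<le> norm (y - x) / \<delta>" using \<delta> by simp
      ultimately have m: "pi - m \<le> norm (y - x) / \<delta>" "0 \<le> pi - m" unfolding m_def by (simp_all add: min_def)
      have "\<bar>bump \<delta> c y - bump \<delta> c x\<bar> = (1 - cos (pi - m)) / 2"
        using bump_outside(1)[OF \<delta> 2] bump_nonneg[of \<delta> c y] unfolding bump_def m_def[symmetric] by simp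
      also have "\<dots> \<le> (norm (y - x) / \<delta>)\<^sup>2 / 4"
        using one_minus_cos_le[of "pi - m"] power_mono[OF m, of 2] by simp
      finally show ?thesis by (simp add: power_divide)
    qed
    from has_derivative_zero_quadratic[OF this] show ?thesis
      unfolding bump_outside(2)[OF \<delta> 2] by simp
  next
    case 3
    have lt: "norm (x - c) / \<delta> < pi" using 3(2) \<delta> by (simp add: field_simps)
    have "(norm has_derivative (\<lambda>h. h \<bullet> sgn (x - c))) (at (x - c))"
      using has_derivative_norm[of "x - c"] 3(1) by (simp add: inner_commute)
    then have [derivative_intros]: "((\<lambda>y. norm (y - c)) has_derivative (\<lambda>h. h \<bullet> sgn (x - c))) (at x)"
      by (rule has_derivative_compose[where f = "\<lambda>y. y - c" and f' = "\<lambda>h. h", rotated])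
         (auto intro!: derivative_eq_intros)
    have "((\<lambda>y. (1 + cos (norm (y - c) / \<delta>)) / 2) has_derivative (\<lambda>v. bump_grad \<delta> c x \<bullet> v)) (at x)"
      unfolding bump_grad_def using 3(1) lt \<delta>
      by (auto intro!: derivative_eq_intros simp: fun_eq_iff min_def inner_commute)
    then show ?thesis
    proof (rule has_derivative_transform_within_open)
      show "open (ball c (pi * \<delta>))" by simp
      show "x \<in> ball c (pi * \<delta>)" using 3(2) by (simp add: dist_norm norm_minus_commute)
      fix y assume "y \<in> ball c (pi * \<delta>)"
      then have "norm (y - c) / \<delta> < pi" using \<delta> by (simp add: field_simps dist_norm norm_minus_commute)
      then show "(1 + cos (norm (y - c) / \<delta>)) / 2 = bump \<delta> c y" unfolding bump_def by (simp add: min_def)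
    qed
  qed
qed

lemma continuous_bump_grad:
  fixes c :: "'a::euclidean_space"
  assumes \<delta>: "0 < \<delta>"
  shows "continuous_on UNIV (bump_grad \<delta> c)"
  unfolding continuous_on_eq_continuous_at[OF open_UNIV]
proof
  fix x :: 'a
  show "isCont (bump_grad \<delta> c) x"
  proof (cases "x = c")
    case False
    then show ?thesis
      unfolding bump_grad_def using \<delta> by (intro continuous_intros) auto
  next
    case True
    have "norm (bump_grad \<delta> c y) \<le> norm (y - c) / (2 * \<delta>\<^sup>2)" for y
    proof -
      define m where "m = min (norm (y - c) / \<delta>) pi"
      have m: "0 \<le> m" "m \<le> norm (y - c) / \<delta>" unfolding m_def using \<delta> by simp_all
      have "norm (bump_grad \<delta> c y) \<le> \<bar>sin m\<bar> / (2 * \<delta>)"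
        unfolding bump_grad_def m_def[symmetric] using \<delta> by (simp add: norm_sgn)
      also have "\<dots> \<le> (norm (y - c) / \<delta>) / (2 * \<delta>)"
        using abs_sin_x_le_abs_x[of m] m \<delta> by (intro divide_right_mono) auto
      finally show ?thesis by (simp add: power2_eq_square mult.assoc)
    qed
    moreover have "((\<lambda>y. norm (y - c) / (2 * \<delta>\<^sup>2)) \<longlongrightarrow> 0) (at c)"
      by (rule tendsto_eq_intros refl | use \<delta> in simp)+
    ultimately have "(bump_grad \<delta> c \<longlongrightarrow> 0) (at c)"
      by (intro Lim_null_comparison[of "bump_grad \<delta> c"]) auto
    then show ?thesis unfolding True isCont_def by (simp add: bump_grad_def)
  qed
qed

lemma C1_bump: "0 < \<delta> \<Longrightarrow> C1_with_derivs X (\<lambda>p. bump \<delta> c (snd p)) (\<lambda>p. 0) (\<lambda>p. bump_grad \<delta> c (snd p))"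
  by (intro C1_space bump_has_derivative continuous_bump_grad)

section \<open>Explicit solutions of the Hamilton-Jacobi equation\<close>

text \<open>An eigenvalue of \<open>1 + t(K-1)\<close>, the linear map that moves points of the plane from time \<open>0\<close> to time
\<open>t\<close>.\<close>

definition stretch :: "real \<Rightarrow> real \<Rightarrow> real" where
  "stretch k t = 1 + t * (k - 1)"

text \<open>The eigenvalue \<open>m(t) = 2\<delta>^2 (k-1)/(1 + t(k-1))\<close> of the quadratic form; for \<open>k > 0\<close> these
are the solutions of \<open>m' = -m^2/(2\<delta>^2)\<close> that exist on all of \<open>[0,1]\<close>.\<close>

definition stiff :: "real \<Rightarrow> real \<Rightarrow> real \<Rightarrow> real" where
  "stiff \<delta> k t = 2 * \<delta>\<^sup>2 * (k - 1) / stretch k t"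

lemma stretch_pos:
  assumes "0 < k" "t \<in> {0..1}"
  shows "0 < stretch k t"
proof -
  have "stretch k t = (1 - t) + t * k" unfolding stretch_def by (simp add: algebra_simps)
  moreover have "0 \<le> t * k" "t = 1 \<Longrightarrow> 0 < t * k" using assms by simp_all
  ultimately show ?thesis using assms(2) by (cases "t = 1") auto
qed

lemma stretch_has_derivative: "(stretch k has_real_derivative (k - 1)) (at t within T)"
  unfolding stretch_def by (auto intro!: derivative_eq_intros)

lemma continuous_on_stretch: "continuous_on T (stretch k)"
  unfolding stretch_def by (intro continuous_intros)

lemma continuous_on_stiff:
  assumes "0 < k" shows "continuous_on {0..1} (stiff \<delta> k)"
  unfolding stiff_def using stretch_pos[OF assms] by (intro continuous_intros continuous_on_stretch) force

lemma stiff_has_derivative: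
  assumes "0 < k" "t \<in> {0..1}" "\<delta> \<noteq> 0"
  shows "(stiff \<delta> k has_real_derivative - (stiff \<delta> k t)\<^sup>2 / (2 * \<delta>\<^sup>2)) (at t within T)"
proof -
  have p: "stretch k t \<noteq> 0" using stretch_pos[OF assms(1,2)] by simp
  have "(stiff \<delta> k has_real_derivative (0 * stretch k t - 2 * \<delta>\<^sup>2 * (k - 1) * (k - 1)) / (stretch k t * stretch k t)) (at t within T)"
    unfolding stiff_def by (intro DERIV_divide DERIV_const stretch_has_derivative p)
  moreover have "(0 * stretch k t - 2 * \<delta>\<^sup>2 * (k - 1) * (k - 1)) / (stretch k t * stretch k t) = - (stiff \<delta> k t)\<^sup>2 / (2 * \<delta>\<^sup>2)"
    unfolding stiff_def using p assms(3) by (simp add: field_simps power2_eq_square)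
  ultimately show ?thesis by simp
qed

lemma stiff_strict_mono:
  assumes "0 < k" "k < k'" "t \<in> {0..1}" "0 < \<delta>"
  shows "stiff \<delta> k t < stiff \<delta> k' t"
proof -
  have p: "0 < stretch k t" "0 < stretch k' t" using stretch_pos assms by force+
  have "(k - 1) * stretch k' t < (k' - 1) * stretch k t"
    unfolding stretch_def using assms(2) by (simp add: algebra_simps)
  then have "(k - 1) / stretch k t < (k' - 1) / stretch k' t" using p by (simp add: field_simps)
  then have "2 * \<delta>\<^sup>2 * ((k - 1) / stretch k t) < 2 * \<delta>\<^sup>2 * ((k' - 1) / stretch k' t)"
    using assms(4) by (intro mult_strict_left_mono) auto
  then show ?thesis unfolding stiff_def by simp
qed

text \<open>The glued potential: near \<open>c i\<close> the quadratic form with eigenvalues \<open>\<kappa> i\<close> and \<open>k\<close>, away from all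
centres the form \<open>k\<close> alone.\<close>

definition cert :: "real \<Rightarrow> nat set \<Rightarrow> real \<Rightarrow> (nat \<Rightarrow> real) \<Rightarrow> (nat \<Rightarrow> 'a::euclidean_space) \<Rightarrow> real \<times> 'a \<Rightarrow> real" where
  "cert \<delta> I k \<kappa> c p = stiff \<delta> k (fst p) + (\<Sum>i\<in>I. (stiff \<delta> (\<kappa> i) (fst p) - stiff \<delta> k (fst p)) * bump \<delta> (c i) (snd p))"

definition cert_t :: "real \<Rightarrow> nat set \<Rightarrow> real \<Rightarrow> (nat \<Rightarrow> real) \<Rightarrow> (nat \<Rightarrow> 'a::euclidean_space) \<Rightarrow> real \<times> 'a \<Rightarrow> real" where
  "cert_t \<delta> I k \<kappa> c p = - (stiff \<delta> k (fst p))\<^sup>2 / (2 * \<delta>\<^sup>2) +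
     (\<Sum>i\<in>I. ((stiff \<delta> k (fst p))\<^sup>2 - (stiff \<delta> (\<kappa> i) (fst p))\<^sup>2) / (2 * \<delta>\<^sup>2) * bump \<delta> (c i) (snd p))"

definition cert_x :: "real \<Rightarrow> nat set \<Rightarrow> real \<Rightarrow> (nat \<Rightarrow> real) \<Rightarrow> (nat \<Rightarrow> 'a::euclidean_space) \<Rightarrow> real \<times> 'a \<Rightarrow> 'a" where
  "cert_x \<delta> I k \<kappa> c p = (\<Sum>i\<in>I. (stiff \<delta> (\<kappa> i) (fst p) - stiff \<delta> k (fst p)) *\<^sub>R bump_grad \<delta> (c i) (snd p))"

text \<open>Product and sum rules deliver the derivatives in the shape of the rule; this replaces them by equal
functions.\<close>

lemma C1_cong:
  assumes "C1_with_derivs X f ft fx" "f = g" "ft = gt" "fx = gx"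
  shows "C1_with_derivs X g gt gx"
  using assms by simp

lemma C1_stiff:
  assumes "0 < k" "0 < \<delta>"
  shows "C1_with_derivs ({0..1} \<times> S) (\<lambda>p. stiff \<delta> k (fst p)) (\<lambda>p. - (stiff \<delta> k (fst p))\<^sup>2 / (2 * \<delta>\<^sup>2))
     (\<lambda>p. 0 :: 'a::euclidean_space)"
  by (rule C1_time[OF stiff_has_derivative]) (use assms in \<open>auto intro!: continuous_intros continuous_on_stiff\<close>)

lemma C1_cert:
  fixes c :: "nat \<Rightarrow> 'a::euclidean_space"
  assumes \<delta>: "0 < \<delta>" and k: "0 < k" and \<kappa>: "\<And>i. i \<in> I \<Longrightarrow> 0 < \<kappa> i"
  shows "C1_with_derivs ({0..1} \<times> S) (cert \<delta> I k \<kappa> c) (cert_t \<delta> I k \<kappa> c) (cert_x \<delta> I k \<kappa> c)"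
proof (rule C1_cong)
  have m: "C1_with_derivs ({0..1} \<times> S) (\<lambda>p. (-1::real)) (\<lambda>p. 0) (\<lambda>p. 0 :: 'a)"
    using C1_time[of "{0..1}" "\<lambda>_. -1" "\<lambda>_. 0"] by auto
  show "C1_with_derivs ({0..1} \<times> S)
    (\<lambda>p. stiff \<delta> k (fst p) + (\<Sum>i\<in>I. (stiff \<delta> (\<kappa> i) (fst p) + -1 * stiff \<delta> k (fst p)) * bump \<delta> (c i) (snd p)))
    (\<lambda>p. - (stiff \<delta> k (fst p))\<^sup>2 / (2 * \<delta>\<^sup>2) + (\<Sum>i\<in>I. (stiff \<delta> (\<kappa> i) (fst p) + -1 * stiff \<delta> k (fst p)) * 0 +
       (- (stiff \<delta> (\<kappa> i) (fst p))\<^sup>2 / (2 * \<delta>\<^sup>2) + (-1 * (- (stiff \<delta> k (fst p))\<^sup>2 / (2 * \<delta>\<^sup>2)) + 0 * stiff \<delta> k (fst p))) * bump \<delta> (c i) (snd p)))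
    (\<lambda>p. 0 + (\<Sum>i\<in>I. (stiff \<delta> (\<kappa> i) (fst p) + -1 * stiff \<delta> k (fst p)) *\<^sub>R bump_grad \<delta> (c i) (snd p) +
       bump \<delta> (c i) (snd p) *\<^sub>R (0 + (-1 *\<^sub>R 0 + stiff \<delta> k (fst p) *\<^sub>R 0))))"
    by (rule C1_add[OF C1_stiff[OF k \<delta>]], rule C1_sum, rule C1_mult[OF _ C1_bump[OF \<delta>]],
        rule C1_add[OF C1_stiff[OF \<kappa> \<delta>]], assumption, rule C1_mult[OF m C1_stiff[OF k \<delta>]])
qed (auto simp: cert_def cert_t_def cert_x_def fun_eq_iff algebra_simps diff_divide_distrib intro!: sum.cong)

text \<open>At every point at most one bump is active. The index \<open>i\<close> is arbitrary at points outside all balls,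
so that sums over \<open>I\<close> reduce to a single term everywhere.\<close>

lemma bumps_single:
  fixes c :: "nat \<Rightarrow> 'a::euclidean_space"
  assumes \<delta>: "0 < \<delta>" and I: "I \<noteq> {}"
    and sep: "\<And>i j. i \<in> I \<Longrightarrow> j \<in> I \<Longrightarrow> i \<noteq> j \<Longrightarrow> 2 * pi * \<delta> \<le> norm (c i - c j)"
  shows "\<exists>i\<in>I. \<forall>j\<in>I - {i}. bump \<delta> (c j) x = 0 \<and> bump_grad \<delta> (c j) x = 0"
proof (cases "\<exists>i\<in>I. norm (x - c i) < pi * \<delta>")
  case True
  then obtain i where i: "i \<in> I" "norm (x - c i) < pi * \<delta>" by blast
  have "pi * \<delta> \<le> norm (x - c j)" if "j \<in> I - {i}" for j
  proof -
    have "norm (c i - c j) \<le> norm (x - c j) + norm (x - c i)"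
      using norm_triangle_ineq4[of "x - c j" "x - c i"] by simp
    then show ?thesis using sep[OF i(1), of j] that i(2) by auto
  qed
  then show ?thesis using bump_outside[OF \<delta>] i(1) by blast
next
  case False
  then show ?thesis using bump_outside[OF \<delta>] I by (meson DiffD1 all_not_in_conv not_less)
qed

lemma sum_single:
  assumes "finite I" "i \<in> I" "\<And>j. j \<in> I - {i} \<Longrightarrow> f j = 0"
  shows "sum f I = f i"
  using sum.remove[OF assms(1,2), of f] assms(3) by (simp add: sum.neutral)

lemma cert_single:
  fixes c :: "nat \<Rightarrow> 'a::euclidean_space"
  assumes "finite I" "i \<in> I" and s: "\<forall>j\<in>I - {i}. bump \<delta> (c j) x = 0 \<and> bump_grad \<delta> (c j) x = 0"
  shows "cert \<delta> I k \<kappa> c (t, x) = stiff \<delta> k t + (stiff \<delta> (\<kappa> i) t - stiff \<delta> k t) * bump \<delta> (c i) x"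
    and "cert_t \<delta> I k \<kappa> c (t, x) = - (stiff \<delta> k t)\<^sup>2 / (2 * \<delta>\<^sup>2) +
       ((stiff \<delta> k t)\<^sup>2 - (stiff \<delta> (\<kappa> i) t)\<^sup>2) / (2 * \<delta>\<^sup>2) * bump \<delta> (c i) x"
    and "cert_x \<delta> I k \<kappa> c (t, x) = (stiff \<delta> (\<kappa> i) t - stiff \<delta> k t) *\<^sub>R bump_grad \<delta> (c i) x"
proof -
  have e: "\<And>j. j \<in> I - {i} \<Longrightarrow> bump \<delta> (c j) x = 0" "\<And>j. j \<in> I - {i} \<Longrightarrow> bump_grad \<delta> (c j) x = 0" using s by auto
  show "cert \<delta> I k \<kappa> c (t, x) = stiff \<delta> k t + (stiff \<delta> (\<kappa> i) t - stiff \<delta> k t) * bump \<delta> (c i) x"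
    unfolding cert_def fst_conv snd_conv by (subst sum_single[OF assms(1,2)]) (simp_all add: e)
  show "cert_t \<delta> I k \<kappa> c (t, x) = - (stiff \<delta> k t)\<^sup>2 / (2 * \<delta>\<^sup>2) +
       ((stiff \<delta> k t)\<^sup>2 - (stiff \<delta> (\<kappa> i) t)\<^sup>2) / (2 * \<delta>\<^sup>2) * bump \<delta> (c i) x"
    unfolding cert_t_def fst_conv snd_conv by (subst sum_single[OF assms(1,2)]) (simp_all add: e)
  show "cert_x \<delta> I k \<kappa> c (t, x) = (stiff \<delta> (\<kappa> i) t - stiff \<delta> k t) *\<^sub>R bump_grad \<delta> (c i) x"
    unfolding cert_x_def fst_conv snd_conv by (subst sum_single[OF assms(1,2)]) (simp_all add: e)
qed

lemma cert_hamilton_jacobi: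
  fixes c :: "nat \<Rightarrow> 'a::euclidean_space"
  assumes \<delta>: "0 < \<delta>" and I: "finite I" "I \<noteq> {}"
    and sep: "\<And>i j. i \<in> I \<Longrightarrow> j \<in> I \<Longrightarrow> i \<noteq> j \<Longrightarrow> 2 * pi * \<delta> \<le> norm (c i - c j)"
  shows "cert_t \<delta> I k \<kappa> c p + (cert_x \<delta> I k \<kappa> c p \<bullet> cert_x \<delta> I k \<kappa> c p + (cert \<delta> I k \<kappa> c p)\<^sup>2 / \<delta>\<^sup>2) / 2 = 0"
proof -
  obtain t x where p: "p = (t, x)" by (cases p)
  obtain i where i: "i \<in> I" "\<forall>j\<in>I - {i}. bump \<delta> (c j) x = 0 \<and> bump_grad \<delta> (c j) x = 0"
    using bumps_single[where c = c and x = x, OF \<delta> I(2)] sep by blast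
  note e = cert_single[OF I(1) i(1,2)]
  show ?thesis
    unfolding p e inner_scaleR_left inner_scaleR_right bump_grad_inner[OF \<delta>]
    using \<delta> by (simp add: field_simps power2_eq_square)
qed

section \<open>Duality for the action\<close>

text \<open>Fenchel's inequality for \<open>f_wf\<close>: for \<open>x > 0\<close> the difference of the two sides is at least
\<open>(|y - x b|^2 + \<delta>^2 (z - x c/\<delta>^2)^2)/(2x)\<close>.\<close>

lemma f_wf_ge_linear:
  assumes \<delta>: "0 < \<delta>" and hj: "a + (b \<bullet> b + c\<^sup>2 / \<delta>\<^sup>2) / 2 \<le> 0"
  shows "ennreal (a * x + b \<bullet> y + c * z) \<le> f_wf \<delta> x y z"
proof (cases "0 < x")
  case True
  have "0 \<le> (y - x *\<^sub>R b) \<bullet> (y - x *\<^sub>R b) + \<delta>\<^sup>2 * (z - x * c / \<delta>\<^sup>2)\<^sup>2" by simp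
  also have "\<dots> = (y \<bullet> y + \<delta>\<^sup>2 * z\<^sup>2) - 2 * x * (b \<bullet> y + c * z) + x\<^sup>2 * (b \<bullet> b + c\<^sup>2 / \<delta>\<^sup>2)"
    using \<delta> by (simp add: inner_diff_left inner_diff_right inner_commute field_simps power2_eq_square)
  also have "\<dots> \<le> (y \<bullet> y + \<delta>\<^sup>2 * z\<^sup>2) - 2 * x * (b \<bullet> y + c * z) + x\<^sup>2 * (- 2 * a)"
  proof (intro add_left_mono mult_left_mono)
    show "b \<bullet> b + c\<^sup>2 / \<delta>\<^sup>2 \<le> - 2 * a" using hj by argo
  qed simp
  finally have "2 * x * (a * x + b \<bullet> y + c * z) \<le> (norm y)\<^sup>2 + \<delta>\<^sup>2 * z\<^sup>2"
    unfolding power2_norm_eq_inner by (simp add: algebra_simps power2_eq_square)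
  then have "a * x + b \<bullet> y + c * z \<le> ((norm y)\<^sup>2 + \<delta>\<^sup>2 * z\<^sup>2) / (2 * x)"
    using True by (simp add: field_simps)
  then show ?thesis unfolding f_wf_def using True by (simp add: ennreal_leI)
qed (simp add: f_wf_def)

text \<open>The equality case of Fenchel's inequality, read off from the same sum of squares.\<close>

lemma f_wf_eq_linear:
  assumes \<delta>: "0 < \<delta>" and hj: "a + (b \<bullet> b + c\<^sup>2 / \<delta>\<^sup>2) / 2 = 0"
    and fin: "f_wf \<delta> x y z \<noteq> \<infinity>" and eq: "enn2real (f_wf \<delta> x y z) = a * x + b \<bullet> y + c * z"
  shows "0 \<le> x \<and> y = x *\<^sub>R b \<and> z = x * c / \<delta>\<^sup>2"
proof (cases "0 < x")
  case True
  have "0 \<le> ((norm y)\<^sup>2 + \<delta>\<^sup>2 * z\<^sup>2) / (2 * x)" using True by simp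
  then have "((norm y)\<^sup>2 + \<delta>\<^sup>2 * z\<^sup>2) / (2 * x) = a * x + b \<bullet> y + c * z"
    using eq True unfolding f_wf_def by (simp only: if_True enn2real_ennreal)
  then have e: "y \<bullet> y + \<delta>\<^sup>2 * z\<^sup>2 = 2 * x * (a * x + b \<bullet> y + c * z)"
    using True by (simp add: field_simps power2_norm_eq_inner)
  define H where "H = b \<bullet> b + c\<^sup>2 / \<delta>\<^sup>2"
  have H: "2 * a + H = 0" using hj unfolding H_def by argo
  have "(y - x *\<^sub>R b) \<bullet> (y - x *\<^sub>R b) + \<delta>\<^sup>2 * (z - x * c / \<delta>\<^sup>2)\<^sup>2 =
     (y \<bullet> y + \<delta>\<^sup>2 * z\<^sup>2) - 2 * x * (b \<bullet> y + c * z) + x\<^sup>2 * (b \<bullet> b + c\<^sup>2 / \<delta>\<^sup>2)"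
    using \<delta> by (simp add: inner_diff_left inner_diff_right inner_commute field_simps power2_eq_square)
  also have "\<dots> = x\<^sup>2 * (2 * a + H)"
    unfolding e H_def[symmetric] by (simp add: algebra_simps power2_eq_square)
  also have "\<dots> = 0" unfolding H by simp
  finally have s: "(y - x *\<^sub>R b) \<bullet> (y - x *\<^sub>R b) + \<delta>\<^sup>2 * (z - x * c / \<delta>\<^sup>2)\<^sup>2 = 0" .
  have n: "0 \<le> (y - x *\<^sub>R b) \<bullet> (y - x *\<^sub>R b)" "0 \<le> \<delta>\<^sup>2 * (z - x * c / \<delta>\<^sup>2)\<^sup>2" by simp_all
  with s have "(y - x *\<^sub>R b) \<bullet> (y - x *\<^sub>R b) = 0" "\<delta>\<^sup>2 * (z - x * c / \<delta>\<^sup>2)\<^sup>2 = 0" by linarith+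
  then show ?thesis using True \<delta> by simp
next
  case False
  then show ?thesis using fin unfolding f_wf_def by (auto split: if_splits)
qed

text \<open>Several of the points \<open>x i\<close> may coincide, so the sum of Dirac masses is represented as the image of
a weighted counting measure on the indices, with density \<open>1\<close>.\<close>

lemma signed_integral_dirac_sum:
  fixes x :: "nat \<Rightarrow> 'a::euclidean_space"
  assumes I: "finite I" and h: "\<And>i. i \<in> I \<Longrightarrow> 0 \<le> h i" and x: "\<And>i. i \<in> I \<Longrightarrow> x i \<in> S"
    and S: "compact S" "continuous_on S f"
  shows "signed_integral S (\<lambda>A. \<Sum>i\<in>I. h i * dirac (x i) A) f = (\<Sum>i\<in>I. h i * f (x i))"
proof -
  define M where "M = distr (point_measure I (\<lambda>i. ennreal (h i))) (borel :: 'a measure) x"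
  have xm: "x \<in> measurable (point_measure I (\<lambda>i. ennreal (h i))) borel"
    by (simp add: measurable_def)
  have "finite_measure (point_measure I (\<lambda>i. ennreal (h i)))"
    by (rule finite_measureI) (simp add: emeasure_point_measure_finite[OF I] space_point_measure sum_ennreal h)
  then interpret finite_measure M unfolding M_def by (rule finite_measure.finite_measure_distr[OF _ xm])
  have sM: "sets M = sets borel" unfolding M_def by simp
  have I': "(LINT p|M. g p) = (\<Sum>i\<in>I. h i * g (x i))" if "g \<in> borel_measurable borel" for g :: "'a \<Rightarrow> real"
    unfolding M_def integral_distr[OF xm that]
    by (subst lebesgue_integral_point_measure_finite[OF I]) (simp_all add: h)
  have "has_density (\<lambda>A. \<Sum>i\<in>I. h i * dirac (x i) A) M (\<lambda>_. 1::real)"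
    unfolding has_density_def
  proof (intro conjI ballI)
    fix A :: "'a set" assume A: "A \<in> sets borel"
    have "(LINT p:A|M. (1::real)) = (\<Sum>i\<in>I. h i * (indicator A (x i) *\<^sub>R 1))"
      unfolding set_lebesgue_integral_def by (rule I') (use A in simp)
    then show "(\<Sum>i\<in>I. h i * dirac (x i) A) = (LINT p:A|M. 1)"
      using A by (simp add: dirac_def measure_return)
  qed simp
  from signed_integral_density(2)[OF this sM S(1) borel_compact[OF S(1)] S(2)]
  have "signed_integral S (\<lambda>A. \<Sum>i\<in>I. h i * dirac (x i) A) f = (LINT p|M. indicator S p *\<^sub>R f p)"
    by (simp add: set_lebesgue_integral_def)
  also have "\<dots> = (\<Sum>i\<in>I. h i * (indicator S (x i) *\<^sub>R f (x i)))"
    by (rule I'[OF borel_measurable_continuous_on_indicator[OF borel_compact[OF S(1)] S(2)]])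
  finally show ?thesis using x by (simp cong: sum.cong)
qed

lemma pairing_density:
  fixes \<Omega> :: "'a::euclidean_space set"
  assumes b: "bounded \<Omega>"
    and d: "triple_density ({0..1} \<times> closure \<Omega>) M r w z (\<rho>, \<omega>, \<zeta>)"
    and C1: "C1_with_derivs ({0..1} \<times> closure \<Omega>) \<phi> \<phi>t \<phi>x"
  shows "set_integrable M ({0..1} \<times> closure \<Omega>) (\<lambda>p. \<phi>t p * r p + \<phi>x p \<bullet> w p + \<phi> p * z p)"
    and "signed_integral ({0..1} \<times> closure \<Omega>) \<rho> \<phi>t + vector_integral ({0..1} \<times> closure \<Omega>) \<omega> \<phi>x +
      signed_integral ({0..1} \<times> closure \<Omega>) \<zeta> \<phi> =
      (LINT p:{0..1} \<times> closure \<Omega>|M. \<phi>t p * r p + \<phi>x p \<bullet> w p + \<phi> p * z p)"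
proof -
  let ?X = "{0..1::real} \<times> closure \<Omega>"
  have X: "compact ?X" using b by (intro compact_Times compact_Icc) (simp_all add: compact_closure)
  have h: "has_density \<rho> M r" "has_density \<omega> M w" "has_density \<zeta> M z" and sM: "sets M = sets borel"
    using d unfolding triple_density_def by simp_all
  have c: "continuous_on ?X \<phi>t" "continuous_on ?X \<phi>x" using C1 unfolding C1_with_derivs_def by simp_all
  note 1 = signed_integral_density[OF h(1) sM X borel_compact[OF X] c(1)]
  note 2 = vector_integral_density[OF h(2) sM X borel_compact[OF X] c(2)]
  note 3 = signed_integral_density[OF h(3) sM X borel_compact[OF X] C1_continuous_on[OF C1]]
  show "set_integrable M ?X (\<lambda>p. \<phi>t p * r p + \<phi>x p \<bullet> w p + \<phi> p * z p)"
    by (intro set_integral_add(1) 1(1) 2(1) 3(1))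
  show "signed_integral ?X \<rho> \<phi>t + vector_integral ?X \<omega> \<phi>x + signed_integral ?X \<zeta> \<phi> =
     (LINT p:?X|M. \<phi>t p * r p + \<phi>x p \<bullet> w p + \<phi> p * z p)"
    unfolding 1(2) 2(2) 3(2) by (simp only: set_integral_add(2)[OF set_integral_add(1)[OF 1(1) 2(1)] 3(1)] set_integral_add(2)[OF 1(1) 2(1)])
qed

lemma CE_pairing:
  fixes \<Omega> :: "'a::euclidean_space set"
  assumes ce: "(\<rho>, \<omega>, \<zeta>) \<in> CE \<Omega> \<rho>0 \<rho>1" and b: "bounded \<Omega>"
    and d: "triple_density ({0..1} \<times> closure \<Omega>) M r w z (\<rho>, \<omega>, \<zeta>)"
    and C1: "C1_with_derivs ({0..1} \<times> closure \<Omega>) \<phi> \<phi>t \<phi>x"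
  shows "set_integrable M ({0..1} \<times> closure \<Omega>) (\<lambda>p. \<phi>t p * r p + \<phi>x p \<bullet> w p + \<phi> p * z p)"
    and "(LINT p:{0..1} \<times> closure \<Omega>|M. \<phi>t p * r p + \<phi>x p \<bullet> w p + \<phi> p * z p) =
      signed_integral (closure \<Omega>) \<rho>1 (\<lambda>x. \<phi> (1, x)) - signed_integral (closure \<Omega>) \<rho>0 (\<lambda>x. \<phi> (0, x))"
  using ce C1 pairing_density[OF b d C1] unfolding CE_def Let_def by auto

lemma CE_triple_density:
  assumes "(\<rho>, \<omega>, \<zeta>) \<in> CE \<Omega> \<rho>0 \<rho>1"
  shows "\<exists>M r w z. triple_density ({0..1} \<times> closure \<Omega>) M r w z (\<rho>, \<omega>, \<zeta>)"
  using assms unfolding CE_def Let_def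
  by (intro triple_density_exists borel_closed closed_Times closed_closure closed_atLeastAtMost) auto

lemma ennreal_integral_le:
  fixes g :: "'b \<Rightarrow> real"
  assumes "integrable M g"
  shows "ennreal (LINT x|M. g x) \<le> (\<integral>\<^sup>+x. ennreal (g x) \<partial>M)"
proof -
  have "(LINT x|M. g x) \<le> (LINT x|M. max 0 (g x))"
    using assms by (intro integral_mono) auto
  then have "ennreal (LINT x|M. g x) \<le> ennreal (LINT x|M. max 0 (g x))" by (rule ennreal_leI)
  also have "\<dots> = (\<integral>\<^sup>+x. ennreal (max 0 (g x)) \<partial>M)"
    using assms by (intro nn_integral_eq_integral[symmetric]) auto
  also have "\<dots> = (\<integral>\<^sup>+x. ennreal (g x) \<partial>M)"
    by (intro nn_integral_cong) (simp add: max_def ennreal_neg)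
  finally show ?thesis .
qed

lemma action_lower_bound:
  fixes \<Omega> :: "'a::euclidean_space set"
  assumes ce: "(\<rho>, \<omega>, \<zeta>) \<in> CE \<Omega> \<rho>0 \<rho>1" and b: "bounded \<Omega>" and \<delta>: "0 < \<delta>"
    and C1: "C1_with_derivs ({0..1} \<times> closure \<Omega>) \<phi> \<phi>t \<phi>x"
    and hj: "\<And>p. p \<in> {0..1} \<times> closure \<Omega> \<Longrightarrow> \<phi>t p + (\<phi>x p \<bullet> \<phi>x p + (\<phi> p)\<^sup>2 / \<delta>\<^sup>2) / 2 \<le> 0"
  shows "ennreal (signed_integral (closure \<Omega>) \<rho>1 (\<lambda>x. \<phi> (1, x)) - signed_integral (closure \<Omega>) \<rho>0 (\<lambda>x. \<phi> (0, x)))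
     \<le> action \<delta> \<Omega> (\<rho>, \<omega>, \<zeta>)"
proof -
  let ?X = "{0..1::real} \<times> closure \<Omega>"
  obtain M r w z where d: "triple_density ?X M r w z (\<rho>, \<omega>, \<zeta>)" using CE_triple_density[OF ce] by blast
  note P = CE_pairing[OF ce b d C1]
  have "ennreal (LINT p:?X|M. \<phi>t p * r p + \<phi>x p \<bullet> w p + \<phi> p * z p) \<le>
     (\<integral>\<^sup>+p. ennreal (indicator ?X p *\<^sub>R (\<phi>t p * r p + \<phi>x p \<bullet> w p + \<phi> p * z p)) \<partial>M)"
    using P(1) unfolding set_lebesgue_integral_def set_integrable_def by (rule ennreal_integral_le)
  also have "\<dots> \<le> (\<integral>\<^sup>+p\<in>?X. f_wf \<delta> (r p) (w p) (z p) \<partial>M)"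
    by (intro nn_integral_mono) (auto simp: indicator_def intro!: f_wf_ge_linear[OF \<delta>] hj)
  also have "\<dots> = action \<delta> \<Omega> (\<rho>, \<omega>, \<zeta>)" by (rule action_eq[OF d, symmetric])
  finally show ?thesis unfolding P(2) .
qed

text \<open>The duality gap is the integral of the pointwise gap in Fenchel's inequality. If it is zero, the
pointwise gap vanishes almost everywhere. The finiteness of the action is what permits subtracting
the two integrals.\<close>

lemma action_optimal:
  fixes \<Omega> :: "'a::euclidean_space set"
  assumes ce: "(\<rho>, \<omega>, \<zeta>) \<in> CE \<Omega> \<rho>0 \<rho>1" and b: "bounded \<Omega>" and \<delta>: "0 < \<delta>"
    and d: "triple_density ({0..1} \<times> closure \<Omega>) M r w z (\<rho>, \<omega>, \<zeta>)"
    and C1: "C1_with_derivs ({0..1} \<times> closure \<Omega>) \<phi> \<phi>t \<phi>x"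
    and hj: "\<And>p. p \<in> {0..1} \<times> closure \<Omega> \<Longrightarrow> \<phi>t p + (\<phi>x p \<bullet> \<phi>x p + (\<phi> p)\<^sup>2 / \<delta>\<^sup>2) / 2 = 0"
    and opt: "action \<delta> \<Omega> (\<rho>, \<omega>, \<zeta>) = ennreal V" "0 \<le> V"
      "V = signed_integral (closure \<Omega>) \<rho>1 (\<lambda>x. \<phi> (1, x)) - signed_integral (closure \<Omega>) \<rho>0 (\<lambda>x. \<phi> (0, x))"
  shows "AE p in M. p \<in> {0..1} \<times> closure \<Omega> \<longrightarrow> 0 \<le> r p \<and> w p = r p *\<^sub>R \<phi>x p \<and> z p = r p * \<phi> p / \<delta>\<^sup>2"
proof -
  let ?X = "{0..1::real} \<times> closure \<Omega>"
  note P = CE_pairing[OF ce b d C1]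
  have h: "has_density \<rho> M r" "has_density \<omega> M w" "has_density \<zeta> M z" and sM: "sets M = sets borel"
    using d unfolding triple_density_def by simp_all
  have Xm[measurable]: "?X \<in> sets M"
    unfolding sM by (intro borel_closed closed_Times closed_closure closed_atLeastAtMost)
  have rwz: "r \<in> borel_measurable M" "w \<in> borel_measurable M" "z \<in> borel_measurable M"
    by (intro borel_measurable_integrable has_density_integrable[OF h(1)]
        has_density_integrable[OF h(2)] has_density_integrable[OF h(3)])+
  note [measurable] = borel_measurable_f_wf[OF rwz, of \<delta>]
  define F where "F p = f_wf \<delta> (r p) (w p) (z p) * indicator ?X p" for p
  define L where "L p = indicator ?X p *\<^sub>R (\<phi>t p * r p + \<phi>x p \<bullet> w p + \<phi> p * z p)" for p
  have Fm[measurable]: "F \<in> borel_measurable M" unfolding F_def by measurable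
  have IF: "(\<integral>\<^sup>+p. F p \<partial>M) = ennreal V" using opt(1) unfolding action_eq[OF d] F_def .
  have Li: "integrable M L" and IL: "(LINT p|M. L p) = V"
    using P unfolding L_def set_integrable_def set_lebesgue_integral_def opt(3) by auto
  have fin: "AE p in M. F p \<noteq> \<infinity>"
    by (rule nn_integral_PInf_AE[OF Fm]) (simp add: IF)
  have IR: "(\<integral>\<^sup>+p. ennreal (enn2real (F p)) \<partial>M) = ennreal V"
    unfolding IF[symmetric] by (rule nn_integral_cong_AE) (use fin in \<open>auto simp: less_top\<close>)
  have Ri: "integrable M (\<lambda>p. enn2real (F p))"
    by (rule integrableI_nonneg) (simp_all add: IR)
  have IRL: "(LINT p|M. enn2real (F p)) = V"
    by (rule integral_eq_nn_integral[THEN trans]) (simp_all add: IR opt(2))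
  have LF: "ennreal (L p) \<le> F p" for p
    unfolding L_def F_def by (auto simp: indicator_def intro!: f_wf_ge_linear[OF \<delta>] eq_refl[OF hj])
  have "AE p in M. enn2real (F p) - L p = 0"
  proof (subst integral_nonneg_eq_0_iff_AE[symmetric])
    show "integrable M (\<lambda>p. enn2real (F p) - L p)" using Ri Li by simp
    show "AE p in M. 0 \<le> enn2real (F p) - L p"
      using fin
    proof eventually_elim
      case (elim p)
      then have "ennreal (L p) \<le> ennreal (enn2real (F p))" using LF[of p] by (simp add: less_top)
      then show ?case by (simp add: ennreal_le_iff)
    qed
    show "(LINT p|M. enn2real (F p) - L p) = 0" using Ri Li IRL IL by simp
  qed
  then show ?thesis using fin
  proof eventually_elim
    case (elim p)
    show ?case
    proof
      assume p: "p \<in> ?X"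
      show "0 \<le> r p \<and> w p = r p *\<^sub>R \<phi>x p \<and> z p = r p * \<phi> p / \<delta>\<^sup>2"
        by (rule f_wf_eq_linear[OF \<delta> hj[OF p]]) (use elim p in \<open>simp_all add: F_def L_def\<close>)
    qed
  qed
qed

section \<open>One pair of Dirac masses in the cone\<close>

text \<open>The angle from the eigenvector of \<open>\<kappa>\<close> to \<open>P\<^sub>0\<close> that solves \<open>K P\<^sub>0 = P\<^sub>1\<close> for the given second eigenvalue
\<open>k\<close>: if \<open>P\<^sub>0\<close>, \<open>P\<^sub>1\<close> have moduli \<open>\<surd>h0\<close>, \<open>\<surd>h1\<close> and angles \<open>\<alpha>\<close>, \<open>\<alpha> + \<theta>\<close>, the second coordinate of the
equation reads \<open>\<surd>h1 sin (\<alpha> + \<theta>) = k \<surd>h0 sin \<alpha>\<close>.\<close>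

definition tilt :: "real \<Rightarrow> real \<Rightarrow> 'a::euclidean_space \<Rightarrow> real \<Rightarrow> 'a \<Rightarrow> real \<Rightarrow> real" where
  "tilt \<delta> h0 x0 h1 x1 k = arctan (sqrt h1 * sin (half_angle \<delta> x0 x1) /
     (k * sqrt h0 - sqrt h1 * cos (half_angle \<delta> x0 x1)))"

text \<open>The eigenvalue \<open>\<kappa>\<close>, from the first coordinate of \<open>K P\<^sub>0 = P\<^sub>1\<close>.\<close>

definition radial_factor :: "real \<Rightarrow> real \<Rightarrow> 'a::euclidean_space \<Rightarrow> real \<Rightarrow> 'a \<Rightarrow> real \<Rightarrow> real" where
  "radial_factor \<delta> h0 x0 h1 x1 k =
     sqrt h1 * cos (tilt \<delta> h0 x0 h1 x1 k + half_angle \<delta> x0 x1) / (sqrt h0 * cos (tilt \<delta> h0 x0 h1 x1 k))"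

text \<open>The point of the line through \<open>x0\<close> and \<open>x1\<close> that lies in the direction of the eigenvector; it is
behind \<open>x0\<close>, seen from \<open>x1\<close>.\<close>

definition centre :: "real \<Rightarrow> real \<Rightarrow> 'a::euclidean_space \<Rightarrow> real \<Rightarrow> 'a \<Rightarrow> real \<Rightarrow> 'a" where
  "centre \<delta> h0 x0 h1 x1 k = x0 - (2 * \<delta> * tilt \<delta> h0 x0 h1 x1 k) *\<^sub>R sgn (x1 - x0)"

definition pair_cost :: "real \<Rightarrow> real \<Rightarrow> 'a::euclidean_space \<Rightarrow> real \<Rightarrow> 'a \<Rightarrow> real" where
  "pair_cost \<delta> h0 x0 h1 x1 = 2 * \<delta>\<^sup>2 * (h0 + h1 - 2 * sqrt (h0 * h1) * cos (half_angle \<delta> x0 x1))"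

lemma bump_eq_cos:
  assumes "0 < \<delta>" "norm (x - c) = 2 * \<delta> * s" "s \<le> pi / 2"
  shows "bump \<delta> c x = (cos s)\<^sup>2"
proof -
  have "norm (x - c) / \<delta> = 2 * s" using assms(1,2) by simp
  moreover have "min (2 * s) pi = 2 * s" using assms(3) by simp
  ultimately show ?thesis unfolding bump_def using cos_double_cos[of s] by simp
qed

lemma half_angle_bounds:
  assumes "0 < \<delta>" "norm (x0 - x1) < pi * \<delta>"
  shows "0 \<le> half_angle \<delta> x0 x1" "half_angle \<delta> x0 x1 < pi / 2" "0 < cos (half_angle \<delta> x0 x1)"
    "0 \<le> sin (half_angle \<delta> x0 x1)"
proof -
  show a: "0 \<le> half_angle \<delta> x0 x1" unfolding half_angle_def using assms by simp
  show b: "half_angle \<delta> x0 x1 < pi / 2"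
    unfolding half_angle_def using assms by (simp add: field_simps norm_minus_commute)
  show "0 < cos (half_angle \<delta> x0 x1)" using a b by (intro cos_gt_zero_pi) auto
  show "0 \<le> sin (half_angle \<delta> x0 x1)" using a b by (intro sin_ge_zero) auto
qed

lemma displacement_eq:
  assumes "0 < \<delta>"
  shows "x1 - x0 = (2 * \<delta> * half_angle \<delta> x0 x1) *\<^sub>R sgn (x1 - x0)"
  unfolding half_angle_def sgn_div_norm using assms by (cases "x1 = x0") simp_all

lemma cos_arctan_squared: "(cos (arctan x))\<^sup>2 = 1 / (1 + x\<^sup>2)"
  unfolding cos_arctan power_divide by simp

lemma inverse_one_plus_squared:
  fixes a b :: real
  assumes "a \<noteq> 0" shows "1 / (1 + (b / a)\<^sup>2) = a\<^sup>2 / (a\<^sup>2 + b\<^sup>2)"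
proof -
  have "1 + (b / a)\<^sup>2 = (a\<^sup>2 + b\<^sup>2) / a\<^sup>2" using assms by (simp add: power_divide add_divide_distrib)
  then show ?thesis by simp
qed

text \<open>The condition on \<open>k\<close> says that \<open>K\<close> is positive definite with both points inside the open right angle
about its first eigenvector.\<close>

locale dirac_pair =
  fixes \<delta> h0 h1 :: real and x0 x1 :: "'a::euclidean_space" and k :: real
  assumes \<delta>: "0 < \<delta>" and h0: "0 < h0" and h1: "0 < h1"
    and near: "norm (x0 - x1) < pi * \<delta>"
    and large: "sqrt h1 < k * sqrt h0 * cos (half_angle \<delta> x0 x1)"
begin

abbreviation \<theta> where "\<theta> \<equiv> half_angle \<delta> x0 x1"
abbreviation \<alpha> where "\<alpha> \<equiv> tilt \<delta> h0 x0 h1 x1 k"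
abbreviation \<kappa> where "\<kappa> \<equiv> radial_factor \<delta> h0 x0 h1 x1 k"
abbreviation c where "c \<equiv> centre \<delta> h0 x0 h1 x1 k"
abbreviation e where "e \<equiv> sgn (x1 - x0)"
abbreviation h where "h \<equiv> dirac_mass \<delta> h0 x0 h1 x1"

definition p where "p = sqrt h0 * cos \<alpha>"
definition q where "q = sqrt h0 * sin \<alpha>"

lemmas \<theta>_bounds = half_angle_bounds[OF \<delta> near]

lemma k_pos: "0 < k"
proof -
  have "0 < k * (sqrt h0 * cos \<theta>)" using less_trans[OF real_sqrt_gt_zero[OF h1] large] by (simp only: mult.assoc)
  moreover have "0 < sqrt h0 * cos \<theta>" using h0 \<theta>_bounds by simp
  ultimately show ?thesis by (simp add: zero_less_mult_iff)
qed

lemma denominator_pos: "0 < k * sqrt h0 - sqrt h1 * cos \<theta>"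
proof -
  have "k * sqrt h0 * cos \<theta> \<le> k * sqrt h0 * 1" using k_pos h0 by (intro mult_left_mono) auto
  moreover have "sqrt h1 * cos \<theta> \<le> sqrt h1 * 1" using h1 by (intro mult_left_mono) auto
  ultimately show ?thesis using large by linarith
qed

lemma \<alpha>_bounds: "0 \<le> \<alpha>" "\<alpha> < pi / 2" "0 < cos \<alpha>" "0 \<le> sin \<alpha>"
proof -
  have "0 \<le> sqrt h1 * sin \<theta> / (k * sqrt h0 - sqrt h1 * cos \<theta>)"
    using denominator_pos \<theta>_bounds h1 by (intro divide_nonneg_pos mult_nonneg_nonneg) auto
  then show a: "0 \<le> \<alpha>" unfolding tilt_def by simp
  show b: "\<alpha> < pi / 2" unfolding tilt_def by (rule arctan_ubound)
  show "0 < cos \<alpha>" using a b by (intro cos_gt_zero_pi) auto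
  show "0 \<le> sin \<alpha>" using a b by (intro sin_ge_zero) auto
qed

lemma tan_\<alpha>: "sin \<alpha> * (k * sqrt h0 - sqrt h1 * cos \<theta>) = sqrt h1 * sin \<theta> * cos \<alpha>"
proof -
  have "tan \<alpha> = sqrt h1 * sin \<theta> / (k * sqrt h0 - sqrt h1 * cos \<theta>)" unfolding tilt_def by (rule tan_arctan)
  then show ?thesis unfolding tan_def using denominator_pos \<alpha>_bounds by (simp add: field_simps)
qed

lemma kq: "k * q = sqrt h1 * sin (\<alpha> + \<theta>)"
  unfolding q_def sin_add using tan_\<alpha> by (simp add: algebra_simps)

lemma \<alpha>\<theta>_bounds: "\<alpha> + \<theta> < pi / 2" "0 < cos (\<alpha> + \<theta>)"
proof -
  let ?d = "k * sqrt h0 - sqrt h1 * cos \<theta>"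
  have "?d * cos (\<alpha> + \<theta>) = cos \<alpha> * cos \<theta> * ?d - sin \<theta> * (sin \<alpha> * ?d)"
    unfolding cos_add by (simp add: algebra_simps)
  also have "\<dots> = cos \<alpha> * (k * sqrt h0 * cos \<theta> - sqrt h1 * ((cos \<theta>)\<^sup>2 + (sin \<theta>)\<^sup>2))"
    unfolding tan_\<alpha> power2_eq_square by (simp add: algebra_simps del: sin_cos_squared_add3)
  also have "\<dots> = cos \<alpha> * (k * sqrt h0 * cos \<theta> - sqrt h1)" by simp
  finally have "0 < ?d * cos (\<alpha> + \<theta>)" using large \<alpha>_bounds by simp
  then show c: "0 < cos (\<alpha> + \<theta>)" using denominator_pos by (simp add: zero_less_mult_iff)
  show "\<alpha> + \<theta> < pi / 2"
  proof (rule ccontr)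
    assume "\<not> ?thesis"
    then have "cos (\<alpha> + \<theta>) \<le> cos (pi / 2)"
      using \<alpha>_bounds \<theta>_bounds by (intro cos_monotone_0_pi_le) auto
    then show False using c by simp
  qed
qed

lemma p_pos: "0 < p" and q_nonneg: "0 \<le> q"
  unfolding p_def q_def using h0 \<alpha>_bounds by simp_all

lemma \<kappa>p: "\<kappa> * p = sqrt h1 * cos (\<alpha> + \<theta>)"
  unfolding radial_factor_def p_def using h0 \<alpha>_bounds by simp

lemma \<kappa>_pos: "0 < \<kappa>"
  unfolding radial_factor_def using h0 h1 \<alpha>_bounds \<alpha>\<theta>_bounds by simp

lemma \<kappa>_less: "\<kappa> < k"
proof -
  have "cos (\<alpha> + \<theta>) \<le> cos \<alpha>"
    using \<alpha>_bounds \<theta>_bounds \<alpha>\<theta>_bounds by (intro cos_monotone_0_pi_le) auto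
  then have "sqrt h1 * cos (\<alpha> + \<theta>) \<le> sqrt h1 * cos \<alpha>" using h1 by (intro mult_left_mono) auto
  also have "\<dots> < k * sqrt h0 * cos \<alpha>"
  proof (rule mult_strict_right_mono)
    have "k * sqrt h0 * cos \<theta> \<le> k * sqrt h0 * 1" using k_pos h0 by (intro mult_left_mono) auto
    then show "sqrt h1 < k * sqrt h0" using large by linarith
  qed (rule \<alpha>_bounds)
  finally have "\<kappa> * p < k * p" unfolding \<kappa>p unfolding p_def by (simp add: mult.assoc)
  then show ?thesis using p_pos by simp
qed

lemma p2q2: "p\<^sup>2 + q\<^sup>2 = h0" "(\<kappa> * p)\<^sup>2 + (k * q)\<^sup>2 = h1" "p * (\<kappa> * p) + q * (k * q) = sqrt (h0 * h1) * cos \<theta>"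
proof -
  show "p\<^sup>2 + q\<^sup>2 = h0" unfolding p_def q_def power_mult_distrib
    using h0 by (simp flip: distrib_left)
  show "(\<kappa> * p)\<^sup>2 + (k * q)\<^sup>2 = h1" unfolding \<kappa>p kq power_mult_distrib
    using h1 by (simp flip: distrib_left)
  have "p * (\<kappa> * p) + q * (k * q) = sqrt h0 * sqrt h1 * (cos (\<alpha> + \<theta>) * cos \<alpha> + sin (\<alpha> + \<theta>) * sin \<alpha>)"
    unfolding \<kappa>p kq unfolding p_def q_def by (simp add: algebra_simps)
  also have "\<dots> = sqrt h0 * sqrt h1 * cos \<theta>" using cos_diff[of "\<alpha> + \<theta>" \<alpha>] by simp
  finally show "p * (\<kappa> * p) + q * (k * q) = sqrt (h0 * h1) * cos \<theta>" by (simp add: real_sqrt_mult)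
qed

text \<open>Pythagoras for \<open>(1-t) P\<^sub>0 + t P\<^sub>1\<close>, whose coordinates in the eigenframe of \<open>K\<close> are \<open>p stretch \<kappa> t\<close> and
\<open>q stretch k t\<close>.\<close>

lemma mass_eq: "h t = (p * stretch \<kappa> t)\<^sup>2 + (q * stretch k t)\<^sup>2"
proof -
  have "(p * stretch \<kappa> t)\<^sup>2 + (q * stretch k t)\<^sup>2 =
    (1 - t)\<^sup>2 * (p\<^sup>2 + q\<^sup>2) + 2 * t * (1 - t) * (p * (\<kappa> * p) + q * (k * q)) + t\<^sup>2 * ((\<kappa> * p)\<^sup>2 + (k * q)\<^sup>2)"
    unfolding stretch_def by (simp add: algebra_simps power2_eq_square)
  also have "\<dots> = h t" unfolding p2q2 dirac_mass_def Let_def by (simp add: algebra_simps power2_eq_square)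
  finally show ?thesis by simp
qed

lemma mass_pos: "t \<in> {0..1} \<Longrightarrow> 0 < h t"
  unfolding mass_eq using p_pos stretch_pos[OF \<kappa>_pos, of t] by (intro add_pos_nonneg) auto

definition angle :: "real \<Rightarrow> real" where
  "angle t = arctan (q * stretch k t / (p * stretch \<kappa> t))"

lemma angle_bounds:
  assumes t: "t \<in> {0..1}"
  shows "\<alpha> \<le> angle t" "angle t \<le> \<alpha> + \<theta>" "0 \<le> angle t" "angle t < pi / 2"
proof -
  have s: "0 < stretch k t" "0 < stretch \<kappa> t" using stretch_pos k_pos \<kappa>_pos t by blast+
  have a: "\<alpha> = arctan (q / p)"
  proof -
    have "q / p = tan \<alpha>" unfolding p_def q_def tan_def using h0 by simp
    then show ?thesis using arctan_tan[of \<alpha>] \<alpha>_bounds by simp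
  qed
  have b: "\<alpha> + \<theta> = arctan (k * q / (\<kappa> * p))"
  proof -
    have "k * q / (\<kappa> * p) = tan (\<alpha> + \<theta>)" unfolding kq \<kappa>p tan_def using h1 by simp
    then show ?thesis using arctan_tan[of "\<alpha> + \<theta>"] \<alpha>_bounds \<alpha>\<theta>_bounds \<theta>_bounds by simp
  qed
  have "stretch \<kappa> t \<le> stretch k t" unfolding stretch_def using \<kappa>_less t by (simp add: mult_left_mono)
  then have "q / p \<le> q * stretch k t / (p * stretch \<kappa> t)"
    using s p_pos q_nonneg by (simp add: divide_simps mult_left_mono mult.assoc)
  then show l: "\<alpha> \<le> angle t" unfolding a angle_def by (rule arctan_monotone')
  have "(1 - t) * \<kappa> \<le> (1 - t) * k" using \<kappa>_less t by (intro mult_left_mono) auto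
  then have "stretch k t * \<kappa> \<le> k * stretch \<kappa> t" unfolding stretch_def by (simp add: algebra_simps)
  then have "q * p * (stretch k t * \<kappa>) \<le> q * p * (k * stretch \<kappa> t)"
    using p_pos q_nonneg by (intro mult_left_mono) auto
  then have "q * stretch k t / (p * stretch \<kappa> t) \<le> k * q / (\<kappa> * p)"
    using s p_pos \<kappa>_pos by (simp add: divide_simps mult_ac)
  then show "angle t \<le> \<alpha> + \<theta>" unfolding b angle_def by (rule arctan_monotone')
  show "0 \<le> angle t" using l \<alpha>_bounds by simp
  show "angle t < pi / 2" unfolding angle_def by (rule arctan_ubound)
qed

definition position :: "real \<Rightarrow> 'a" where
  "position t = c + (2 * \<delta> * angle t) *\<^sub>R e"

lemma position_0: "position 0 = x0"
proof -
  have "angle 0 = \<alpha>"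
  proof -
    have "q * stretch k 0 / (p * stretch \<kappa> 0) = tan \<alpha>" unfolding p_def q_def tan_def stretch_def using h0 by simp
    then show ?thesis unfolding angle_def using arctan_tan[of \<alpha>] \<alpha>_bounds by simp
  qed
  then show ?thesis unfolding position_def centre_def by simp
qed

lemma angle_1: "angle 1 = \<alpha> + \<theta>"
proof -
  have "q * stretch k 1 / (p * stretch \<kappa> 1) = k * q / (\<kappa> * p)" unfolding stretch_def by (simp add: mult.commute)
  also have "\<dots> = tan (\<alpha> + \<theta>)" unfolding kq \<kappa>p tan_def using h1 by simp
  finally show ?thesis unfolding angle_def using arctan_tan[of "\<alpha> + \<theta>"] \<alpha>_bounds \<alpha>\<theta>_bounds \<theta>_bounds by simp
qed

lemma position_1: "position 1 = x1"
proof -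
  have "position 1 = x0 + (2 * \<delta> * \<theta>) *\<^sub>R e"
    unfolding position_def centre_def angle_1 by (simp add: algebra_simps)
  then show ?thesis unfolding displacement_eq[OF \<delta>, of x1 x0, symmetric] by simp
qed

lemma momentum_eq: "dirac_momentum \<delta> h0 x0 h1 x1 = (2 * \<delta> * (p * q * (k - \<kappa>))) *\<^sub>R e"
proof -
  have "p * q * (k - \<kappa>) = p * (k * q) - q * (\<kappa> * p)" by (simp add: algebra_simps)
  also have "\<dots> = sqrt h0 * sqrt h1 * (sin (\<alpha> + \<theta>) * cos \<alpha> - cos (\<alpha> + \<theta>) * sin \<alpha>)"
    unfolding kq \<kappa>p unfolding p_def q_def by (simp add: algebra_simps)
  also have "\<dots> = sqrt (h0 * h1) * sin \<theta>" using sin_diff[of "\<alpha> + \<theta>" \<alpha>] by (simp add: real_sqrt_mult)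
  finally show ?thesis unfolding dirac_momentum_def by (simp add: mult.assoc)
qed

lemma position_has_derivative:
  assumes t: "t \<in> {0..1}"
  shows "(position has_vector_derivative (2 * \<delta> * (p * q * (k - \<kappa>) / h t)) *\<^sub>R e) (at t within T)"
proof -
  have s: "0 < stretch k t" "0 < stretch \<kappa> t" using stretch_pos k_pos \<kappa>_pos t by blast+
  have nz: "p * stretch \<kappa> t \<noteq> 0" using p_pos s by simp
  have d1: "((\<lambda>t. q * stretch k t / (p * stretch \<kappa> t)) has_real_derivative
     (q * (k - 1) * (p * stretch \<kappa> t) - q * stretch k t * (p * (\<kappa> - 1))) / ((p * stretch \<kappa> t) * (p * stretch \<kappa> t))) (at t within T)"
    by (intro DERIV_divide DERIV_cmult stretch_has_derivative nz)
  have n: "q * (k - 1) * (p * stretch \<kappa> t) - q * stretch k t * (p * (\<kappa> - 1)) = p * q * (k - \<kappa>)"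
    unfolding stretch_def by (simp add: algebra_simps)
  have "(angle has_real_derivative (p * q * (k - \<kappa>) / ((p * stretch \<kappa> t) * (p * stretch \<kappa> t))) *
      inverse (1 + (q * stretch k t / (p * stretch \<kappa> t))\<^sup>2)) (at t within T)"
    unfolding angle_def using DERIV_chain2[OF DERIV_arctan d1[unfolded n]] by (simp add: mult.commute)
  moreover have "(p * q * (k - \<kappa>) / ((p * stretch \<kappa> t) * (p * stretch \<kappa> t))) *
      inverse (1 + (q * stretch k t / (p * stretch \<kappa> t))\<^sup>2) = p * q * (k - \<kappa>) / h t"
  proof -
    have "h t = ((p * stretch \<kappa> t) * (p * stretch \<kappa> t)) * (1 + (q * stretch k t / (p * stretch \<kappa> t))\<^sup>2)"
      unfolding mass_eq using nz by (simp add: power_divide power2_eq_square distrib_left)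
    then show ?thesis by (simp add: divide_inverse)
  qed
  ultimately have "(angle has_real_derivative p * q * (k - \<kappa>) / h t) (at t within T)" by simp
  then show ?thesis
    unfolding position_def by (auto intro!: derivative_eq_intros simp: has_vector_derivative_def has_field_derivative_def fun_eq_iff algebra_simps)
qed

text \<open>The velocity in the defining property is determined because the mass is positive; hence two solutions
differ by a constant. As the left-hand side does not mention \<open>k\<close>, the description by the angle holds
for every large \<open>k\<close>.\<close>

lemma dirac_position_eq:
  assumes t: "t \<in> {0..1}"
  shows "dirac_position \<delta> h0 x0 h1 x1 t = position t"
proof -
  let ?P = "\<lambda>x. x 0 = x0 \<and> (\<forall>t\<in>{0..1}. \<exists>v. (x has_vector_derivative v) (at t within {0..1}) \<and>
       h t *\<^sub>R v = dirac_momentum \<delta> h0 x0 h1 x1)"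
  have v: "h t *\<^sub>R ((2 * \<delta> * (p * q * (k - \<kappa>) / h t)) *\<^sub>R e) = dirac_momentum \<delta> h0 x0 h1 x1" if "t \<in> {0..1}" for t
    unfolding momentum_eq using mass_pos[OF that] by simp
  have "?P position"
  proof (intro conjI ballI position_0)
    fix t :: real assume t: "t \<in> {0..1}"
    show "\<exists>v. (position has_vector_derivative v) (at t within {0..1}) \<and>
       h t *\<^sub>R v = dirac_momentum \<delta> h0 x0 h1 x1"
      by (rule exI, rule conjI, rule position_has_derivative[OF t], rule v[OF t])
  qed
  then have P: "?P (dirac_position \<delta> h0 x0 h1 x1)" unfolding dirac_position_def by (rule someI[of ?P])
  have "((\<lambda>t. dirac_position \<delta> h0 x0 h1 x1 t - position t) has_vector_derivative 0) (at t within {0..1})"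
    if t: "t \<in> {0..1}" for t
  proof -
    obtain v' where v': "(dirac_position \<delta> h0 x0 h1 x1 has_vector_derivative v') (at t within {0..1})"
      "h t *\<^sub>R v' = dirac_momentum \<delta> h0 x0 h1 x1" using P t by blast
    then have "h t *\<^sub>R v' = h t *\<^sub>R ((2 * \<delta> * (p * q * (k - \<kappa>) / h t)) *\<^sub>R e)" using v[OF t] by simp
    then have "v' = (2 * \<delta> * (p * q * (k - \<kappa>) / h t)) *\<^sub>R e"
      by (rule scaleR_left_imp_eq[rotated]) (use mass_pos[OF t] in simp)
    then show ?thesis using has_vector_derivative_diff[OF v'(1) position_has_derivative[OF t, of "{0..1}"]] by simp
  qed
  then obtain C
    where C: "\<And>t. t \<in> {0..1} \<Longrightarrow> dirac_position \<delta> h0 x0 h1 x1 t - position t = C"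
    by (rule has_vector_derivative_zero_constant[OF convex_real_interval(5)]) (assumption, rule that)
  have "C = 0" using C[of 0] conjunct1[OF P] position_0 by simp
  then show ?thesis using C[OF t] by simp
qed

lemma norm_position_centre:
  assumes t: "t \<in> {0..1}"
  shows "norm (position t - c) = 2 * \<delta> * angle t"
proof (cases "x0 = x1")
  case True
  then have "\<theta> = 0" "\<alpha> = 0" unfolding tilt_def half_angle_def by simp_all
  then have "angle t = 0" using angle_bounds(1,2)[OF t] by linarith
  then show ?thesis unfolding position_def by simp
next
  case False
  then have "norm e = 1" by (simp add: norm_sgn)
  then show ?thesis unfolding position_def using angle_bounds[OF t] \<delta> by simp
qed

text \<open>The squared cosine of the angle between \<open>P(t)\<close> and the eigenvector.\<close>

lemma bump_position:
  assumes t: "t \<in> {0..1}"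
  shows "bump \<delta> c (position t) = (p * stretch \<kappa> t)\<^sup>2 / h t"
proof -
  have nz: "p * stretch \<kappa> t \<noteq> 0" using p_pos stretch_pos[OF \<kappa>_pos t] by simp
  have "bump \<delta> c (position t) = (cos (angle t))\<^sup>2"
    by (rule bump_eq_cos[OF \<delta> norm_position_centre[OF t]]) (use angle_bounds[OF t] in simp)
  also have "\<dots> = 1 / (1 + (q * stretch k t / (p * stretch \<kappa> t))\<^sup>2)"
    unfolding angle_def by (rule cos_arctan_squared)
  also have "\<dots> = (p * stretch \<kappa> t)\<^sup>2 / h t"
    unfolding mass_eq by (rule inverse_one_plus_squared[OF nz])
  finally show ?thesis .
qed

lemma position_segment:
  assumes t: "t \<in> {0..1}"
  shows "position t \<in> closed_segment x0 x1"
proof (cases "\<theta> = 0")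
  case True
  then have "angle t = \<alpha>" using angle_bounds(1,2)[OF t] by linarith
  then have "position t = x0" unfolding position_def centre_def by simp
  then show ?thesis by simp
next
  case False
  then have \<theta>: "0 < \<theta>" using \<theta>_bounds by simp
  define u where "u = (angle t - \<alpha>) / \<theta>"
  have u: "0 \<le> u" "u \<le> 1"
    using \<theta> angle_bounds(1,2)[OF t] unfolding u_def by (simp_all add: divide_le_eq)
  have "angle t = \<alpha> + u * \<theta>" unfolding u_def using \<theta> by simp
  then have "position t = x0 + (2 * \<delta> * (u * \<theta>)) *\<^sub>R e"
    unfolding position_def centre_def by (simp add: algebra_simps)
  also have "\<dots> = x0 + u *\<^sub>R (x1 - x0)"
  proof -
    have "u *\<^sub>R (x1 - x0) = u *\<^sub>R ((2 * \<delta> * \<theta>) *\<^sub>R e)"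
      by (rule arg_cong[where f = "\<lambda>v. u *\<^sub>R v", OF displacement_eq[OF \<delta>, of x1 x0]])
    then show ?thesis by (simp add: mult.assoc mult.left_commute)
  qed
  also have "\<dots> = (1 - u) *\<^sub>R x0 + u *\<^sub>R x1" by (simp add: algebra_simps)
  finally show ?thesis using u unfolding in_segment by (intro exI[of _ u] conjI)
qed

lemma centre_near: "norm (c - x0) < pi * \<delta>"
proof -
  have "norm (c - x0) = 2 * \<delta> * \<alpha> * norm e" unfolding centre_def using \<delta> \<alpha>_bounds by simp
  also have "\<dots> \<le> 2 * \<delta> * \<alpha> * 1" using \<delta> \<alpha>_bounds by (intro mult_left_mono) (auto simp: norm_sgn)
  also have "\<dots> < pi * \<delta>" using \<delta> \<alpha>_bounds by simp
  finally show ?thesis .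
qed

text \<open>With \<open>m(1) P\<^sub>1 = 2\<delta>^2 (P\<^sub>1 - P\<^sub>0) = m(0) P\<^sub>0\<close> the left-hand side is
\<open>2\<delta>^2 ((P\<^sub>1 - P\<^sub>0) \<cdot> P\<^sub>1 - (P\<^sub>1 - P\<^sub>0) \<cdot> P\<^sub>0)\<close>.\<close>

lemma pair_value:
  "h1 * (stiff \<delta> k 1 + (stiff \<delta> \<kappa> 1 - stiff \<delta> k 1) * bump \<delta> c x1)
   - h0 * (stiff \<delta> k 0 + (stiff \<delta> \<kappa> 0 - stiff \<delta> k 0) * bump \<delta> c x0) = pair_cost \<delta> h0 x0 h1 x1"
proof -
  have h: "h 0 = h0" "h 1 = h1" unfolding dirac_mass_def Let_def by simp_all
  have b0: "bump \<delta> c x0 = p\<^sup>2 / h0"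
    using bump_position[of 0] unfolding position_0 h by (simp add: stretch_def)
  have b1: "bump \<delta> c x1 = (\<kappa> * p)\<^sup>2 / h1"
    using bump_position[of 1] unfolding position_1 h by (simp add: stretch_def mult.commute)
  have e0: "h0 * (a + (b - a) * (p\<^sup>2 / h0)) = a * q\<^sup>2 + b * p\<^sup>2" for a b
  proof -
    have "h0 * (a + (b - a) * (p\<^sup>2 / h0)) = a * h0 + (b - a) * p\<^sup>2"
      using h0 by (simp add: distrib_left)
    also have "\<dots> = a * (p\<^sup>2 + q\<^sup>2) + (b - a) * p\<^sup>2" unfolding p2q2(1) ..
    finally show ?thesis by (simp add: algebra_simps)
  qed
  have e1: "h1 * (a + (b - a) * ((\<kappa> * p)\<^sup>2 / h1)) = a * (k * q)\<^sup>2 + b * (\<kappa> * p)\<^sup>2" for a b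
  proof -
    have "h1 * (a + (b - a) * ((\<kappa> * p)\<^sup>2 / h1)) = a * h1 + (b - a) * (\<kappa> * p)\<^sup>2"
      using h1 by (simp add: distrib_left)
    also have "\<dots> = a * ((\<kappa> * p)\<^sup>2 + (k * q)\<^sup>2) + (b - a) * (\<kappa> * p)\<^sup>2" unfolding p2q2(2) ..
    finally show ?thesis by (simp add: algebra_simps)
  qed
  have s0: "stiff \<delta> a 0 = 2 * \<delta>\<^sup>2 * (a - 1)" for a unfolding stiff_def stretch_def by simp
  have s1: "stiff \<delta> a 1 * (a * b)\<^sup>2 = 2 * \<delta>\<^sup>2 * (a - 1) * a * b\<^sup>2" if "a > 0" for a b
    unfolding stiff_def stretch_def using that by (simp add: power2_eq_square)
  have "pair_cost \<delta> h0 x0 h1 x1 = 2 * \<delta>\<^sup>2 * ((p\<^sup>2 + q\<^sup>2) + ((\<kappa> * p)\<^sup>2 + (k * q)\<^sup>2) - 2 * (p * (\<kappa> * p) + q * (k * q)))"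
    unfolding pair_cost_def p2q2 by (simp add: mult.assoc)
  then show ?thesis
    unfolding b0 b1 e0 e1 s0 s1[OF \<kappa>_pos] s1[OF k_pos] by (simp add: algebra_simps power2_eq_square)
qed

end

section \<open>The explicit curves\<close>

lemma pair_cost_nonneg:
  assumes "0 \<le> h0" "0 \<le> h1"
  shows "0 \<le> pair_cost \<delta> h0 x0 h1 x1"
proof -
  have "sqrt (h0 * h1) * cos (half_angle \<delta> x0 x1) \<le> sqrt (h0 * h1) * 1"
    using assms by (intro mult_left_mono) auto
  moreover have "0 \<le> (sqrt h0 - sqrt h1)\<^sup>2" by simp
  then have "2 * sqrt (h0 * h1) \<le> h0 + h1"
    using assms by (simp add: power2_diff real_sqrt_mult)
  ultimately have "0 \<le> h0 + h1 - 2 * sqrt (h0 * h1) * cos (half_angle \<delta> x0 x1)" by (simp add: mult.assoc)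
  then show ?thesis unfolding pair_cost_def by simp
qed

text \<open>The features of a Dirac geodesic on which the superposition rests, for positive and for vanishing
masses alike. The
integrand is prescribed on the open interval only, because a curve that starts or ends with mass
zero has integrand \<open>0\<close> there.\<close>

definition dirac_path where
  "dirac_path \<delta> h0 (x0 :: 'a::euclidean_space) h1 x1 \<gamma> h w dh \<longleftrightarrow>
     (\<forall>t\<in>{0..1}. \<gamma> t \<in> closed_segment x0 x1 \<and> 0 \<le> h t \<and>
        (\<exists>v. (\<gamma> has_vector_derivative v) (at t within {0..1}) \<and> h t *\<^sub>R v = w) \<and>
        (h has_real_derivative dh t) (at t within {0..1})) \<and>
     continuous_on {0..1} dh \<and>
     (\<forall>t\<in>{0<..<1}. f_wf \<delta> (h t) w (dh t) = ennreal (pair_cost \<delta> h0 x0 h1 x1)) \<and>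
     h 0 = h0 \<and> (h0 \<noteq> 0 \<longrightarrow> \<gamma> 0 = x0) \<and> h 1 = h1 \<and> (h1 \<noteq> 0 \<longrightarrow> \<gamma> 1 = x1) \<and>
     dirac_geodesic \<delta> h0 x0 h1 x1 = tensor_dt (\<lambda>t A. h t * dirac (\<gamma> t) A)"

lemma dirac_pair_exists:
  assumes \<delta>: "0 < \<delta>" and h: "0 < h0" "0 < h1" and near: "norm (x0 - x1) < pi * \<delta>"
    and k: "k > sqrt h1 / (sqrt h0 * cos (half_angle \<delta> x0 x1))"
  shows "dirac_pair \<delta> h0 h1 x0 x1 k"
proof
  have "0 < sqrt h0 * cos (half_angle \<delta> x0 x1)" using h half_angle_bounds[OF \<delta> near] by simp
  then show "sqrt h1 < k * sqrt h0 * cos (half_angle \<delta> x0 x1)" using k by (simp add: divide_less_eq mult.assoc)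
qed (use assms in auto)

definition dirac_growth ::
    "real \<Rightarrow> real \<Rightarrow> 'a::euclidean_space \<Rightarrow> real \<Rightarrow> 'a \<Rightarrow> real \<Rightarrow> real" where
  "dirac_growth \<delta> h0 x0 h1 x1 t =
     2 * (h0 + h1 - 2 * sqrt (h0 * h1) * cos (half_angle \<delta> x0 x1)) * t
     - 2 * (h0 - sqrt (h0 * h1) * cos (half_angle \<delta> x0 x1))"

lemma dirac_mass_has_derivative:
  "(dirac_mass \<delta> h0 x0 h1 x1 has_real_derivative
     dirac_growth \<delta> h0 x0 h1 x1 t) (at t within T)"
  unfolding dirac_mass_def dirac_growth_def Let_def by (auto intro!: derivative_eq_intros)

text \<open>Constant speed: with \<open>h = |P|^2\<close> the two squares in the numerator are the squared cross and scalar
products of \<open>P\<close> and \<open>P'\<close>, which add up to \<open>|P|^2 |P'|^2\<close>.\<close>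

lemma dirac_mass_cost:
  assumes \<delta>: "0 < \<delta>" and h: "0 \<le> h0" "0 \<le> h1"
    and pos: "0 < dirac_mass \<delta> h0 x0 h1 x1 t"
  shows "f_wf \<delta> (dirac_mass \<delta> h0 x0 h1 x1 t) (dirac_momentum \<delta> h0 x0 h1 x1)
     (dirac_growth \<delta> h0 x0 h1 x1 t) = ennreal (pair_cost \<delta> h0 x0 h1 x1)"
proof -
  define S where "S = sqrt (h0 * h1)"
  define \<theta> where "\<theta> = half_angle \<delta> x0 x1"
  define A where "A = h0 + h1 - 2 * S * cos \<theta>"
  define B where "B = h0 - S * cos \<theta>"
  define m where "m = A * t\<^sup>2 - 2 * B * t + h0"
  have m: "dirac_mass \<delta> h0 x0 h1 x1 t = m"
    unfolding dirac_mass_def Let_def m_def A_def B_def S_def \<theta>_def ..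
  have S2: "S\<^sup>2 = h0 * h1" unfolding S_def using h by simp
  have "norm (sgn (x1 - x0)) = 1 \<or> sin \<theta> = 0"
    unfolding \<theta>_def half_angle_def by (cases "x1 = x0") (simp_all add: norm_sgn)
  then have n: "(norm (dirac_momentum \<delta> h0 x0 h1 x1))\<^sup>2 = 4 * \<delta>\<^sup>2 * S\<^sup>2 * (sin \<theta>)\<^sup>2"
    unfolding dirac_momentum_def S_def[symmetric] \<theta>_def[symmetric]
    by (auto simp: power_mult_distrib)
  have "S\<^sup>2 * (1 - (cos \<theta>)\<^sup>2) + B\<^sup>2 = A * h0"
    unfolding A_def B_def using S2 by (simp add: algebra_simps power2_eq_square)
  then have X: "4 * (S\<^sup>2 * (sin \<theta>)\<^sup>2) + (2 * A * t - 2 * B)\<^sup>2 = 4 * A * m"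
    unfolding m_def sin_squared_eq by (simp add: algebra_simps power2_eq_square)
  have "4 * \<delta>\<^sup>2 * S\<^sup>2 * (sin \<theta>)\<^sup>2 + \<delta>\<^sup>2 * (2 * A * t - 2 * B)\<^sup>2 =
      \<delta>\<^sup>2 * (4 * (S\<^sup>2 * (sin \<theta>)\<^sup>2) + (2 * A * t - 2 * B)\<^sup>2)"
    by (simp only: distrib_left mult_ac)
  also have "\<dots> = \<delta>\<^sup>2 * (4 * A * m)" unfolding X ..
  also have "\<dots> = (2 * \<delta>\<^sup>2 * A) * (2 * m)" by simp
  finally have "(4 * \<delta>\<^sup>2 * S\<^sup>2 * (sin \<theta>)\<^sup>2 + \<delta>\<^sup>2 * (2 * A * t - 2 * B)\<^sup>2) / (2 * m) = 2 * \<delta>\<^sup>2 * A"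
    using pos unfolding m by simp
  then show ?thesis
    using pos unfolding f_wf_def dirac_growth_def n m S_def[symmetric] \<theta>_def[symmetric] A_def[symmetric] B_def[symmetric] pair_cost_def
    by simp
qed

lemma growth_cost:
  fixes s a :: real
  assumes "s \<noteq> 0" "a \<noteq> 0"
  shows "(\<delta>\<^sup>2 * (2 * s * a)\<^sup>2) / (2 * (s\<^sup>2 * a)) = 2 * \<delta>\<^sup>2 * a"
  using assms by (simp add: field_simps power2_eq_square)

lemma tensor_dt_cong:
  assumes "\<And>t A. t \<in> {0..1} \<Longrightarrow> \<nu> t A = \<nu>' t A"
  shows "tensor_dt \<nu> = tensor_dt \<nu>'"
  unfolding tensor_dt_def by (intro ext if_cong set_lebesgue_integral_cong refl) (simp_all add: assms)

lemma dirac_path_positive: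
  assumes \<delta>: "0 < \<delta>" and h: "0 < h0" "0 < h1" and near: "norm (x0 - x1) < pi * \<delta>"
  shows "dirac_path \<delta> h0 x0 h1 x1 (dirac_position \<delta> h0 x0 h1 x1) (dirac_mass \<delta> h0 x0 h1 x1)
     (dirac_momentum \<delta> h0 x0 h1 x1)
     (dirac_growth \<delta> h0 x0 h1 x1)"
proof -
  define k where "k = sqrt h1 / (sqrt h0 * cos (half_angle \<delta> x0 x1)) + 1"
  interpret dirac_pair \<delta> h0 h1 x0 x1 k
    by (rule dirac_pair_exists[OF assms]) (simp add: k_def)
  let ?v = "\<lambda>t. (2 * \<delta> * (p * q * (k - \<kappa>) / h t)) *\<^sub>R e"
  have v: "(dirac_position \<delta> h0 x0 h1 x1 has_vector_derivative ?v t) (at t within {0..1})" if t: "t \<in> {0..1}" for t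
    by (rule has_vector_derivative_transform[OF t _ position_has_derivative[OF t]]) (rule dirac_position_eq)
  have w: "h t *\<^sub>R ?v t = dirac_momentum \<delta> h0 x0 h1 x1" if "t \<in> {0..1}" for t
    unfolding momentum_eq using mass_pos[OF that] by simp
  show ?thesis
    unfolding dirac_path_def
  proof (intro conjI ballI impI)
    fix t :: real assume t: "t \<in> {0..1}"
    show "dirac_position \<delta> h0 x0 h1 x1 t \<in> closed_segment x0 x1"
      unfolding dirac_position_eq[OF t] by (rule position_segment[OF t])
    show "0 \<le> h t" using mass_pos[OF t] by simp
    show "\<exists>v. (dirac_position \<delta> h0 x0 h1 x1 has_vector_derivative v) (at t within {0..1}) \<and>
         h t *\<^sub>R v = dirac_momentum \<delta> h0 x0 h1 x1"
      by (rule exI, rule conjI, rule v[OF t], rule w[OF t])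
  next
    show "dirac_geodesic \<delta> h0 x0 h1 x1 = tensor_dt (\<lambda>t A. h t * dirac (dirac_position \<delta> h0 x0 h1 x1 t) A)"
      unfolding dirac_geodesic_def using h by simp
  next
    show "dirac_position \<delta> h0 x0 h1 x1 0 = x0" "dirac_position \<delta> h0 x0 h1 x1 1 = x1"
      using dirac_position_eq[of 0] dirac_position_eq[of 1] position_0 position_1 by simp_all
  next
    fix t :: real assume "t \<in> {0<..<1}"
    then have "0 < h t" by (intro mass_pos) auto
    then show "f_wf \<delta> (h t) (dirac_momentum \<delta> h0 x0 h1 x1)
      (dirac_growth \<delta> h0 x0 h1 x1 t) =
      ennreal (pair_cost \<delta> h0 x0 h1 x1)"
      using h by (intro dirac_mass_cost \<delta>) auto
  next
    show "continuous_on {0..1} (dirac_growth \<delta> h0 x0 h1 x1)"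
      unfolding dirac_growth_def by (intro continuous_intros)
    show "h 0 = h0" "h 1 = h1" unfolding dirac_mass_def Let_def by simp_all
  qed (rule dirac_mass_has_derivative)
qed

text \<open>A curve with a vanishing end mass stays at the point that carries the other mass, so the two cases
of the explicit formula combine into one curve.\<close>

lemma dirac_path_zero:
  assumes \<delta>: "0 < \<delta>" and h: "0 \<le> h0" "0 \<le> h1" and z: "h0 = 0 \<or> h1 = 0"
  shows "dirac_path \<delta> h0 x0 h1 x1 (\<lambda>t. if h0 = 0 then x1 else x0) (\<lambda>t. t\<^sup>2 * h1 + (1 - t)\<^sup>2 * h0)
     0 (\<lambda>t. 2 * t * h1 - 2 * (1 - t) * h0)"
  unfolding dirac_path_def
proof (intro conjI ballI impI)
  fix t :: real assume t: "t \<in> {0<..<1}"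
  consider "h0 = 0" "h1 = 0" | "h0 = 0" "0 < h1" | "0 < h0" "h1 = 0" using z h by linarith
  then show "f_wf \<delta> (t\<^sup>2 * h1 + (1 - t)\<^sup>2 * h0) (0::'a) (2 * t * h1 - 2 * (1 - t) * h0) = ennreal (pair_cost \<delta> h0 x0 h1 x1)"
  proof cases
    case 1
    then show ?thesis by (simp add: f_wf_def pair_cost_def)
  next
    case 2
    then have "(\<delta>\<^sup>2 * (2 * t * h1)\<^sup>2) / (2 * (t\<^sup>2 * h1)) = 2 * \<delta>\<^sup>2 * h1"
      using t by (intro growth_cost) auto
    then show ?thesis using 2 t by (simp add: f_wf_def pair_cost_def)
  next
    case 3
    then have "(\<delta>\<^sup>2 * (2 * (1 - t) * h0)\<^sup>2) / (2 * ((1 - t)\<^sup>2 * h0)) = 2 * \<delta>\<^sup>2 * h0"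
      using t by (intro growth_cost) auto
    then show ?thesis using 3 t by (simp add: f_wf_def pair_cost_def)
  qed
next
  show "dirac_geodesic \<delta> h0 x0 h1 x1 =
      tensor_dt (\<lambda>t A. (t\<^sup>2 * h1 + (1 - t)\<^sup>2 * h0) * dirac (if h0 = 0 then x1 else x0) A)"
    unfolding dirac_geodesic_def using z h by (auto intro!: tensor_dt_cong)
next
  fix t :: real assume "t \<in> {0..1}"
  show "\<exists>v. ((\<lambda>t. if h0 = 0 then x1 else x0) has_vector_derivative v) (at t within {0..1}) \<and>
      (t\<^sup>2 * h1 + (1 - t)\<^sup>2 * h0) *\<^sub>R v = 0"
    by (intro exI[of _ 0] conjI has_vector_derivative_const scaleR_zero_right)
qed (use z h in \<open>auto intro!: derivative_eq_intros continuous_intros simp: algebra_simps\<close>)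

lemma dirac_path_exists:
  assumes "0 < \<delta>" "0 \<le> h0" "0 \<le> h1" "norm (x0 - x1) < pi * \<delta>"
  shows "\<exists>\<gamma> h w dh. dirac_path \<delta> h0 x0 h1 x1 \<gamma> h w dh"
proof (cases "0 < h0 \<and> 0 < h1")
  case True
  show ?thesis by (intro exI, rule dirac_path_positive) (use True assms in auto)
next
  case False
  show ?thesis by (intro exI, rule dirac_path_zero) (use False assms in auto)
qed

text \<open>The fundamental theorem of calculus for \<open>h(t) \<phi>(t, \<gamma>(t))\<close>.\<close>

lemma dirac_path_weak:
  fixes \<gamma> :: "real \<Rightarrow> 'a::euclidean_space"
  assumes P: "dirac_path \<delta> h0 x0 h1 x1 \<gamma> h w dh"
    and C1: "C1_with_derivs ({0..1} \<times> C) \<phi> \<phi>t \<phi>x" and C: "\<And>t. t \<in> {0..1} \<Longrightarrow> \<gamma> t \<in> C"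
  shows "(LINT t:{0..1}|lborel. \<phi>t (t, \<gamma> t) * h t + \<phi>x (t, \<gamma> t) \<bullet> w + \<phi> (t, \<gamma> t) * dh t) =
     h1 * \<phi> (1, x1) - h0 * \<phi> (0, x0)"
proof -
  have \<gamma>: "continuous_on {0..1} \<gamma>" and hc: "continuous_on {0..1} h"
    using P unfolding dirac_path_def continuous_on_eq_continuous_within
    by (blast intro: has_vector_derivative_continuous DERIV_continuous)+
  have sub: "(\<lambda>t. (t, \<gamma> t)) ` {0..1} \<subseteq> {0..1} \<times> C" using C by auto
  have pc: "continuous_on {0..1} (\<lambda>t. (t, \<gamma> t))" by (intro continuous_intros \<gamma>)
  have cc: "continuous_on {0..1} (\<lambda>t. \<phi>t (t, \<gamma> t))" "continuous_on {0..1} (\<lambda>t. \<phi>x (t, \<gamma> t))"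
    "continuous_on {0..1} (\<lambda>t. \<phi> (t, \<gamma> t))"
    using C1 C1_continuous_on[OF C1] unfolding C1_with_derivs_def
    by (auto intro: continuous_on_compose2[OF _ pc sub])
  have dhc: "continuous_on {0..1} dh" using P unfolding dirac_path_def by blast
  have "integral\<^sup>L lborel (\<lambda>t. indicator {0..1} t *\<^sub>R (\<phi>t (t, \<gamma> t) * h t + \<phi>x (t, \<gamma> t) \<bullet> w + \<phi> (t, \<gamma> t) * dh t)) =
     h 1 * \<phi> (1, \<gamma> 1) - h 0 * \<phi> (0, \<gamma> 0)"
  proof (rule integral_FTC_Icc)
    fix t :: real assume "0 \<le> t" "t \<le> 1"
    then have t: "t \<in> {0..1}" by simp
    obtain v where v: "(\<gamma> has_vector_derivative v) (at t within {0..1})" "h t *\<^sub>R v = w"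
      using P t unfolding dirac_path_def by blast
    have dh: "(h has_real_derivative dh t) (at t within {0..1})" using P t unfolding dirac_path_def by blast
    have "((\<lambda>t. (t, \<gamma> t)) has_derivative (\<lambda>s. (s, s *\<^sub>R v))) (at t within {0..1})"
      using v(1) unfolding has_vector_derivative_def by (intro has_derivative_Pair has_derivative_ident)
    moreover have "(\<phi> has_derivative (\<lambda>(s, u). \<phi>t (t, \<gamma> t) * s + \<phi>x (t, \<gamma> t) \<bullet> u)) (at (t, \<gamma> t) within (\<lambda>t. (t, \<gamma> t)) ` {0..1})"
      using C1 t C[OF t] unfolding C1_with_derivs_def by (intro has_derivative_subset[OF _ sub]) auto
    ultimately have "((\<lambda>t. \<phi> (t, \<gamma> t)) has_derivative (\<lambda>s. \<phi>t (t, \<gamma> t) * s + \<phi>x (t, \<gamma> t) \<bullet> (s *\<^sub>R v))) (at t within {0..1})"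
      using has_derivative_in_compose by fastforce
    from has_derivative_mult[OF dh[unfolded has_field_derivative_def] this]
    show "((\<lambda>t. h t * \<phi> (t, \<gamma> t)) has_vector_derivative
        \<phi>t (t, \<gamma> t) * h t + \<phi>x (t, \<gamma> t) \<bullet> w + \<phi> (t, \<gamma> t) * dh t) (at t within {0..1})"
      unfolding has_vector_derivative_def v(2)[symmetric]
      by (rule has_derivative_eq_rhs) (simp add: fun_eq_iff algebra_simps)
  qed (auto intro!: continuous_intros cc hc dhc)
  moreover have "h 1 * \<phi> (1, \<gamma> 1) = h1 * \<phi> (1, x1)" "h 0 * \<phi> (0, \<gamma> 0) = h0 * \<phi> (0, x0)"
    using P unfolding dirac_path_def by (auto simp: )
  ultimately show ?thesis unfolding set_lebesgue_integral_def by simp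
qed

section \<open>Superposition of finitely many curves\<close>

lemma signed_measures_has_density:
  fixes g :: "'b::topological_space \<Rightarrow> real"
  assumes d: "has_density \<nu> M g" and sM: "sets M = sets borel" and X: "X \<in> sets borel"
    and nX: "emeasure M (- X) = 0" and non: "\<And>A. A \<notin> sets borel \<Longrightarrow> \<nu> A = 0"
  shows "\<nu> \<in> signed_measures X"
  unfolding signed_measures_def
proof (intro CollectI conjI allI impI ballI)
  have gi: "integrable M g" using d by (rule has_density_integrable)
  have si: "set_integrable M A g" if "A \<in> sets borel" for A
    unfolding set_integrable_def using that sM by (intro integrable_mult_indicator gi) simp
  {
    fix A :: "nat \<Rightarrow> 'b set" assume A: "range A \<subseteq> sets borel" "disjoint_family A"
    then have Am: "A i \<in> sets borel" for i by auto
    have AM: "A i \<in> sets M" for i using Am sM by simp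
    have U: "(\<Union>n. A n) = (\<Union>n. \<Union>i<n. A i)" by (auto intro: lessI)
    have "(\<lambda>n. LINT x:(\<Union>i<n. A i)|M. g x) \<longlonglongrightarrow> (LINT x:(\<Union>n. \<Union>i<n. A i)|M. g x)"
    proof (rule set_integral_cont_up)
      show "incseq (\<lambda>n. \<Union>i<n. A i)" by (intro incseq_SucI UN_mono) auto
      show "set_integrable M (\<Union>n. \<Union>i<n. A i) g" using Am by (intro si sets.countable_UN sets.finite_UN) auto
    qed (intro sets.finite_UN AM, simp)
    moreover have "(LINT x:(\<Union>i<n. A i)|M. g x) = (\<Sum>i<n. \<nu> (A i))" for n
      using A(2) by (subst set_integral_finite_Union)
        (auto intro!: si Am AM simp: has_density_eq[OF d Am] disjoint_family_on_def)
    moreover have "(LINT x:(\<Union>n. \<Union>i<n. A i)|M. g x) = \<nu> (\<Union>n. A n)"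
      unfolding U[symmetric] using Am by (intro has_density_eq[OF d, symmetric] sets.countable_UN) auto
    ultimately show "(\<lambda>n. \<nu> (A n)) sums \<nu> (\<Union>n. A n)" unfolding sums_def by simp
  }
  fix A assume A: "A \<in> sets borel" "A \<inter> X = {}"
  have "A \<in> null_sets M"
  proof (rule null_sets_subset)
    show "- X \<in> null_sets M" using nX X sM by (simp add: null_sets_def borel_comp)
    show "A \<in> sets M" "A \<subseteq> - X" using A sM by auto
  qed
  then have "AE x in M. indicator A x *\<^sub>R g x = 0" by (rule AE_I') (auto simp: indicator_def split: if_splits)
  then show "\<nu> A = 0" unfolding has_density_eq[OF d A(1)] set_lebesgue_integral_def by (rule integral_eq_zero_AE)
qed (rule non)

text \<open>The sum over \<open>i\<close> of the images of Lebesgue measure on \<open>[0,1]\<close> under the curves, written as one image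
measure.\<close>

definition curve_measure :: "nat set \<Rightarrow> (nat \<Rightarrow> real \<Rightarrow> 'a::euclidean_space) \<Rightarrow> (real \<times> 'a) measure" where
  "curve_measure I \<gamma> = distr (count_space I \<Otimes>\<^sub>M restrict_space lborel {0..1}) borel (\<lambda>(i, t). (t, \<gamma> i t))"

locale curves =
  fixes I :: "nat set" and \<gamma> :: "nat \<Rightarrow> real \<Rightarrow> 'a::euclidean_space"
  assumes fin: "finite I" and cont: "\<And>i. i \<in> I \<Longrightarrow> continuous_on {0..1} (\<gamma> i)"
begin

lemma time_finite: "finite_measure (restrict_space lborel {0..1::real})"
  by (rule finite_measureI) (simp add: emeasure_restrict_space space_restrict_space)

sublocale T: finite_measure "restrict_space lborel {0..1::real}" by (rule time_finite)
sublocale N: finite_measure "count_space I" by (rule finite_measure_count_space[OF fin])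
sublocale P: pair_sigma_finite "count_space I" "restrict_space lborel {0..1::real}" ..

lemma curve_measurable:
  "(\<lambda>(i, t). (t, \<gamma> i t)) \<in> measurable (count_space I \<Otimes>\<^sub>M restrict_space lborel {0..1}) borel"
proof (rule measurable_pair_measure_countable1)
  show "countable I" using fin by (rule countable_finite)
  fix i assume "i \<in> I"
  then have "continuous_on {0..1} (\<lambda>t. (t, \<gamma> i t))" by (intro continuous_intros cont)
  from borel_measurable_continuous_on_restrict[OF this]
  have "(\<lambda>t. (t, \<gamma> i t)) \<in> borel_measurable (restrict_space lborel {0..1})"
    by (subst measurable_cong_sets[OF sets_restrict_space_cong[OF sets_lborel] refl])
  then show "(\<lambda>y. case (i, y) of (i, t) \<Rightarrow> (t, \<gamma> i t)) \<in> measurable (restrict_space lborel {0..1}) borel" by simp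
qed

lemma sets_curve_measure [simp]: "sets (curve_measure I \<gamma>) = sets borel"
  unfolding curve_measure_def by simp

lemma measurable_curve_measure: "measurable (curve_measure I \<gamma>) N = measurable borel N"
  by (rule measurable_cong_sets) simp_all

lemma finite_curve_measure: "finite_measure (curve_measure I \<gamma>)"
  unfolding curve_measure_def
  by (rule finite_measure.finite_measure_distr[OF finite_measure_pair_measure[OF time_finite N.finite_measure_axioms] curve_measurable])

lemma nn_integral_curve_measure:
  assumes f: "f \<in> borel_measurable borel"
  shows "(\<integral>\<^sup>+p. f p \<partial>curve_measure I \<gamma>) = (\<Sum>i\<in>I. \<integral>\<^sup>+t\<in>{0..1}. f (t, \<gamma> i t) \<partial>lborel)"
proof -
  have m: "(\<lambda>x. f (case x of (i, t) \<Rightarrow> (t, \<gamma> i t))) \<in> borel_measurable (count_space I \<Otimes>\<^sub>M restrict_space lborel {0..1})"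
    by (rule measurable_compose[OF curve_measurable f])
  have f': "f \<in> borel_measurable (distr (count_space I \<Otimes>\<^sub>M restrict_space lborel {0..1}) borel (\<lambda>(i, t). (t, \<gamma> i t)))"
    using f by simp
  have "(\<integral>\<^sup>+p. f p \<partial>curve_measure I \<gamma>) =
     (\<integral>\<^sup>+i. \<integral>\<^sup>+t. f (case (i, t) of (i, t) \<Rightarrow> (t, \<gamma> i t)) \<partial>restrict_space lborel {0..1} \<partial>count_space I)"
    unfolding curve_measure_def nn_integral_distr[OF curve_measurable f'] by (rule T.nn_integral_fst[OF m, symmetric])
  also have "\<dots> = (\<Sum>i\<in>I. \<integral>\<^sup>+t. f (t, \<gamma> i t) \<partial>restrict_space lborel {0..1})"
    unfolding nn_integral_count_space_finite[OF fin] by simp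
  finally show ?thesis by (simp add: nn_integral_restrict_space)
qed

lemma integral_curve_measure:
  fixes f :: "real \<times> 'a \<Rightarrow> real"
  assumes f: "integrable (curve_measure I \<gamma>) f"
  shows "(LINT p|curve_measure I \<gamma>. f p) = (\<Sum>i\<in>I. LINT t:{0..1}|lborel. f (t, \<gamma> i t))"
proof -
  have fm: "f \<in> borel_measurable borel"
    using borel_measurable_integrable[OF f] unfolding measurable_curve_measure .
  have i: "integrable (count_space I \<Otimes>\<^sub>M restrict_space lborel {0..1}) (\<lambda>x. f (case x of (i, t) \<Rightarrow> (t, \<gamma> i t)))"
    using f unfolding curve_measure_def by (subst (asm) integrable_distr_eq[OF curve_measurable fm])
  have "(LINT p|curve_measure I \<gamma>. f p) =
     (LINT i|count_space I. LINT t|restrict_space lborel {0..1}. f (case (i, t) of (i, t) \<Rightarrow> (t, \<gamma> i t)))"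
    unfolding curve_measure_def integral_distr[OF curve_measurable fm] by (rule P.integral_fst'[OF i, symmetric])
  also have "\<dots> = (\<Sum>i\<in>I. LINT t|restrict_space lborel {0..1}. f (t, \<gamma> i t))"
    unfolding lebesgue_integral_count_space_finite[OF fin] by simp
  finally show ?thesis by (simp add: integral_restrict_space set_lebesgue_integral_def)
qed

definition graph :: "nat \<Rightarrow> (real \<times> 'a) set" where
  "graph i = {p. fst p \<in> {0..1} \<and> snd p = \<gamma> i (fst p)}"

lemma closed_graph: assumes "i \<in> I" shows "closed (graph i)"
proof -
  have "graph i = {p \<in> {0..1} \<times> UNIV. snd p - \<gamma> i (fst p) = 0}" unfolding graph_def by auto
  moreover have "continuous_on ({0..1} \<times> UNIV) (\<lambda>p. snd p - \<gamma> i (fst p))"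
    by (intro continuous_intros continuous_on_compose2[OF cont[OF assms]]) auto
  ultimately show ?thesis
    using continuous_closed_preimage_constant[of "{0..1} \<times> UNIV" "\<lambda>p. snd p - \<gamma> i (fst p)" 0]
    by (simp add: closed_Times)
qed

text \<open>A density that takes the value \<open>f i t\<close> at the point of the \<open>i\<close>-th curve at time \<open>t\<close>; this is consistent
because the curves are disjoint.\<close>

definition spread :: "(nat \<Rightarrow> real \<Rightarrow> 'v::euclidean_space) \<Rightarrow> real \<times> 'a \<Rightarrow> 'v" where
  "spread f p = (\<Sum>i\<in>I. indicator (graph i) p *\<^sub>R f i (fst p))"

lemma integrable_spread:
  assumes f: "\<And>i. i \<in> I \<Longrightarrow> continuous_on {0..1} (f i)"
  shows "integrable (curve_measure I \<gamma>) (spread f)"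
  unfolding spread_def
proof (rule Bochner_Integration.integrable_sum)
  fix i assume i: "i \<in> I"
  interpret finite_measure "curve_measure I \<gamma>" by (rule finite_curve_measure)
  obtain C where C: "\<And>t. t \<in> {0..1} \<Longrightarrow> norm (f i t) \<le> C"
    using compact_imp_bounded[OF compact_continuous_image[OF f[OF i] compact_Icc]] unfolding bounded_iff by (meson imageI)
  (* C is also a bound off the graph, where the integrand is 0 *)
  have C0: "0 \<le> C" using C[of 0] norm_ge_zero[of "f i 0"] by (rule_tac order_trans) auto
  show "integrable (curve_measure I \<gamma>) (\<lambda>p. indicator (graph i) p *\<^sub>R f i (fst p))"
  proof (rule integrable_const_bound)
    show "AE p in curve_measure I \<gamma>. norm (indicator (graph i) p *\<^sub>R f i (fst p)) \<le> C"
      using C C0 by (intro AE_I2) (auto simp: indicator_def graph_def)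
    have "continuous_on (graph i) (\<lambda>p. f i (fst p))"
      by (rule continuous_on_compose2[OF f[OF i]]) (auto intro: continuous_intros simp: graph_def)
    from borel_measurable_continuous_on_indicator[OF borel_closed[OF closed_graph[OF i]] this]
    show "(\<lambda>p. indicator (graph i) p *\<^sub>R f i (fst p)) \<in> borel_measurable (curve_measure I \<gamma>)"
      unfolding measurable_curve_measure .
  qed
qed

end

locale disjoint_curves = curves +
  assumes disj: "\<And>i j t. i \<in> I \<Longrightarrow> j \<in> I \<Longrightarrow> i \<noteq> j \<Longrightarrow> t \<in> {0..1} \<Longrightarrow> \<gamma> i t \<noteq> \<gamma> j t"
begin

lemma spread_curve:
  assumes "i \<in> I" "t \<in> {0..1}"
  shows "spread f (t, \<gamma> i t) = f i t"
  unfolding spread_def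
  by (subst sum_single[OF fin assms(1)]) (use assms disj[OF assms(1)] in \<open>auto simp: graph_def\<close>)

end

lemma dirac_path_geodesic:
  fixes \<gamma> :: "real \<Rightarrow> 'a::euclidean_space"
  assumes P: "dirac_path \<delta> h0 x0 h1 x1 \<gamma> h w dh" and A: "A \<in> sets borel"
  shows "dirac_geodesic \<delta> h0 x0 h1 x1 A = (LINT t:{0..1}|lborel. indicator A (t, \<gamma> t) * h t)"
proof -
  have "dirac_geodesic \<delta> h0 x0 h1 x1 A = tensor_dt (\<lambda>t A. h t * dirac (\<gamma> t) A) A"
    using P unfolding dirac_path_def by metis
  also have "\<dots> = (LINT t:{0..1}|lborel. h t * dirac (\<gamma> t) {x. (t, x) \<in> A})"
    unfolding tensor_dt_def using A by simp
  also have "\<dots> = (LINT t:{0..1}|lborel. indicator A (t, \<gamma> t) * h t)"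
  proof (rule set_lebesgue_integral_cong)
    show "\<forall>t. t \<in> {0..1} \<longrightarrow> h t * dirac (\<gamma> t) {x. (t, x) \<in> A} = indicator A (t, \<gamma> t) * h t"
    proof (intro allI impI)
      fix t :: real
      have "{x. (t, x) \<in> A} \<in> sets borel"
      proof -
        have "A \<in> sets (borel \<Otimes>\<^sub>M borel)" unfolding borel_prod by (rule A)
        from sets_Pair1[OF this, of t] show ?thesis by (simp add: vimage_def)
      qed
      then have "dirac (\<gamma> t) {x. (t, x) \<in> A} = indicator A (t, \<gamma> t)"
        unfolding dirac_def by (simp add: measure_return indicator_def)
      then show "h t * dirac (\<gamma> t) {x. (t, x) \<in> A} = indicator A (t, \<gamma> t) * h t" by simp
    qed
  qed simp
  finally show ?thesis .
qed

lemma superposition_minimal_candidate: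
  fixes \<Omega> :: "'a::euclidean_space set" and x0 x1 :: "nat \<Rightarrow> 'a"
  assumes \<delta>: "0 < \<delta>" and \<Omega>: "bounded \<Omega>" "convex \<Omega>" and I: "finite I"
    and h: "\<And>i. i \<in> I \<Longrightarrow> 0 \<le> h0 i \<and> 0 \<le> h1 i"
    and x: "\<And>i. i \<in> I \<Longrightarrow> x0 i \<in> closure \<Omega> \<and> x1 i \<in> closure \<Omega>"
    and P: "\<And>i. i \<in> I \<Longrightarrow> dirac_path \<delta> (h0 i) (x0 i) (h1 i) (x1 i) (\<gamma> i) (h i) (w i) (dh i)"
    and disj: "\<And>i j t. i \<in> I \<Longrightarrow> j \<in> I \<Longrightarrow> i \<noteq> j \<Longrightarrow> t \<in> {0..1} \<Longrightarrow> \<gamma> i t \<noteq> \<gamma> j t"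
    and \<rho>0: "\<rho>0 = (\<lambda>A. \<Sum>i\<in>I. h0 i * dirac (x0 i) A)"
    and \<rho>1: "\<rho>1 = (\<lambda>A. \<Sum>i\<in>I. h1 i * dirac (x1 i) A)"
    and \<rho>: "\<rho> = (\<lambda>A. \<Sum>i\<in>I. dirac_geodesic \<delta> (h0 i) (x0 i) (h1 i) (x1 i) A)"
  shows "\<rho> \<in> nonneg_measures ({0..1} \<times> closure \<Omega>) \<and>
    (\<exists>\<omega> \<zeta>. (\<rho>, \<omega>, \<zeta>) \<in> CE \<Omega> \<rho>0 \<rho>1 \<and>
       action \<delta> \<Omega> (\<rho>, \<omega>, \<zeta>) = ennreal (\<Sum>i\<in>I. pair_cost \<delta> (h0 i) (x0 i) (h1 i) (x1 i)))"
proof -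
  let ?X = "{0..1::real} \<times> closure \<Omega>"
  have Xm: "?X \<in> sets borel" by (intro borel_closed closed_Times closed_closure closed_atLeastAtMost)
  have \<gamma>c: "continuous_on {0..1} (\<gamma> i)" and hc: "continuous_on {0..1} (h i)" if "i \<in> I" for i
    using P[OF that] unfolding dirac_path_def continuous_on_eq_continuous_within
    by (blast intro: has_vector_derivative_continuous DERIV_continuous)+
  have dhc: "continuous_on {0..1} (dh i)" if "i \<in> I" for i using P[OF that] unfolding dirac_path_def by blast
  have h0: "0 \<le> h i t" if "i \<in> I" "t \<in> {0..1}" for i t using P[OF that(1)] that(2) unfolding dirac_path_def by blast
  have \<gamma>\<Omega>: "\<gamma> i t \<in> closure \<Omega>" if "i \<in> I" "t \<in> {0..1}" for i t
  proof -
    have "\<gamma> i t \<in> closed_segment (x0 i) (x1 i)" using P[OF that(1)] that(2) unfolding dirac_path_def by blast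
    then show ?thesis
      using x[OF that(1)] closed_segment_subset[OF _ _ convex_closure[OF \<Omega>(2)]] by blast
  qed
  interpret disjoint_curves I \<gamma> by unfold_locales (use I \<gamma>c disj in auto)
  let ?M = "curve_measure I \<gamma>"
  define r where "r = spread h"
  define W where "W = spread (\<lambda>i t. w i)"
  define z where "z = spread dh"
  define \<omega> where "\<omega> A = (if A \<in> sets borel then (LINT p:A|?M. W p) else 0)" for A
  define \<zeta> where "\<zeta> A = (if A \<in> sets borel then (LINT p:A|?M. z p) else 0)" for A
  have ri: "integrable ?M r" and Wi: "integrable ?M W" and zi: "integrable ?M z"
    unfolding r_def W_def z_def by (intro integrable_spread hc dhc continuous_on_const; assumption)+
  have rho_eq: "\<rho> A = (LINT p:A|?M. r p)" if A: "A \<in> sets borel" for A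
  proof -
    have "(LINT p:A|?M. r p) = (\<Sum>i\<in>I. LINT t:{0..1}|lborel. indicator A (t, \<gamma> i t) *\<^sub>R r (t, \<gamma> i t))"
      unfolding set_lebesgue_integral_def[of ?M]
      by (rule integral_curve_measure) (use A in \<open>simp add: integrable_mult_indicator[OF _ ri] del: real_scaleR_def\<close>)
    also have "\<dots> = (\<Sum>i\<in>I. dirac_geodesic \<delta> (h0 i) (x0 i) (h1 i) (x1 i) A)"
    proof (rule sum.cong[OF refl])
      fix i assume i: "i \<in> I"
      have "dirac_geodesic \<delta> (h0 i) (x0 i) (h1 i) (x1 i) A = (LINT t:{0..1}|lborel. indicator A (t, \<gamma> i t) * h i t)"
        by (rule dirac_path_geodesic[OF P[OF i] A])
      also have "\<dots> = (LINT t:{0..1}|lborel. indicator A (t, \<gamma> i t) *\<^sub>R r (t, \<gamma> i t))"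
        by (rule set_lebesgue_integral_cong) (simp_all add: r_def spread_curve[OF i])
      finally show "(LINT t:{0..1}|lborel. indicator A (t, \<gamma> i t) *\<^sub>R r (t, \<gamma> i t)) =
          dirac_geodesic \<delta> (h0 i) (x0 i) (h1 i) (x1 i) A" by simp
    qed
    finally show ?thesis unfolding \<rho> by simp
  qed
  have rho_non: "\<rho> A = 0" if "A \<notin> sets borel" for A
  proof -
    have "dirac_geodesic \<delta> (h0 i) (x0 i) (h1 i) (x1 i) A = 0" for i
      using that unfolding dirac_geodesic_def tensor_dt_def by simp
    then show ?thesis unfolding \<rho> by simp
  qed
  have dr: "has_density \<rho> ?M r" unfolding has_density_def using ri rho_eq by simp
  have dW: "has_density \<omega> ?M W" unfolding has_density_def \<omega>_def using Wi by simp
  have dz: "has_density \<zeta> ?M z" unfolding has_density_def \<zeta>_def using zi by simp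
  have nX: "emeasure ?M (- ?X) = 0"
  proof -
    have "(\<integral>\<^sup>+p. indicator (- ?X) p \<partial>?M) = (\<Sum>i\<in>I. \<integral>\<^sup>+t\<in>{0..1}. indicator (- ?X) (t, \<gamma> i t) \<partial>lborel)"
      by (rule nn_integral_curve_measure[OF borel_measurable_indicator[OF borel_comp[OF Xm]]])
    also have "\<dots> = (\<Sum>i\<in>I. 0)"
    proof (rule sum.cong[OF refl])
      fix i assume i: "i \<in> I"
      have "(\<integral>\<^sup>+t\<in>{0..1}. indicator (- ?X) (t, \<gamma> i t) \<partial>lborel) = (\<integral>\<^sup>+(t::real). 0 \<partial>lborel)"
        by (rule nn_integral_cong) (use \<gamma>\<Omega>[OF i] in \<open>auto simp: indicator_def\<close>)
      then show "(\<integral>\<^sup>+t\<in>{0..1}. indicator (- ?X) (t, \<gamma> i t) \<partial>lborel) = 0" by simp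
    qed
    finally show ?thesis using borel_comp[OF Xm] by simp
  qed
  have td: "triple_density ?X ?M r W z (\<rho>, \<omega>, \<zeta>)"
    unfolding triple_density_def using finite_curve_measure nX dr dW dz by simp
  have \<rho>s: "\<rho> \<in> signed_measures ?X"
    by (rule signed_measures_has_density[OF dr sets_curve_measure Xm nX rho_non])
  have \<zeta>s: "\<zeta> \<in> signed_measures ?X"
    by (rule signed_measures_has_density[OF dz sets_curve_measure Xm nX]) (simp add: \<zeta>_def)
  have \<omega>s: "\<omega> \<in> vector_measures ?X"
    unfolding vector_measures_def
    by (intro CollectI ballI signed_measures_has_density[OF has_density_inner[OF dW sets_curve_measure] sets_curve_measure Xm nX])
       (simp add: \<omega>_def)
  have r0: "0 \<le> r p" for p
    unfolding r_def spread_def by (intro sum_nonneg) (auto simp: graph_def indicator_def intro!: h0)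
  have \<rho>n: "\<rho> \<in> nonneg_measures ?X"
    unfolding nonneg_measures_def
  proof (intro CollectI conjI \<rho>s allI)
    fix A
    show "0 \<le> \<rho> A"
    proof (cases "A \<in> sets borel")
      case True
      show ?thesis unfolding rho_eq[OF True] set_lebesgue_integral_def
        by (intro integral_nonneg_AE AE_I2) (simp add: r0)
    qed (simp add: rho_non)
  qed
  have clc: "compact (closure \<Omega>)" using \<Omega>(1) by (simp add: compact_closure)
  have ce: "(\<rho>, \<omega>, \<zeta>) \<in> CE \<Omega> \<rho>0 \<rho>1"
    unfolding CE_def Let_def
  proof (intro CollectI case_prodI conjI allI impI \<rho>s \<omega>s \<zeta>s)
    fix \<phi> \<phi>t \<phi>x assume C1: "C1_with_derivs ?X \<phi> \<phi>t \<phi>x"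
    let ?f = "\<lambda>p. \<phi>t p * r p + \<phi>x p \<bullet> W p + \<phi> p * z p"
    note PD = pairing_density[OF \<Omega>(1) td C1]
    have "(LINT p:?X|?M. ?f p) = (\<Sum>i\<in>I. LINT t:{0..1}|lborel. indicator ?X (t, \<gamma> i t) *\<^sub>R ?f (t, \<gamma> i t))"
      unfolding set_lebesgue_integral_def[of ?M]
      by (rule integral_curve_measure) (rule PD(1)[unfolded set_integrable_def])
    also have "\<dots> = (\<Sum>i\<in>I. h1 i * \<phi> (1, x1 i) - h0 i * \<phi> (0, x0 i))"
    proof (rule sum.cong[OF refl])
      fix i assume i: "i \<in> I"
      have "(LINT t:{0..1}|lborel. indicator ?X (t, \<gamma> i t) *\<^sub>R ?f (t, \<gamma> i t)) =
        (LINT t:{0..1}|lborel. \<phi>t (t, \<gamma> i t) * h i t + \<phi>x (t, \<gamma> i t) \<bullet> w i + \<phi> (t, \<gamma> i t) * dh i t)"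
        by (rule set_lebesgue_integral_cong)
           (use \<gamma>\<Omega>[OF i] in \<open>auto simp: r_def W_def z_def spread_curve[OF i]\<close>)
      also have "\<dots> = h1 i * \<phi> (1, x1 i) - h0 i * \<phi> (0, x0 i)"
        by (rule dirac_path_weak[OF P[OF i] C1 \<gamma>\<Omega>[OF i]])
      finally show "(LINT t:{0..1}|lborel. indicator ?X (t, \<gamma> i t) *\<^sub>R ?f (t, \<gamma> i t)) =
         h1 i * \<phi> (1, x1 i) - h0 i * \<phi> (0, x0 i)" .
    qed
    finally have L: "(LINT p:?X|?M. ?f p) = (\<Sum>i\<in>I. h1 i * \<phi> (1, x1 i)) - (\<Sum>i\<in>I. h0 i * \<phi> (0, x0 i))"
      by (simp add: sum_subtractf)
    have c: "continuous_on (closure \<Omega>) (\<lambda>x. \<phi> (t, x))" if "t \<in> {0..1}" for t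
      by (rule continuous_on_compose2[OF C1_continuous_on[OF C1]]) (use that in \<open>auto intro!: continuous_intros\<close>)
    have s1: "signed_integral (closure \<Omega>) \<rho>1 (\<lambda>x. \<phi> (1, x)) = (\<Sum>i\<in>I. h1 i * \<phi> (1, x1 i))"
      unfolding \<rho>1 by (rule signed_integral_dirac_sum[OF I _ _ clc c]) (use h x in auto)
    have s0: "signed_integral (closure \<Omega>) \<rho>0 (\<lambda>x. \<phi> (0, x)) = (\<Sum>i\<in>I. h0 i * \<phi> (0, x0 i))"
      unfolding \<rho>0 by (rule signed_integral_dirac_sum[OF I _ _ clc c]) (use h x in auto)
    show "signed_integral ?X \<rho> \<phi>t + vector_integral ?X \<omega> \<phi>x + signed_integral ?X \<zeta> \<phi> =
        signed_integral (closure \<Omega>) \<rho>1 (\<lambda>x. \<phi> (1, x)) - signed_integral (closure \<Omega>) \<rho>0 (\<lambda>x. \<phi> (0, x))"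
      unfolding PD(2) s0 s1 by (rule L)
  qed
  have "action \<delta> \<Omega> (\<rho>, \<omega>, \<zeta>) = ennreal (\<Sum>i\<in>I. pair_cost \<delta> (h0 i) (x0 i) (h1 i) (x1 i))"
  proof -
    have "(\<lambda>p. f_wf \<delta> (r p) (W p) (z p)) \<in> borel_measurable ?M"
      by (intro borel_measurable_f_wf borel_measurable_integrable ri Wi zi)
    then have fm: "(\<lambda>p. f_wf \<delta> (r p) (W p) (z p) * indicator ?X p) \<in> borel_measurable borel"
      using Xm unfolding measurable_curve_measure by measurable
    have "action \<delta> \<Omega> (\<rho>, \<omega>, \<zeta>) = (\<Sum>i\<in>I. \<integral>\<^sup>+t\<in>{0..1}. f_wf \<delta> (r (t, \<gamma> i t)) (W (t, \<gamma> i t)) (z (t, \<gamma> i t)) * indicator ?X (t, \<gamma> i t) \<partial>lborel)"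
      unfolding action_eq[OF td] by (rule nn_integral_curve_measure[OF fm])
    also have "\<dots> = (\<Sum>i\<in>I. ennreal (pair_cost \<delta> (h0 i) (x0 i) (h1 i) (x1 i)))"
    proof (rule sum.cong[OF refl])
      fix i assume i: "i \<in> I"
      let ?V = "ennreal (pair_cost \<delta> (h0 i) (x0 i) (h1 i) (x1 i))"
      have f: "f_wf \<delta> (h i t) (w i) (dh i t) = ?V" if "t \<in> {0<..<1}" for t
        using P[OF i] that unfolding dirac_path_def by blast
      have "(\<integral>\<^sup>+t\<in>{0..1}. f_wf \<delta> (r (t, \<gamma> i t)) (W (t, \<gamma> i t)) (z (t, \<gamma> i t)) * indicator ?X (t, \<gamma> i t) \<partial>lborel) =
        (\<integral>\<^sup>+t. ?V * indicator {0..1::real} t \<partial>lborel)"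
      proof (rule nn_integral_cong_AE)
        (* the end times, where a curve may have mass 0, form a null set *)
        have "AE t in lborel. t \<noteq> 0 \<and> t \<noteq> (1::real)"
          using AE_lborel_singleton[of 0] AE_lborel_singleton[of 1] by eventually_elim simp
        then show "AE t in lborel. f_wf \<delta> (r (t, \<gamma> i t)) (W (t, \<gamma> i t)) (z (t, \<gamma> i t)) * indicator ?X (t, \<gamma> i t) *
            indicator {0..1} t = ?V * indicator {0..1} t"
        proof eventually_elim
          case (elim t)
          show ?case
          proof (cases "t \<in> {0..1}")
            case True
            then have "t \<in> {0<..<1}" using elim by auto
            then show ?thesis using True \<gamma>\<Omega>[OF i True] f
              by (simp add: r_def W_def z_def spread_curve[OF i True])
          qed simp
        qed
      qed
      then show "(\<integral>\<^sup>+t\<in>{0..1}. f_wf \<delta> (r (t, \<gamma> i t)) (W (t, \<gamma> i t)) (z (t, \<gamma> i t)) * indicator ?X (t, \<gamma> i t) \<partial>lborel) = ?V"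
        by (simp add: nn_integral_cmult_indicator)
    qed
    also have "\<dots> = ennreal (\<Sum>i\<in>I. pair_cost \<delta> (h0 i) (x0 i) (h1 i) (x1 i))"
      by (rule sum_ennreal) (use h in \<open>auto intro: pair_cost_nonneg\<close>)
    finally show ?thesis .
  qed
  then show ?thesis using \<rho>n ce by blast
qed

section \<open>The lower bound\<close>

text \<open>The contribution of one pair to the boundary terms of \<open>cert\<close>.\<close>

definition pair_bound where
  "pair_bound \<delta> k \<kappa> (c::'a::euclidean_space) h0 x0 h1 x1 =
     h1 * (stiff \<delta> k 1 + (stiff \<delta> \<kappa> 1 - stiff \<delta> k 1) * bump \<delta> c x1)
   - h0 * (stiff \<delta> k 0 + (stiff \<delta> \<kappa> 0 - stiff \<delta> k 0) * bump \<delta> c x0)"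

locale separated_pairs =
  fixes \<delta> :: real and I :: "nat set" and h0 h1 :: "nat \<Rightarrow> real" and x0 x1 :: "nat \<Rightarrow> 'a::euclidean_space"
    and \<Omega> :: "'a set"
  assumes \<delta>: "0 < \<delta>" and \<Omega>: "bounded \<Omega>" and I: "finite I" "I \<noteq> {}"
    and h: "\<And>i. i \<in> I \<Longrightarrow> 0 \<le> h0 i" "\<And>i. i \<in> I \<Longrightarrow> 0 \<le> h1 i"
    and x: "\<And>i. i \<in> I \<Longrightarrow> x0 i \<in> closure \<Omega>" "\<And>i. i \<in> I \<Longrightarrow> x1 i \<in> closure \<Omega>"
    and near: "\<And>i. i \<in> I \<Longrightarrow> norm (x0 i - x1 i) < pi * \<delta>"
    and far: "\<And>i j y z. i \<in> I \<Longrightarrow> j \<in> I \<Longrightarrow> i \<noteq> j \<Longrightarrow> y \<in> {x0 i, x1 i} \<Longrightarrow> z \<in> {x0 j, x1 j} \<Longrightarrow>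
       4 * pi * \<delta> < norm (y - z)"
begin

definition "\<rho>0 = (\<lambda>A. \<Sum>i\<in>I. h0 i * dirac (x0 i) A)"
definition "\<rho>1 = (\<lambda>A. \<Sum>i\<in>I. h1 i * dirac (x1 i) A)"

lemma boundary_terms:
  assumes C1: "C1_with_derivs ({0..1} \<times> closure \<Omega>) \<phi> \<phi>t \<phi>x"
  shows "signed_integral (closure \<Omega>) \<rho>1 (\<lambda>x. \<phi> (1, x)) - signed_integral (closure \<Omega>) \<rho>0 (\<lambda>x. \<phi> (0, x)) =
    (\<Sum>i\<in>I. h1 i * \<phi> (1, x1 i) - h0 i * \<phi> (0, x0 i))"
proof -
  have clc: "compact (closure \<Omega>)" using \<Omega> by (simp add: compact_closure)
  have c: "continuous_on (closure \<Omega>) (\<lambda>x. \<phi> (t, x))" if "t \<in> {0..1}" for t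
    by (rule continuous_on_compose2[OF C1_continuous_on[OF C1]]) (use that in \<open>auto intro!: continuous_intros\<close>)
  have s1: "signed_integral (closure \<Omega>) \<rho>1 (\<lambda>x. \<phi> (1, x)) = (\<Sum>i\<in>I. h1 i * \<phi> (1, x1 i))"
    unfolding \<rho>1_def by (rule signed_integral_dirac_sum[OF I(1) h(2) x(2) clc c]) auto
  have s0: "signed_integral (closure \<Omega>) \<rho>0 (\<lambda>x. \<phi> (0, x)) = (\<Sum>i\<in>I. h0 i * \<phi> (0, x0 i))"
    unfolding \<rho>0_def by (rule signed_integral_dirac_sum[OF I(1) h(1) x(1) clc c]) auto
  show ?thesis unfolding s0 s1 by (rule sum_subtractf[symmetric])
qed

text \<open>Every centre is so close to an end point of its pair that the balls of radius \<open>\<pi>\<delta>\<close> about the centres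
are disjoint, and none of them contains an end point of another pair.\<close>

definition centred :: "(nat \<Rightarrow> 'a) \<Rightarrow> bool" where
  "centred c \<longleftrightarrow> (\<forall>i\<in>I. \<exists>y\<in>{x0 i, x1 i}. norm (c i - y) < pi * \<delta>)"

lemma centred_far:
  assumes c: "centred c" and ij: "i \<in> I" "j \<in> I" "i \<noteq> j" and z: "z \<in> {x0 i, x1 i}"
  shows "pi * \<delta> \<le> norm (z - c j)"
proof -
  obtain y where y: "y \<in> {x0 j, x1 j}" "norm (c j - y) < pi * \<delta>" using c ij(2) unfolding centred_def by blast
  have "norm (z - y) \<le> norm (z - c j) + norm (c j - y)" using norm_triangle_ineq[of "z - c j" "c j - y"] by simp
  moreover have "4 * pi * \<delta> < norm (z - y)" using far[OF ij z y(1)] .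
  moreover have "0 < pi * \<delta>" using \<delta> by simp
  ultimately show ?thesis using y(2) by linarith
qed

lemma centred_separated:
  assumes c: "centred c" "centred c'" and ij: "i \<in> I" "j \<in> I" "i \<noteq> j"
  shows "2 * pi * \<delta> \<le> norm (c i - c' j)"
proof -
  obtain y where y: "y \<in> {x0 i, x1 i}" "norm (c i - y) < pi * \<delta>" using c ij(1) unfolding centred_def by blast
  obtain z where z: "z \<in> {x0 j, x1 j}" "norm (c' j - z) < pi * \<delta>" using c ij(2) unfolding centred_def by blast
  have "norm (y - z) \<le> norm (c i - y) + norm (c i - c' j) + norm (c' j - z)"
    using norm_triangle_ineq[of "y - c i" "c i - c' j"] norm_triangle_ineq[of "y - c' j" "c' j - z"]
    by (simp add: norm_minus_commute)
  moreover have "4 * pi * \<delta> < norm (y - z)" using far[OF ij y(1) z(1)] .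
  ultimately show ?thesis using y(2) z(2) by linarith
qed

lemma centred_HJ:
  assumes c: "centred c"
  shows "cert_t \<delta> I k \<kappa> c p + (cert_x \<delta> I k \<kappa> c p \<bullet> cert_x \<delta> I k \<kappa> c p + (cert \<delta> I k \<kappa> c p)\<^sup>2 / \<delta>\<^sup>2) / 2 = 0"
  by (rule cert_hamilton_jacobi[OF \<delta> I centred_separated[OF c c]])

lemma centred_boundary:
  assumes c: "centred c" and k: "0 < k" and \<kappa>: "\<And>i. i \<in> I \<Longrightarrow> 0 < \<kappa> i"
  shows "signed_integral (closure \<Omega>) \<rho>1 (\<lambda>x. cert \<delta> I k \<kappa> c (1, x)) -
      signed_integral (closure \<Omega>) \<rho>0 (\<lambda>x. cert \<delta> I k \<kappa> c (0, x)) =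
    (\<Sum>i\<in>I. pair_bound \<delta> k (\<kappa> i) (c i) (h0 i) (x0 i) (h1 i) (x1 i))"
proof -
  have C1: "C1_with_derivs ({0..1} \<times> closure \<Omega>) (cert \<delta> I k \<kappa> c) (cert_t \<delta> I k \<kappa> c) (cert_x \<delta> I k \<kappa> c)"
    by (rule C1_cert[OF \<delta> k \<kappa>])
  show ?thesis
    unfolding boundary_terms[OF C1]
proof (rule sum.cong[OF refl])
  fix i assume i: "i \<in> I"
  have s: "\<forall>j\<in>I - {i}. bump \<delta> (c j) z = 0 \<and> bump_grad \<delta> (c j) z = 0" if "z \<in> {x0 i, x1 i}" for z
    using bump_outside[OF \<delta> centred_far[OF c i _ _ that]] by blast
  show "h1 i * cert \<delta> I k \<kappa> c (1, x1 i) - h0 i * cert \<delta> I k \<kappa> c (0, x0 i) =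
      pair_bound \<delta> k (\<kappa> i) (c i) (h0 i) (x0 i) (h1 i) (x1 i)"
    unfolding pair_bound_def cert_single(1)[OF I(1) i s, of "x1 i", simplified] cert_single(1)[OF I(1) i s, of "x0 i", simplified] ..
qed
qed

lemma centred_lower_bound:
  assumes c: "centred c" and k: "0 < k" and \<kappa>: "\<And>i. i \<in> I \<Longrightarrow> 0 < \<kappa> i"
    and ce: "(\<rho>, \<omega>, \<zeta>) \<in> CE \<Omega> \<rho>0 \<rho>1"
  shows "ennreal (\<Sum>i\<in>I. pair_bound \<delta> k (\<kappa> i) (c i) (h0 i) (x0 i) (h1 i) (x1 i)) \<le> action \<delta> \<Omega> (\<rho>, \<omega>, \<zeta>)"
proof -
  have C1: "C1_with_derivs ({0..1} \<times> closure \<Omega>) (cert \<delta> I k \<kappa> c) (cert_t \<delta> I k \<kappa> c) (cert_x \<delta> I k \<kappa> c)"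
    by (rule C1_cert[OF \<delta> k \<kappa>])
  have "signed_integral (closure \<Omega>) \<rho>1 (\<lambda>x. cert \<delta> I k \<kappa> c (1, x)) -
      signed_integral (closure \<Omega>) \<rho>0 (\<lambda>x. cert \<delta> I k \<kappa> c (0, x)) =
    (\<Sum>i\<in>I. pair_bound \<delta> k (\<kappa> i) (c i) (h0 i) (x0 i) (h1 i) (x1 i))"
    by (rule centred_boundary[OF c k \<kappa>])
  then show ?thesis
    using action_lower_bound[OF ce \<Omega> \<delta> C1 eq_refl[OF centred_HJ[OF c]]] by simp
qed

text \<open>Above this value the common eigenvalue \<open>k\<close> is admissible for every pair.\<close>

definition threshold :: real where
  "threshold = Max ((\<lambda>i. sqrt (h1 i) / (sqrt (h0 i) * cos (half_angle \<delta> (x0 i) (x1 i)))) ` I)"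

lemma threshold_nonneg: "0 \<le> threshold"
proof -
  obtain i where i: "i \<in> I" using I by blast
  have "0 \<le> sqrt (h1 i) / (sqrt (h0 i) * cos (half_angle \<delta> (x0 i) (x1 i)))"
    using h[OF i] half_angle_bounds[OF \<delta> near[OF i]] by simp
  also have "\<dots> \<le> threshold" unfolding threshold_def using I i by (intro Max_ge) auto
  finally show ?thesis .
qed

lemma dirac_pair_threshold:
  assumes k: "threshold < k" and i: "i \<in> I" and pos: "0 < h0 i" "0 < h1 i"
  shows "dirac_pair \<delta> (h0 i) (h1 i) (x0 i) (x1 i) k"
proof (rule dirac_pair_exists[OF \<delta> pos near[OF i]])
  have "sqrt (h1 i) / (sqrt (h0 i) * cos (half_angle \<delta> (x0 i) (x1 i))) \<le> threshold"
    unfolding threshold_def using I i by (intro Max_ge) auto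
  then show "sqrt (h1 i) / (sqrt (h0 i) * cos (half_angle \<delta> (x0 i) (x1 i))) < k" using k by linarith
qed

text \<open>A pair with an empty end has no optimal \<open>\<kappa>\<close>: the bound improves as \<open>\<kappa>\<close> tends to \<open>0\<close> when the mass
vanishes at time \<open>1\<close>, and to infinity when it vanishes at time \<open>0\<close>. The values \<open>\<epsilon>\<close> and \<open>1/\<epsilon>\<close> lose the
factor \<open>1 - \<epsilon>\<close>.\<close>

lemma approximate_lower_bound:
  assumes ce: "(\<rho>, \<omega>, \<zeta>) \<in> CE \<Omega> \<rho>0 \<rho>1" and \<epsilon>: "0 < \<epsilon>"
  shows "ennreal (\<Sum>i\<in>I. pair_cost \<delta> (h0 i) (x0 i) (h1 i) (x1 i) - \<epsilon> * (2 * \<delta>\<^sup>2 * (h0 i + h1 i)))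
     \<le> action \<delta> \<Omega> (\<rho>, \<omega>, \<zeta>)"
proof -
  define k where "k = threshold + 1"
  have k: "threshold < k" "0 < k" unfolding k_def using threshold_nonneg by simp_all
  define pos where "pos i \<longleftrightarrow> 0 < h0 i \<and> 0 < h1 i" for i
  define c where "c i = (if pos i then centre \<delta> (h0 i) (x0 i) (h1 i) (x1 i) k
     else if h1 i = 0 then x0 i else x1 i)" for i
  define \<kappa> where "\<kappa> i = (if pos i then radial_factor \<delta> (h0 i) (x0 i) (h1 i) (x1 i) k
     else if h1 i = 0 then \<epsilon> else 1 / \<epsilon>)" for i
  have dp: "dirac_pair \<delta> (h0 i) (h1 i) (x0 i) (x1 i) k" if "i \<in> I" "pos i" for i
    using dirac_pair_threshold[OF k(1) that(1)] that(2) unfolding pos_def by blast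
  have cc: "centred c"
    unfolding centred_def
  proof
    fix i assume i: "i \<in> I"
    have d: "0 < pi * \<delta>" using \<delta> by simp
    show "\<exists>y\<in>{x0 i, x1 i}. norm (c i - y) < pi * \<delta>"
      using dirac_pair.centre_near[OF dp[OF i]] d unfolding c_def by auto
  qed
  have kp: "0 < \<kappa> i" if i: "i \<in> I" for i
    using dirac_pair.\<kappa>_pos[OF dp[OF i]] \<epsilon> unfolding \<kappa>_def by auto
  have "pair_bound \<delta> k (\<kappa> i) (c i) (h0 i) (x0 i) (h1 i) (x1 i) \<ge>
    pair_cost \<delta> (h0 i) (x0 i) (h1 i) (x1 i) - \<epsilon> * (2 * \<delta>\<^sup>2 * (h0 i + h1 i))" if i: "i \<in> I" for i
  proof -
    have b1: "bump \<delta> y y = 1" for y :: 'a unfolding bump_def by (simp add: min_def)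
    consider "pos i" | "\<not> pos i" "h1 i = 0" | "\<not> pos i" "h1 i \<noteq> 0" "h0 i = 0"
      using h[OF i] unfolding pos_def by force
    then show ?thesis
    proof cases
      case 1
      have "pair_bound \<delta> k (\<kappa> i) (c i) (h0 i) (x0 i) (h1 i) (x1 i) = pair_cost \<delta> (h0 i) (x0 i) (h1 i) (x1 i)"
        unfolding pair_bound_def \<kappa>_def c_def using dirac_pair.pair_value[OF dp[OF i 1]] 1 by simp
      moreover have "0 \<le> \<epsilon> * (2 * \<delta>\<^sup>2 * (h0 i + h1 i))" using h[OF i] \<epsilon> by simp
      ultimately show ?thesis by linarith
    next
      case 2
      then have "pair_bound \<delta> k (\<kappa> i) (c i) (h0 i) (x0 i) (h1 i) (x1 i) = 2 * \<delta>\<^sup>2 * h0 i * (1 - \<epsilon>)"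
        unfolding pair_bound_def \<kappa>_def c_def by (simp add: b1 stiff_def stretch_def algebra_simps)
      then show ?thesis using 2 unfolding pair_cost_def by (simp add: algebra_simps)
    next
      case 3
      then have "pair_bound \<delta> k (\<kappa> i) (c i) (h0 i) (x0 i) (h1 i) (x1 i) = h1 i * stiff \<delta> (1 / \<epsilon>) 1"
        unfolding pair_bound_def \<kappa>_def c_def by (simp add: b1)
      also have "\<dots> = 2 * \<delta>\<^sup>2 * h1 i * (1 - \<epsilon>)"
        unfolding stiff_def stretch_def using \<epsilon> by (simp add: field_simps)
      finally show ?thesis using 3 unfolding pair_cost_def by (simp add: algebra_simps)
    qed
  qed
  then have "ennreal (\<Sum>i\<in>I. pair_cost \<delta> (h0 i) (x0 i) (h1 i) (x1 i) - \<epsilon> * (2 * \<delta>\<^sup>2 * (h0 i + h1 i))) \<le>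
     ennreal (\<Sum>i\<in>I. pair_bound \<delta> k (\<kappa> i) (c i) (h0 i) (x0 i) (h1 i) (x1 i))"
    by (intro ennreal_leI sum_mono)
  also have "\<dots> \<le> action \<delta> \<Omega> (\<rho>, \<omega>, \<zeta>)" by (rule centred_lower_bound[OF cc k(2) kp ce])
  finally show ?thesis .
qed

lemma total_lower_bound:
  assumes ce: "(\<rho>, \<omega>, \<zeta>) \<in> CE \<Omega> \<rho>0 \<rho>1"
  shows "ennreal (\<Sum>i\<in>I. pair_cost \<delta> (h0 i) (x0 i) (h1 i) (x1 i)) \<le> action \<delta> \<Omega> (\<rho>, \<omega>, \<zeta>)"
proof (rule LIMSEQ_le_const2)
  have "(\<lambda>n. (\<Sum>i\<in>I. pair_cost \<delta> (h0 i) (x0 i) (h1 i) (x1 i) - inverse (real (Suc n)) * (2 * \<delta>\<^sup>2 * (h0 i + h1 i))))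
     \<longlonglongrightarrow> (\<Sum>i\<in>I. pair_cost \<delta> (h0 i) (x0 i) (h1 i) (x1 i) - 0 * (2 * \<delta>\<^sup>2 * (h0 i + h1 i)))"
    by (intro tendsto_intros LIMSEQ_inverse_real_of_nat)
  then show "(\<lambda>n. ennreal (\<Sum>i\<in>I. pair_cost \<delta> (h0 i) (x0 i) (h1 i) (x1 i) - inverse (real (Suc n)) * (2 * \<delta>\<^sup>2 * (h0 i + h1 i))))
     \<longlonglongrightarrow> ennreal (\<Sum>i\<in>I. pair_cost \<delta> (h0 i) (x0 i) (h1 i) (x1 i))"
    by (intro tendsto_ennrealI) simp
  show "\<exists>N. \<forall>n\<ge>N. ennreal (\<Sum>i\<in>I. pair_cost \<delta> (h0 i) (x0 i) (h1 i) (x1 i) - inverse (real (Suc n)) * (2 * \<delta>\<^sup>2 * (h0 i + h1 i)))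
     \<le> action \<delta> \<Omega> (\<rho>, \<omega>, \<zeta>)"
    by (intro exI allI impI approximate_lower_bound[OF ce]) simp
qed

end

section \<open>Uniqueness for positive masses\<close>

context dirac_pair begin

text \<open>The quantities \<open>bump/stretch\<^sup>2\<close> and \<open>(1 - bump)/stretch\<^sup>2\<close> are the squared coordinates of the initial point of a
trajectory of the flow \<open>1 + t(K-1)\<close>, per unit of its mass at time \<open>t\<close>. On the curve they are \<open>p\<^sup>2/h\<close> and \<open>q\<^sup>2/h\<close>.\<close>

lemma weight_position:
  assumes t: "t \<in> {0..1}"
  shows "1 / (stretch \<kappa> t)\<^sup>2 * bump \<delta> c (position t) = p\<^sup>2 / h t"
  unfolding bump_position[OF t] using stretch_pos[OF \<kappa>_pos t] by (simp add: power_mult_distrib)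

lemma coweight_position:
  assumes t: "t \<in> {0..1}"
  shows "1 / (stretch k t)\<^sup>2 * (1 - bump \<delta> c (position t)) = q\<^sup>2 / h t"
proof -
  have "1 - bump \<delta> c (position t) = (h t - (p * stretch \<kappa> t)\<^sup>2) / h t"
    unfolding bump_position[OF t] using mass_pos[OF t] by (simp add: diff_divide_distrib)
  also have "h t - (p * stretch \<kappa> t)\<^sup>2 = (q * stretch k t)\<^sup>2" unfolding mass_eq by simp
  finally show ?thesis using stretch_pos[OF k_pos t] by (simp add: power_mult_distrib)
qed

text \<open>The ratio of the two invariants is the squared tangent of the initial angle, so it determines the
distance to the centre at time \<open>t\<close>.\<close>

lemma on_sphere:
  assumes t: "t \<in> {0..1}" and x: "norm (x - c) < pi * \<delta>"
    and eq: "p\<^sup>2 * (1 / (stretch k t)\<^sup>2 * (1 - bump \<delta> c x)) = q\<^sup>2 * (1 / (stretch \<kappa> t)\<^sup>2 * bump \<delta> c x)"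
  shows "norm (x - c) = 2 * \<delta> * angle t"
proof -
  define s where "s = norm (x - c) / (2 * \<delta>)"
  have s: "0 \<le> s" "s < pi / 2" "norm (x - c) = 2 * \<delta> * s"
    unfolding s_def using \<delta> x by (simp_all add: field_simps)
  have b: "bump \<delta> c x = (cos s)\<^sup>2" by (rule bump_eq_cos[OF \<delta> s(3)]) (use s in simp)
  have b': "1 - bump \<delta> c x = (sin s)\<^sup>2" unfolding b by (simp add: sin_squared_eq)
  have st: "0 < stretch k t" "0 < stretch \<kappa> t" using stretch_pos k_pos \<kappa>_pos t by blast+
  have cs: "0 < cos s" using s by (intro cos_gt_zero_pi) auto
  have ss: "0 \<le> sin s" using s by (intro sin_ge_zero) auto
  have "(p * sin s / stretch k t)\<^sup>2 = (q * cos s / stretch \<kappa> t)\<^sup>2"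
    using eq unfolding b' unfolding b by (simp add: power_mult_distrib power_divide)
  then have "p * sin s / stretch k t = q * cos s / stretch \<kappa> t"
    using p_pos q_nonneg ss cs st by (subst (asm) power2_eq_iff_nonneg) auto
  then have "p * sin s * stretch \<kappa> t = q * cos s * stretch k t"
    using st by (simp add: frac_eq_eq)
  then have "tan s = q * stretch k t / (p * stretch \<kappa> t)"
    unfolding tan_def using p_pos st cs by (simp add: frac_eq_eq mult_ac)
  then have "angle t = s" unfolding angle_def using arctan_tan[of s] s by simp
  then show ?thesis using s(3) by simp
qed

end

lemma tilt_strict_antimono:
  assumes 1: "dirac_pair \<delta> h0 h1 x0 x1 k" and 2: "dirac_pair \<delta> h0 h1 x0 x1 k'"
    and k: "k < k'" and ne: "x0 \<noteq> x1"
  shows "tilt \<delta> h0 x0 h1 x1 k' < tilt \<delta> h0 x0 h1 x1 k"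
proof -
  interpret A: dirac_pair \<delta> h0 h1 x0 x1 k by fact
  have "0 < half_angle \<delta> x0 x1" unfolding half_angle_def using A.\<delta> ne by simp
  then have "0 < sin (half_angle \<delta> x0 x1)" using A.\<theta>_bounds by (intro sin_gt_zero) auto
  then have s: "0 < sqrt h1 * sin (half_angle \<delta> x0 x1)" using A.h1 by simp
  have "k * sqrt h0 < k' * sqrt h0" using k A.h0 by simp
  then have d: "k * sqrt h0 - sqrt h1 * cos (half_angle \<delta> x0 x1) < k' * sqrt h0 - sqrt h1 * cos (half_angle \<delta> x0 x1)"
    by simp
  with A.denominator_pos have "0 < k' * sqrt h0 - sqrt h1 * cos (half_angle \<delta> x0 x1)" by linarith
  then show ?thesis unfolding tilt_def
    by (intro arctan_monotone divide_strict_left_mono[OF d s] mult_pos_pos A.denominator_pos)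
qed

text \<open>If \<open>x0 \<noteq> x1\<close>, the centre for \<open>k'\<close> lies strictly between the centre for \<open>k\<close> and the moving point, by
strict monotonicity of \<open>tilt\<close>. Equality in the triangle inequality then leaves one common point of the two spheres. If
\<open>x0 = x1\<close> the spheres have radius zero.\<close>

lemma spheres_tangent:
  fixes x0 x1 x :: "'a::euclidean_space"
  assumes 1: "dirac_pair \<delta> h0 h1 x0 x1 k" and 2: "dirac_pair \<delta> h0 h1 x0 x1 k'"
    and k: "k < k'" and t: "t \<in> {0..1}"
    and n: "norm (x - centre \<delta> h0 x0 h1 x1 k) = norm (dirac_position \<delta> h0 x0 h1 x1 t - centre \<delta> h0 x0 h1 x1 k)"
    and n': "norm (x - centre \<delta> h0 x0 h1 x1 k') = norm (dirac_position \<delta> h0 x0 h1 x1 t - centre \<delta> h0 x0 h1 x1 k')"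
  shows "x = dirac_position \<delta> h0 x0 h1 x1 t"
proof -
  interpret A: dirac_pair \<delta> h0 h1 x0 x1 k by fact
  interpret B: dirac_pair \<delta> h0 h1 x0 x1 k' by fact
  let ?y = "dirac_position \<delta> h0 x0 h1 x1 t"
  have yA: "?y = A.c + (2 * \<delta> * A.angle t) *\<^sub>R sgn (x1 - x0)"
    unfolding A.dirac_position_eq[OF t] A.position_def ..
  have yB: "?y = B.c + (2 * \<delta> * B.angle t) *\<^sub>R sgn (x1 - x0)"
    unfolding B.dirac_position_eq[OF t] B.position_def ..
  show ?thesis
  proof (cases "x0 = x1")
    case True
    then have "?y = A.c" using yA by simp
    then show ?thesis using n by simp
  next
    case False
    define e where "e = sgn (x1 - x0)"
    have e: "e \<bullet> e = 1" unfolding e_def using False by (simp add: dot_square_norm norm_sgn)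
    define \<tau> where "\<tau> = 2 * \<delta> * (A.\<alpha> - B.\<alpha>)"
    have \<tau>: "0 < \<tau>" unfolding \<tau>_def using tilt_strict_antimono[OF 1 2 k False] A.\<delta> by simp
    define b where "b = 2 * \<delta> * B.angle t"
    define u where "u = x - B.c"
    have b: "0 \<le> b" unfolding b_def using A.\<delta> B.angle_bounds(3)[OF t] by simp
    have cc: "B.c = A.c + \<tau> *\<^sub>R e" unfolding centre_def \<tau>_def e_def by (simp add: algebra_simps)
    have "norm u = norm (b *\<^sub>R e)" using n' unfolding u_def yB b_def e_def by simp
    then have nu: "u \<bullet> u = b\<^sup>2" using e unfolding norm_eq by (simp add: power2_eq_square)
    have "x - A.c = u + \<tau> *\<^sub>R e" unfolding u_def cc by simp
    moreover have "?y - A.c = (b + \<tau>) *\<^sub>R e" unfolding yB b_def[symmetric] e_def[symmetric] cc by (simp add: algebra_simps)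
    ultimately have "norm (u + \<tau> *\<^sub>R e) = norm ((b + \<tau>) *\<^sub>R e)" using n by simp
    then have "(u + \<tau> *\<^sub>R e) \<bullet> (u + \<tau> *\<^sub>R e) = (b + \<tau>)\<^sup>2" unfolding norm_eq using e by (simp add: power2_eq_square)
    then have "u \<bullet> u + 2 * \<tau> * (u \<bullet> e) + \<tau>\<^sup>2 = b\<^sup>2 + 2 * \<tau> * b + \<tau>\<^sup>2"
      using e by (simp add: inner_add_left inner_add_right inner_commute power2_eq_square algebra_simps)
    then have ue: "u \<bullet> e = b" using nu \<tau> by simp
    have "(u - b *\<^sub>R e) \<bullet> (u - b *\<^sub>R e) = u \<bullet> u - 2 * b * (u \<bullet> e) + b\<^sup>2 * (e \<bullet> e)"
      by (simp add: inner_diff_left inner_diff_right inner_commute power2_eq_square algebra_simps)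
    also have "\<dots> = 0" unfolding nu ue e by (simp add: power2_eq_square)
    finally have "u = b *\<^sub>R e" by simp
    then show ?thesis unfolding yB u_def b_def e_def by (simp add: algebra_simps)
  qed
qed

lemma C1_const: "C1_with_derivs ({0..1} \<times> S) (\<lambda>p. a) (\<lambda>p. 0) (\<lambda>p. 0 :: 'a::euclidean_space)"
  using C1_time[of "{0..1}" "\<lambda>_. a" "\<lambda>_. 0"] by auto

lemma C1_inverse_stretch:
  assumes k: "0 < k" and \<delta>: "0 < \<delta>"
  shows "C1_with_derivs ({0..1} \<times> S) (\<lambda>p. 1 / (stretch k (fst p))\<^sup>2)
    (\<lambda>p. - (stiff \<delta> k (fst p) / \<delta>\<^sup>2) * (1 / (stretch k (fst p))\<^sup>2)) (\<lambda>p. 0 :: 'a::euclidean_space)"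
proof (rule C1_time)
  fix t :: real assume t: "t \<in> {0..1}"
  have s: "stretch k t \<noteq> 0" using stretch_pos[OF k t] by simp
  have "((\<lambda>t. 1 / (stretch k t)\<^sup>2) has_real_derivative
     (0 * (stretch k t)\<^sup>2 - 1 * (of_nat 2 * stretch k t ^ (2 - 1) * (k - 1))) / ((stretch k t)\<^sup>2 * (stretch k t)\<^sup>2)) (at t within {0..1})"
  proof (intro DERIV_divide DERIV_const)
    show "((\<lambda>t. (stretch k t)\<^sup>2) has_real_derivative of_nat 2 * stretch k t ^ (2 - 1) * (k - 1)) (at t within {0..1})"
      using DERIV_power[OF stretch_has_derivative[of k t "{0..1}"], of 2] by (simp add: mult_ac)
  qed (use s in simp)
  moreover have "(0 * (stretch k t)\<^sup>2 - 1 * (of_nat 2 * stretch k t ^ (2 - 1) * (k - 1))) / ((stretch k t)\<^sup>2 * (stretch k t)\<^sup>2) =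
     - (stiff \<delta> k t / \<delta>\<^sup>2) * (1 / (stretch k t)\<^sup>2)"
    unfolding stiff_def using s \<delta> by (simp add: field_simps power2_eq_square)
  ultimately show "((\<lambda>t. 1 / (stretch k t)\<^sup>2) has_real_derivative - (stiff \<delta> k t / \<delta>\<^sup>2) * (1 / (stretch k t)\<^sup>2)) (at t within {0..1})"
    by simp
next
  show "continuous_on {0..1} (\<lambda>t. - (stiff \<delta> k t / \<delta>\<^sup>2) * (1 / (stretch k t)\<^sup>2))"
    using \<delta> stretch_pos[OF k] by (intro continuous_intros continuous_on_stiff[OF k] continuous_on_stretch) force+
qed

lemma C1_weight:
  fixes c :: "'a::euclidean_space"
  assumes k: "0 < \<kappa>" and \<delta>: "0 < \<delta>"
  shows "C1_with_derivs ({0..1} \<times> S) (\<lambda>p. 1 / (stretch \<kappa> (fst p))\<^sup>2 * bump \<delta> c (snd p))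
    (\<lambda>p. - (stiff \<delta> \<kappa> (fst p) / \<delta>\<^sup>2) * (1 / (stretch \<kappa> (fst p))\<^sup>2) * bump \<delta> c (snd p))
    (\<lambda>p. (1 / (stretch \<kappa> (fst p))\<^sup>2) *\<^sub>R bump_grad \<delta> c (snd p))"
  by (rule C1_cong[OF C1_mult[OF C1_inverse_stretch[OF k \<delta>] C1_bump[OF \<delta>]]]) simp_all

lemma C1_coweight:
  fixes c :: "'a::euclidean_space"
  assumes k: "0 < k" and \<delta>: "0 < \<delta>"
  shows "C1_with_derivs ({0..1} \<times> S) (\<lambda>p. 1 / (stretch k (fst p))\<^sup>2 * (1 - bump \<delta> c (snd p)))
    (\<lambda>p. - (stiff \<delta> k (fst p) / \<delta>\<^sup>2) * (1 / (stretch k (fst p))\<^sup>2) * (1 - bump \<delta> c (snd p)))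
    (\<lambda>p. - ((1 / (stretch k (fst p))\<^sup>2) *\<^sub>R bump_grad \<delta> c (snd p)))"
  by (rule C1_cong[OF C1_mult[OF C1_inverse_stretch[OF k \<delta>]
        C1_add[OF C1_const[of _ 1] C1_mult[OF C1_const[of _ "-1"] C1_bump[OF \<delta>]]]]]) simp_all

lemma cert_le_stiff:
  assumes \<delta>: "0 < \<delta>" and t: "t \<in> {0..1}" and \<kappa>: "\<And>i. i \<in> I \<Longrightarrow> 0 < \<kappa> i \<and> \<kappa> i < k"
  shows "cert \<delta> I k \<kappa> c (t, x) \<le> stiff \<delta> k t"
proof -
  have "(\<Sum>i\<in>I. (stiff \<delta> (\<kappa> i) t - stiff \<delta> k t) * bump \<delta> (c i) x) \<le> 0"
    using stiff_strict_mono[OF _ _ t \<delta>] \<kappa> bump_nonneg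
    by (intro sum_nonpos mult_nonpos_nonneg) (auto intro: less_imp_le)
  then show ?thesis unfolding cert_def by simp
qed

lemma cert_outside:
  assumes "\<And>i. i \<in> I \<Longrightarrow> bump \<delta> (c i) x = 0"
  shows "cert \<delta> I k \<kappa> c (t, x) = stiff \<delta> k t"
  unfolding cert_def using assms by (simp add: sum.neutral)

text \<open>With \<open>B\<close>, \<open>G\<close> the value and gradient of an active bump and \<open>m\<close>, \<open>m1\<close> the eigenvalues of the quadratic form,
both invariants satisfy \<open>\<psi>_t + \<nabla>\<phi> \<cdot> \<nabla>\<psi> + \<phi>\<psi>/\<delta>^2 = 0\<close> for \<open>\<phi> = m + (m1 - m) B\<close>.\<close>

lemma weight_transport:
  fixes G :: "'a::euclidean_space"
  assumes \<delta>: "0 < \<delta>" and G: "G \<bullet> G = B * (1 - B) / \<delta>\<^sup>2"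
  shows "- (m1 / \<delta>\<^sup>2) * a * B + (a *\<^sub>R G) \<bullet> ((m1 - m) *\<^sub>R G) = - ((m + (m1 - m) * B) / \<delta>\<^sup>2) * (a * B)"
    and "- (m / \<delta>\<^sup>2) * b * (1 - B) + (- (b *\<^sub>R G)) \<bullet> ((m1 - m) *\<^sub>R G) = - ((m + (m1 - m) * B) / \<delta>\<^sup>2) * (b * (1 - B))"
proof -
  have \<delta>2: "\<delta>\<^sup>2 \<noteq> 0" using \<delta> by simp
  have "- (m1 / \<delta>\<^sup>2) * a * B + (a *\<^sub>R G) \<bullet> ((m1 - m) *\<^sub>R G) = - (m1 * a * B - a * (m1 - m) * (B * (1 - B))) / \<delta>\<^sup>2"
    unfolding inner_scaleR_left inner_scaleR_right G using \<delta>2 by (simp add: field_simps)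
  also have "m1 * a * B - a * (m1 - m) * (B * (1 - B)) = (m + (m1 - m) * B) * (a * B)" by (simp add: algebra_simps)
  finally show "- (m1 / \<delta>\<^sup>2) * a * B + (a *\<^sub>R G) \<bullet> ((m1 - m) *\<^sub>R G) = - ((m + (m1 - m) * B) / \<delta>\<^sup>2) * (a * B)" by simp
  have "- (m / \<delta>\<^sup>2) * b * (1 - B) + (- (b *\<^sub>R G)) \<bullet> ((m1 - m) *\<^sub>R G) = - (m * b * (1 - B) + b * (m1 - m) * (B * (1 - B))) / \<delta>\<^sup>2"
    unfolding inner_minus_left inner_scaleR_left inner_scaleR_right G using \<delta>2 by (simp add: field_simps)
  also have "m * b * (1 - B) + b * (m1 - m) * (B * (1 - B)) = (m + (m1 - m) * B) * (b * (1 - B))" by (simp add: algebra_simps)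
  finally show "- (m / \<delta>\<^sup>2) * b * (1 - B) + (- (b *\<^sub>R G)) \<bullet> ((m1 - m) *\<^sub>R G) = - ((m + (m1 - m) * B) / \<delta>\<^sup>2) * (b * (1 - B))" by simp
qed

lemma (in separated_pairs) segments_disjoint:
  assumes ij: "i \<in> I" "j \<in> I" "i \<noteq> j"
    and y: "y \<in> closed_segment (x0 i) (x1 i)" and z: "z \<in> closed_segment (x0 j) (x1 j)"
  shows "y \<noteq> z"
proof
  assume yz: "y = z"
  have "norm (y - x0 i) < pi * \<delta>" "norm (z - x0 j) < pi * \<delta>"
    using segment_bound1[OF y] segment_bound1[OF z] near[OF ij(1)] near[OF ij(2)] by (simp_all add: norm_minus_commute)
  moreover have "norm (x0 i - x0 j) \<le> norm (y - x0 i) + norm (z - x0 j)"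
    using norm_triangle_ineq4[of "z - x0 j" "y - x0 i"] yz by simp
  moreover have "4 * pi * \<delta> < norm (x0 i - x0 j)" using far[OF ij] by simp
  moreover have "0 < pi * \<delta>" using \<delta> by simp
  ultimately show False by linarith
qed

locale positive_pairs = separated_pairs +
  assumes pos: "\<And>i. i \<in> I \<Longrightarrow> 0 < h0 i" "\<And>i. i \<in> I \<Longrightarrow> 0 < h1 i"
begin

abbreviation cen where "cen k i \<equiv> centre \<delta> (h0 i) (x0 i) (h1 i) (x1 i) k"
abbreviation rad where "rad k i \<equiv> radial_factor \<delta> (h0 i) (x0 i) (h1 i) (x1 i) k"
abbreviation mass where "mass i \<equiv> dirac_mass \<delta> (h0 i) (x0 i) (h1 i) (x1 i)"
definition \<gamma> where "\<gamma> i = dirac_position \<delta> (h0 i) (x0 i) (h1 i) (x1 i)"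
abbreviation X where "X \<equiv> {0..1::real} \<times> closure \<Omega>"
abbreviation pot where "pot k \<equiv> cert \<delta> I k (rad k) (cen k)"
abbreviation vel where "vel k \<equiv> cert_x \<delta> I k (rad k) (cen k)"
definition V where "V = (\<Sum>i\<in>I. pair_cost \<delta> (h0 i) (x0 i) (h1 i) (x1 i))"

lemma pair: "threshold < k \<Longrightarrow> i \<in> I \<Longrightarrow> dirac_pair \<delta> (h0 i) (h1 i) (x0 i) (x1 i) k"
  by (rule dirac_pair_threshold) (use pos in auto)

lemma k_pos: "threshold < k \<Longrightarrow> 0 < k" using threshold_nonneg by linarith

lemma rad_bounds: "threshold < k \<Longrightarrow> i \<in> I \<Longrightarrow> 0 < rad k i \<and> rad k i < k"
  using dirac_pair.\<kappa>_pos[OF pair] dirac_pair.\<kappa>_less[OF pair] by blast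

lemma centred_cen: "threshold < k \<Longrightarrow> centred (cen k)"
  unfolding centred_def using dirac_pair.centre_near[OF pair] by blast

lemma C1_pot:
  assumes k: "threshold < k"
  shows "C1_with_derivs X (pot k) (cert_t \<delta> I k (rad k) (cen k)) (vel k)"
  by (rule C1_cert[OF \<delta> k_pos[OF k]]) (use rad_bounds[OF k] in blast)

lemma V_eq:
  assumes k: "threshold < k"
  shows "V = signed_integral (closure \<Omega>) \<rho>1 (\<lambda>x. pot k (1, x)) - signed_integral (closure \<Omega>) \<rho>0 (\<lambda>x. pot k (0, x))"
proof -
  have "signed_integral (closure \<Omega>) \<rho>1 (\<lambda>x. pot k (1, x)) - signed_integral (closure \<Omega>) \<rho>0 (\<lambda>x. pot k (0, x)) =
    (\<Sum>i\<in>I. pair_bound \<delta> k (rad k i) (cen k i) (h0 i) (x0 i) (h1 i) (x1 i))"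
    by (rule centred_boundary[OF centred_cen[OF k] k_pos[OF k]]) (use rad_bounds[OF k] in blast)
  also have "\<dots> = V"
    unfolding V_def pair_bound_def by (intro sum.cong refl dirac_pair.pair_value[OF pair[OF k]])
  finally show ?thesis by simp
qed

lemma V_nonneg: "0 \<le> V" unfolding V_def by (intro sum_nonneg pair_cost_nonneg h)

lemma \<gamma>_path: "i \<in> I \<Longrightarrow> dirac_path \<delta> (h0 i) (x0 i) (h1 i) (x1 i) (\<gamma> i) (mass i)
     (dirac_momentum \<delta> (h0 i) (x0 i) (h1 i) (x1 i))
     (dirac_growth \<delta> (h0 i) (x0 i) (h1 i) (x1 i))"
  unfolding \<gamma>_def by (rule dirac_path_positive[OF \<delta> pos near])

lemma \<gamma>_segment: "i \<in> I \<Longrightarrow> t \<in> {0..1} \<Longrightarrow> \<gamma> i t \<in> closed_segment (x0 i) (x1 i)"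
  using \<gamma>_path unfolding dirac_path_def by blast

lemma continuous_\<gamma>: "i \<in> I \<Longrightarrow> continuous_on {0..1} (\<gamma> i)"
  using \<gamma>_path unfolding dirac_path_def continuous_on_eq_continuous_within
  by (blast intro: has_vector_derivative_continuous)

lemma \<gamma>_disjoint: "i \<in> I \<Longrightarrow> j \<in> I \<Longrightarrow> i \<noteq> j \<Longrightarrow> t \<in> {0..1} \<Longrightarrow> \<gamma> i t \<noteq> \<gamma> j t"
  using segments_disjoint \<gamma>_segment by blast

lemma \<gamma>_position: "threshold < k \<Longrightarrow> i \<in> I \<Longrightarrow> t \<in> {0..1} \<Longrightarrow>
    \<gamma> i t = dirac_pair.position \<delta> (h0 i) (h1 i) (x0 i) (x1 i) k t"
  unfolding \<gamma>_def by (rule dirac_pair.dirac_position_eq[OF pair])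

lemma \<gamma>_ends: assumes "i \<in> I" shows "\<gamma> i 0 = x0 i" "\<gamma> i 1 = x1 i"
  using \<gamma>_path[OF assms] pos[OF assms] unfolding dirac_path_def by auto

lemma mass_pos: "i \<in> I \<Longrightarrow> t \<in> {0..1} \<Longrightarrow> 0 < mass i t"
  using dirac_pair.mass_pos[OF pair[of "threshold + 1"]] by simp

sublocale D: disjoint_curves I \<gamma>
  by unfold_locales (use I continuous_\<gamma> \<gamma>_disjoint in auto)

lemma bump_other:
  assumes k: "threshold < k" and ij: "i \<in> I" "j \<in> I" "i \<noteq> j" and y: "y \<in> closed_segment (x0 j) (x1 j)"
  shows "bump \<delta> (cen k i) y = 0"
proof (rule bump_outside(1)[OF \<delta>])
  have "norm (y - x0 j) < pi * \<delta>"
    using segment_bound1[OF y] near[OF ij(2)] by (simp add: norm_minus_commute)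
  moreover have "norm (cen k i - x0 i) < pi * \<delta>" by (rule dirac_pair.centre_near[OF pair[OF k ij(1)]])
  moreover have "norm (x0 i - x0 j) \<le> norm (cen k i - x0 i) + norm (y - cen k i) + norm (y - x0 j)"
    using norm_triangle_ineq[of "x0 i - cen k i" "cen k i - y"] norm_triangle_ineq[of "x0 i - y" "y - x0 j"]
    by (simp add: norm_minus_commute)
  moreover have "4 * pi * \<delta> < norm (x0 i - x0 j)" using far[OF ij] by simp
  moreover have "0 < pi * \<delta>" using \<delta> by simp
  ultimately show "pi * \<delta> \<le> norm (y - cen k i)" by linarith
qed

end

locale minimizer = positive_pairs +
  fixes \<rho> \<omega> \<zeta> M r w z
  assumes ce: "(\<rho>, \<omega>, \<zeta>) \<in> CE \<Omega> \<rho>0 \<rho>1" and opt: "action \<delta> \<Omega> (\<rho>, \<omega>, \<zeta>) = ennreal V"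
    and td: "triple_density X M r w z (\<rho>, \<omega>, \<zeta>)"
begin

lemma sM: "sets M = sets borel" and M_finite: "finite_measure M" and M_null: "emeasure M (- X) = 0"
  and densities: "has_density \<rho> M r" "has_density \<omega> M w" "has_density \<zeta> M z"
  using td unfolding triple_density_def by simp_all

lemma ri: "integrable M r" by (rule has_density_integrable[OF densities(1)])

lemma X_compact: "compact X" using \<Omega> by (intro compact_Times compact_Icc) (simp_all add: compact_closure)

lemma AE_X: "AE p in M. p \<in> X"
proof (rule AE_I')
  show "- X \<in> null_sets M" using M_null sM borel_comp[OF borel_compact[OF X_compact]] by (simp add: null_sets_def)
qed auto

lemma optimality:
  assumes k: "threshold < k"
  shows "AE p in M. p \<in> X \<longrightarrow> 0 \<le> r p \<and> w p = r p *\<^sub>R vel k p \<and> z p = r p * pot k p / \<delta>\<^sup>2"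
  by (rule action_optimal[OF ce \<Omega> \<delta> td C1_pot[OF k] centred_HJ[OF centred_cen[OF k]] opt V_nonneg V_eq[OF k]])

lemma r_nonneg: "AE p in M. 0 \<le> r p"
proof -
  have "threshold < threshold + 1" by simp
  from optimality[OF this] AE_X show ?thesis by eventually_elim blast
qed

text \<open>By optimality the momentum and the source are \<open>\<nabla>\<phi>_k\<close> and \<open>\<phi>_k/\<delta>^2\<close> times \<open>\<rho>\<close>, which turns the continuity
equation into a linear equation for \<open>\<rho>\<close> alone.\<close>

lemma transport_identity:
  assumes k: "threshold < k" and C1: "C1_with_derivs X \<psi> \<psi>t \<psi>x"
  defines "F \<equiv> \<lambda>p. \<psi>t p + \<psi>x p \<bullet> vel k p + \<psi> p * pot k p / \<delta>\<^sup>2"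
  shows "integrable M (\<lambda>p. (indicator X p *\<^sub>R F p) * r p)"
    and "(LINT p|M. (indicator X p *\<^sub>R F p) * r p) = (\<Sum>i\<in>I. h1 i * \<psi> (1, x1 i) - h0 i * \<psi> (0, x0 i))"
proof -
  have c: "continuous_on X \<psi>t" "continuous_on X \<psi>x" "continuous_on X \<psi>"
    "continuous_on X (vel k)" "continuous_on X (pot k)"
    using C1 C1_continuous_on[OF C1] C1_pot[OF k] C1_continuous_on[OF C1_pot[OF k]]
    unfolding C1_with_derivs_def by simp_all
  have Fc: "continuous_on X F" unfolding F_def using \<delta> by (intro continuous_intros c) auto
  show I1: "integrable M (\<lambda>p. (indicator X p *\<^sub>R F p) * r p)"
    by (rule set_integrable_continuous_mult[OF ri sM X_compact borel_compact[OF X_compact] Fc])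
  note P = CE_pairing[OF ce \<Omega> td C1]
  have "(LINT p|M. (indicator X p *\<^sub>R F p) * r p) = (LINT p|M. indicator X p *\<^sub>R (\<psi>t p * r p + \<psi>x p \<bullet> w p + \<psi> p * z p))"
  proof (rule integral_cong_AE)
    show "(\<lambda>p. (indicator X p *\<^sub>R F p) * r p) \<in> borel_measurable M" using I1 by (rule borel_measurable_integrable)
    show "(\<lambda>p. indicator X p *\<^sub>R (\<psi>t p * r p + \<psi>x p \<bullet> w p + \<psi> p * z p)) \<in> borel_measurable M"
      using P(1) unfolding set_integrable_def by (rule borel_measurable_integrable)
    show "AE p in M. (indicator X p *\<^sub>R F p) * r p = indicator X p *\<^sub>R (\<psi>t p * r p + \<psi>x p \<bullet> w p + \<psi> p * z p)"
      using optimality[OF k]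
    proof eventually_elim
      case (elim p)
      show ?case
      proof (cases "p \<in> X")
        case True
        then have "w p = r p *\<^sub>R vel k p" "z p = r p * pot k p / \<delta>\<^sup>2" using elim by blast+
        then show ?thesis unfolding F_def by (simp add: algebra_simps)
      qed simp
    qed
  qed
  also have "\<dots> = (\<Sum>i\<in>I. h1 i * \<psi> (1, x1 i) - h0 i * \<psi> (0, x0 i))"
    using P(2) unfolding set_lebesgue_integral_def boundary_terms[OF C1] .
  finally show "(LINT p|M. (indicator X p *\<^sub>R F p) * r p) = (\<Sum>i\<in>I. h1 i * \<psi> (1, x1 i) - h0 i * \<psi> (0, x0 i))" .
qed

text \<open>All optimal potentials agree where \<open>\<rho>\<close> has mass. Outside the balls for \<open>k'\<close> the potential for \<open>k'\<close> is
\<open>stiff \<delta> k'\<close>, strictly above every value of a potential with a smaller \<open>k\<close>.\<close>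

lemma inside_some_ball:
  assumes k': "threshold < k'"
  shows "AE p in M. p \<in> X \<longrightarrow> r p \<noteq> 0 \<longrightarrow> (\<exists>i\<in>I. bump \<delta> (cen k' i) (snd p) \<noteq> 0)"
proof -
  (* any admissible value below k' *)
  define k where "k = (threshold + k') / 2"
  have k: "threshold < k" "k < k'" unfolding k_def using k' by (simp_all add: field_simps)
  show ?thesis
    using optimality[OF k(1)] optimality[OF k']
  proof eventually_elim
    case (elim p)
    show ?case
    proof (intro impI, rule ccontr)
      assume p: "p \<in> X" and rp: "r p \<noteq> 0" and n: "\<not> (\<exists>i\<in>I. bump \<delta> (cen k' i) (snd p) \<noteq> 0)"
      obtain t y where ty: "p = (t, y)" "t \<in> {0..1}" using p by (cases p) auto
      have "z p = r p * pot k p / \<delta>\<^sup>2" "z p = r p * pot k' p / \<delta>\<^sup>2"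
        using mp[OF elim(1) p] mp[OF elim(2) p] by simp_all
      then have "r p * pot k p / \<delta>\<^sup>2 = r p * pot k' p / \<delta>\<^sup>2" by (rule trans[OF sym])
      then have "pot k p = pot k' p" using rp \<delta> by simp
      moreover have "pot k' p = stiff \<delta> k' t"
      proof -
        have "bump \<delta> (cen k' i) y = 0" if "i \<in> I" for i using n that ty(1) by simp
        then show ?thesis unfolding ty(1) by (rule cert_outside)
      qed
      moreover have "pot k p \<le> stiff \<delta> k t" unfolding ty by (rule cert_le_stiff[OF \<delta> ty(2) rad_bounds[OF k(1)]])
      moreover have "stiff \<delta> k t < stiff \<delta> k' t" by (rule stiff_strict_mono[OF k_pos[OF k(1)] k(2) ty(2) \<delta>])
      ultimately show False by linarith
    qed
  qed
qed

text \<open>The two invariants of the flow about the centre of the \<open>i\<close>-th pair, and their derivatives. The weight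
is supported in the \<open>i\<close>-th ball, the coweight is an invariant only there.\<close>

definition weight where "weight k i q = 1 / (stretch (rad k i) (fst q))\<^sup>2 * bump \<delta> (cen k i) (snd q)"
definition coweight where "coweight k i q = 1 / (stretch k (fst q))\<^sup>2 * (1 - bump \<delta> (cen k i) (snd q))"
definition weight_t where "weight_t k i q = - (stiff \<delta> (rad k i) (fst q) / \<delta>\<^sup>2) * (1 / (stretch (rad k i) (fst q))\<^sup>2) * bump \<delta> (cen k i) (snd q)"
definition weight_x where "weight_x k i q = (1 / (stretch (rad k i) (fst q))\<^sup>2) *\<^sub>R bump_grad \<delta> (cen k i) (snd q)"
definition coweight_t where "coweight_t k i q = - (stiff \<delta> k (fst q) / \<delta>\<^sup>2) * (1 / (stretch k (fst q))\<^sup>2) * (1 - bump \<delta> (cen k i) (snd q))"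
definition coweight_x where "coweight_x k i q = - ((1 / (stretch k (fst q))\<^sup>2) *\<^sub>R bump_grad \<delta> (cen k i) (snd q))"

lemma weight_C1: "threshold < k \<Longrightarrow> i \<in> I \<Longrightarrow> C1_with_derivs X (weight k i) (weight_t k i) (weight_x k i)"
  unfolding weight_def weight_t_def weight_x_def using rad_bounds by (intro C1_weight \<delta>) blast

lemma coweight_C1: "threshold < k \<Longrightarrow> C1_with_derivs X (coweight k i) (coweight_t k i) (coweight_x k i)"
  unfolding coweight_def coweight_t_def coweight_x_def by (intro C1_coweight \<delta> k_pos)

lemma weight_zero: "bump \<delta> (cen k i) (snd q) = 0 \<Longrightarrow> weight k i q = 0" unfolding weight_def by simp

text \<open>In the second identity the factor \<open>weight\<close> restricts attention to the \<open>i\<close>-th ball.\<close>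

lemma weights_transport:
  assumes k: "threshold < k" and i: "i \<in> I"
  shows "weight_t k i q + weight_x k i q \<bullet> vel k q = - (pot k q / \<delta>\<^sup>2) * weight k i q"
    and "weight k i q * (coweight_t k i q + coweight_x k i q \<bullet> vel k q) = weight k i q * (- (pot k q / \<delta>\<^sup>2) * coweight k i q)"
proof -
  obtain t y where q: "q = (t, y)" by (cases q)
  obtain j where j: "j \<in> I" "\<forall>l\<in>I - {j}. bump \<delta> (cen k l) y = 0 \<and> bump_grad \<delta> (cen k l) y = 0"
    using bumps_single[where c = "cen k" and x = y, OF \<delta> I(2)] centred_separated[OF centred_cen[OF k] centred_cen[OF k]]
    by blast
  have "(weight_t k i q + weight_x k i q \<bullet> vel k q = - (pot k q / \<delta>\<^sup>2) * weight k i q) \<and>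
     (weight k i q * (coweight_t k i q + coweight_x k i q \<bullet> vel k q) = weight k i q * (- (pot k q / \<delta>\<^sup>2) * coweight k i q))"
  proof (cases "i = j")
    case True
    note e = cert_single[OF I(1) j, of k "rad k" t, folded True]
    note T = weight_transport[OF \<delta> bump_grad_inner[OF \<delta>]]
    show ?thesis
      unfolding q weight_def weight_t_def weight_x_def coweight_def coweight_t_def coweight_x_def fst_conv snd_conv e(1,3)
      by (intro conjI arg_cong2[where f = "(*)"] refl T)
  next
    case False
    then have "bump \<delta> (cen k i) y = 0" "bump_grad \<delta> (cen k i) y = 0" using j i by auto
    then show ?thesis unfolding q weight_def weight_t_def weight_x_def by simp
  qed
  then show "weight_t k i q + weight_x k i q \<bullet> vel k q = - (pot k q / \<delta>\<^sup>2) * weight k i q"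
    and "weight k i q * (coweight_t k i q + coweight_x k i q \<bullet> vel k q) = weight k i q * (- (pot k q / \<delta>\<^sup>2) * coweight k i q)" by blast+
qed

abbreviation pp where "pp k i \<equiv> dirac_pair.p \<delta> (h0 i) (h1 i) (x0 i) (x1 i) k"
abbreviation qq where "qq k i \<equiv> dirac_pair.q \<delta> (h0 i) (h1 i) (x0 i) (x1 i) k"

lemma weight_on_curve:
  assumes k: "threshold < k" and i: "i \<in> I" and t: "t \<in> {0..1}"
  shows "weight k i (t, \<gamma> i t) = (pp k i)\<^sup>2 / mass i t" "coweight k i (t, \<gamma> i t) = (qq k i)\<^sup>2 / mass i t"
  unfolding weight_def coweight_def fst_conv snd_conv \<gamma>_position[OF k i t]
  using dirac_pair.weight_position[OF pair[OF k i] t] dirac_pair.coweight_position[OF pair[OF k i] t] by blast+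

lemma weight_other_curve:
  assumes k: "threshold < k" and ij: "i \<in> I" "j \<in> I" "i \<noteq> j" and t: "t \<in> {0..1}"
  shows "weight k i (t, \<gamma> j t) = 0"
  by (rule weight_zero) (simp add: bump_other[OF k ij \<gamma>_segment[OF ij(2) t]])

text \<open>The invariant \<open>R = p\<^sup>2 coweight - q\<^sup>2 weight\<close> vanishes exactly on the sphere through the moving point. The
test function \<open>\<Psi> = exp (L t) weight R\<^sup>2\<close> is zero at all end points, while the left-hand side of its
transport equation is \<open>(L - 2\<phi>/\<delta>\<^sup>2) \<Psi> \<ge> \<Psi>\<close> for large \<open>L\<close>. Hence \<open>\<Psi> = 0\<close> where \<open>\<rho>\<close> has mass.\<close>

lemma on_sphere_AE:
  assumes k: "threshold < k" and i: "i \<in> I"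
  shows "AE p in M. p \<in> X \<longrightarrow> r p \<noteq> 0 \<longrightarrow> weight k i p = 0 \<or> (pp k i)\<^sup>2 * coweight k i p - (qq k i)\<^sup>2 * weight k i p = 0"
proof -
  let ?g = "\<lambda>p. pot k p / \<delta>\<^sup>2"
  let ?a = "(pp k i)\<^sup>2" and ?b = "- (qq k i)\<^sup>2"
  define R where "R p = ?a * coweight k i p + ?b * weight k i p" for p
  define Rt where "Rt p = ?a * coweight_t k i p + ?b * weight_t k i p" for p
  define Rx where "Rx p = ?a *\<^sub>R coweight_x k i p + ?b *\<^sub>R weight_x k i p" for p
  have RC: "C1_with_derivs X R Rt Rx"
    by (rule C1_cong[OF C1_add[OF C1_mult[OF C1_const[of _ ?a] coweight_C1[OF k, of i]] C1_mult[OF C1_const[of _ ?b] weight_C1[OF k i]]]])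
       (simp_all add: R_def Rt_def Rx_def fun_eq_iff)
  have gc: "continuous_on X ?g"
    using \<delta> by (intro continuous_intros C1_continuous_on[OF C1_pot[OF k]]) auto
  obtain C where C: "\<And>p. p \<in> X \<Longrightarrow> \<bar>?g p\<bar> \<le> C"
    using compact_imp_bounded[OF compact_continuous_image[OF gc X_compact]] unfolding bounded_iff real_norm_def by (meson imageI)
  (* large enough that L - 2 phi/delta^2 is at least 1 on X *)
  define L where "L = 2 * C + 1"
  define E where "E p = exp (L * fst p)" for p :: "real \<times> 'a"
  have EC: "C1_with_derivs X E (\<lambda>p. L * E p) (\<lambda>p. 0)"
    unfolding E_def by (rule C1_time) (auto intro!: derivative_eq_intros continuous_intros)
  note PR = C1_mult[OF weight_C1[OF k i] RC]
  note RE = C1_mult[OF RC EC]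
  note \<Psi> = C1_mult[OF PR RE]
  define \<Psi> where "\<Psi> p = weight k i p * R p * (R p * E p)" for p
  have E0: "0 < E p" for p unfolding E_def by simp
  have P0: "0 \<le> weight k i p" for p unfolding weight_def by (intro mult_nonneg_nonneg bump_nonneg) simp
  have \<Psi>0: "0 \<le> \<Psi> p" for p
  proof -
    have "\<Psi> p = weight k i p * (R p)\<^sup>2 * E p" unfolding \<Psi>_def by (simp add: power2_eq_square)
    then show ?thesis using P0 E0[of p] by simp
  qed
  have R0: "R (t, \<gamma> i t) = 0" if "t \<in> {0..1}" for t
    unfolding R_def weight_on_curve[OF k i that] by simp
  have zero: "\<Psi> (t, \<gamma> j t) = 0" if "j \<in> I" "t \<in> {0..1}" for j t
    using R0[OF that(2)] weight_other_curve[OF k i that(1) _ that(2)] unfolding \<Psi>_def by (cases "i = j") auto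
  let ?F = "\<lambda>p. (weight k i p * R p * (R p * (L * E p) + Rt p * E p) + (weight k i p * Rt p + weight_t k i p * R p) * (R p * E p)) +
     ((weight k i p * R p) *\<^sub>R (R p *\<^sub>R 0 + E p *\<^sub>R Rx p) + (R p * E p) *\<^sub>R (weight k i p *\<^sub>R Rx p + R p *\<^sub>R weight_x k i p)) \<bullet> vel k p +
     (weight k i p * R p * (R p * E p)) * pot k p / \<delta>\<^sup>2"
  have F: "?F p = (L - 2 * ?g p) * \<Psi> p" for p
  proof -
    define DP where "DP = weight_t k i p + weight_x k i p \<bullet> vel k p"
    define DR where "DR = Rt p + Rx p \<bullet> vel k p"
    have DP: "DP = - ?g p * weight k i p" unfolding DP_def by (rule weights_transport(1)[OF k i])
    have "weight k i p * DR = ?a * (weight k i p * (coweight_t k i p + coweight_x k i p \<bullet> vel k p)) + ?b * (weight k i p * DP)"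
      unfolding DR_def DP_def Rt_def Rx_def by (simp add: inner_add_left algebra_simps)
    also have "\<dots> = - ?g p * (weight k i p * R p)"
      unfolding weights_transport(2)[OF k i] DP R_def by (simp add: algebra_simps)
    finally have DR: "weight k i p * DR = - ?g p * (weight k i p * R p)" .
    have "?F p = L * \<Psi> p + 2 * (weight k i p * DR) * R p * E p + DP * (R p)\<^sup>2 * E p + ?g p * \<Psi> p"
      unfolding \<Psi>_def DP_def DR_def by (simp add: inner_add_left algebra_simps power2_eq_square)
    also have "\<dots> = (L - 2 * ?g p) * \<Psi> p"
      unfolding DR DP \<Psi>_def by (simp add: algebra_simps power2_eq_square)
    finally show ?thesis .
  qed
  have Li: "integrable M (\<lambda>p. (indicator X p *\<^sub>R ?F p) * r p)" by (rule transport_identity(1)[OF k \<Psi>])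
  have "(LINT p|M. (indicator X p *\<^sub>R ?F p) * r p) =
     (\<Sum>j\<in>I. h1 j * (weight k i (1, x1 j) * R (1, x1 j) * (R (1, x1 j) * E (1, x1 j))) -
        h0 j * (weight k i (0, x0 j) * R (0, x0 j) * (R (0, x0 j) * E (0, x0 j))))"
    by (rule transport_identity(2)[OF k \<Psi>])
  also have "\<dots> = (\<Sum>j\<in>I. 0)"
  proof (rule sum.cong[OF refl])
    fix j assume j: "j \<in> I"
    have z: "\<Psi> (1, x1 j) = 0" "\<Psi> (0, x0 j) = 0" using zero[OF j, of 1] zero[OF j, of 0] \<gamma>_ends[OF j] by simp_all
    show "h1 j * (weight k i (1, x1 j) * R (1, x1 j) * (R (1, x1 j) * E (1, x1 j))) -
        h0 j * (weight k i (0, x0 j) * R (0, x0 j) * (R (0, x0 j) * E (0, x0 j))) = 0"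
      unfolding z[unfolded \<Psi>_def] by simp
  qed
  finally have L0: "(LINT p|M. (indicator X p *\<^sub>R ?F p) * r p) = 0" by simp
  have "AE p in M. (indicator X p *\<^sub>R ?F p) * r p = 0"
  proof (subst integral_nonneg_eq_0_iff_AE[symmetric, OF Li])
    show "AE p in M. 0 \<le> (indicator X p *\<^sub>R ?F p) * r p"
      using r_nonneg
    proof eventually_elim
      case (elim p)
      show ?case
      proof (cases "p \<in> X")
        case True
        have "?g p \<le> C" by (rule order_trans[OF abs_ge_self C[OF True]])
        moreover have "0 \<le> C" by (rule order_trans[OF abs_ge_zero C[OF True]])
        ultimately have "0 \<le> L - 2 * ?g p" unfolding L_def by linarith
        then show ?thesis unfolding F using \<Psi>0[of p] elim True by simp
      qed simp
    qed
  qed (rule L0)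
  then show ?thesis
  proof eventually_elim
    case (elim p)
    show ?case
    proof (intro impI)
      assume p: "p \<in> X" and rp: "r p \<noteq> 0"
      have "?g p \<le> C" by (rule order_trans[OF abs_ge_self C[OF p]])
      then have "0 < L - 2 * ?g p" unfolding L_def by linarith
      moreover have "(L - 2 * ?g p) * \<Psi> p = 0" using elim p rp unfolding F by simp
      ultimately have "\<Psi> p = 0" by simp
      then show "weight k i p = 0 \<or> (pp k i)\<^sup>2 * coweight k i p - (qq k i)\<^sup>2 * weight k i p = 0"
        unfolding \<Psi>_def R_def using E0[of p] by auto
    qed
  qed
qed

end

context minimizer begin

lemma on_some_sphere:
  assumes k: "threshold < k"
  shows "AE p in M. p \<in> X \<longrightarrow> r p \<noteq> 0 \<longrightarrow> (\<exists>i\<in>I. norm (snd p - cen k i) < pi * \<delta> \<and>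
     norm (snd p - cen k i) = norm (\<gamma> i (fst p) - cen k i))"
proof -
  have "AE p in M. \<forall>i\<in>I. p \<in> X \<longrightarrow> r p \<noteq> 0 \<longrightarrow> weight k i p = 0 \<or> (pp k i)\<^sup>2 * coweight k i p - (qq k i)\<^sup>2 * weight k i p = 0"
    by (rule AE_finite_allI[OF I(1) on_sphere_AE[OF k]])
  then show ?thesis using inside_some_ball[OF k]
  proof eventually_elim
    case (elim p)
    show ?case
    proof (intro impI)
      assume p: "p \<in> X" and rp: "r p \<noteq> 0"
      obtain t y where ty: "p = (t, y)" "t \<in> {0..1}" using p by (cases p) auto
      obtain i where i: "i \<in> I" "bump \<delta> (cen k i) (snd p) \<noteq> 0" using elim(2) p rp by blast
      interpret A: dirac_pair \<delta> "h0 i" "h1 i" "x0 i" "x1 i" k by (rule pair[OF k i(1)])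
      have "0 < stretch (rad k i) t" using stretch_pos[OF _ ty(2)] rad_bounds[OF k i(1)] by blast
      then have "weight k i p \<noteq> 0" using i(2) unfolding weight_def ty(1) by simp
      then have eq: "(pp k i)\<^sup>2 * coweight k i p = (qq k i)\<^sup>2 * weight k i p" using elim(1) i(1) p rp by auto
      have ball: "norm (y - cen k i) < pi * \<delta>"
        using i(2) bump_outside(1)[OF \<delta>, of y "cen k i"] ty(1) by (simp add: not_less[symmetric]) blast
      have "norm (y - cen k i) = 2 * \<delta> * A.angle t"
        by (rule A.on_sphere[OF ty(2) ball]) (use eq in \<open>simp only: weight_def coweight_def ty(1) fst_conv snd_conv\<close>)
      then have "norm (snd p - cen k i) = norm (\<gamma> i (fst p) - cen k i)"
        unfolding ty(1) fst_conv snd_conv \<gamma>_position[OF k i(1) ty(2)] A.norm_position_centre[OF ty(2)] .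
      then show "\<exists>i\<in>I. norm (snd p - cen k i) < pi * \<delta> \<and> norm (snd p - cen k i) = norm (\<gamma> i (fst p) - cen k i)"
        using i(1) ball ty(1) by (intro bexI[of _ i]) simp_all
    qed
  qed
qed

text \<open>Two values of \<open>k\<close> suffice. The two spheres through a given point belong to the same pair, because centres
of different pairs are at least \<open>2\<pi>\<delta>\<close> apart even for different \<open>k\<close>.\<close>

lemma concentrated_on_curves: "AE p in M. p \<in> X \<and> (r p \<noteq> 0 \<longrightarrow> (\<exists>i\<in>I. p \<in> D.graph i))"
proof -
  define k k' where "k = threshold + 1" and "k' = threshold + 2"
  have k: "threshold < k" "threshold < k'" "k < k'" unfolding k_def k'_def by simp_all
  show ?thesis
    using on_some_sphere[OF k(1)] on_some_sphere[OF k(2)] AE_X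
  proof eventually_elim
    case (elim p)
    show ?case
    proof (intro conjI impI)
      show p: "p \<in> X" by (rule elim(3))
      assume rp: "r p \<noteq> 0"
      have t: "fst p \<in> {0..1}" using p by (cases p) auto
      obtain i where i: "i \<in> I" "norm (snd p - cen k i) < pi * \<delta>"
        "norm (snd p - cen k i) = norm (\<gamma> i (fst p) - cen k i)" using mp[OF mp[OF elim(1) p] rp] by (elim bexE conjE)
      obtain j where j: "j \<in> I" "norm (snd p - cen k' j) < pi * \<delta>"
        "norm (snd p - cen k' j) = norm (\<gamma> j (fst p) - cen k' j)" using mp[OF mp[OF elim(2) p] rp] by (elim bexE conjE)
      have "i = j"
      proof (rule ccontr)
        assume "i \<noteq> j"
        from centred_separated[OF centred_cen[OF k(1)] centred_cen[OF k(2)] i(1) j(1) this]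
        have "2 * pi * \<delta> \<le> norm (cen k i - cen k' j)" .
        moreover have "norm (cen k i - cen k' j) \<le> norm (snd p - cen k i) + norm (snd p - cen k' j)"
          using norm_triangle_ineq4[of "snd p - cen k' j" "snd p - cen k i"] by simp
        ultimately show False using i(2) j(2) by linarith
      qed
      then have "snd p = \<gamma> i (fst p)"
        using spheres_tangent[OF pair[OF k(1) i(1)] pair[OF k(2) i(1)] k(3) t] i(3) j(3) unfolding \<gamma>_def by simp
      then show "\<exists>i\<in>I. p \<in> D.graph i" unfolding D.graph_def using i(1) t by blast
    qed
  qed
qed

text \<open>The part of \<open>\<rho>\<close> on the \<open>i\<close>-th curve, per unit of the expected mass.\<close>

definition dens where "dens i p = (indicator (D.graph i) p *\<^sub>R (1 / mass i (fst p))) * r p"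

lemma compact_graph: assumes i: "i \<in> I" shows "compact (D.graph i)"
proof -
  have "D.graph i = (\<lambda>t. (t, \<gamma> i t)) ` {0..1}" unfolding D.graph_def by (auto simp: image_iff)
  then show ?thesis
    using compact_continuous_image[of "{0..1}" "\<lambda>t. (t, \<gamma> i t)"] continuous_\<gamma>[OF i]
    by (simp add: continuous_on_Pair)
qed

lemma continuous_mass: "continuous_on S (mass i)"
  by (rule DERIV_continuous_on[OF dirac_mass_has_derivative])

lemma integrable_dens_mult:
  assumes i: "i \<in> I" and f: "continuous_on {0..1} f"
  shows "integrable M (\<lambda>p. dens i p * f (fst p))"
proof -
  have "continuous_on (D.graph i) (\<lambda>p. f (fst p) / mass i (fst p))"
  proof (intro continuous_on_divide)
    show "continuous_on (D.graph i) (\<lambda>p. f (fst p))"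
      by (rule continuous_on_compose2[OF f]) (auto intro: continuous_intros simp: D.graph_def)
    show "continuous_on (D.graph i) (\<lambda>p. mass i (fst p))"
      by (rule continuous_on_compose2[OF continuous_mass[of UNIV]]) (auto intro: continuous_intros)
    show "\<forall>p\<in>D.graph i. mass i (fst p) \<noteq> 0"
      unfolding D.graph_def using mass_pos[OF i] by force
  qed
  from set_integrable_continuous_mult[OF ri sM compact_graph[OF i] borel_compact[OF compact_graph[OF i]] this]
  show ?thesis unfolding dens_def by (simp add: mult_ac)
qed

text \<open>Testing with \<open>T(t) weight\<close>: on the \<open>i\<close>-th curve the weight is \<open>p\<^sup>2/mass\<close>, and on the other curves it is \<open>0\<close>.\<close>

lemma time_marginal:
  assumes i: "i \<in> I" and T: "\<And>t. (T has_real_derivative T' t) (at t)" and c: "continuous_on {0..1} T'"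
  shows "(LINT p|M. dens i p * T' (fst p)) = T 1 - T 0"
proof -
  define k where "k = threshold + 1"
  have k: "threshold < k" unfolding k_def by simp
  have TC: "C1_with_derivs X (\<lambda>p. T (fst p)) (\<lambda>p. T' (fst p)) (\<lambda>p. 0)"
    by (rule C1_time[OF DERIV_subset[OF T subset_UNIV] c])
  note C = C1_mult[OF TC weight_C1[OF k i]]
  let ?F = "\<lambda>p. (T (fst p) * weight_t k i p + T' (fst p) * weight k i p) + (T (fst p) *\<^sub>R weight_x k i p + weight k i p *\<^sub>R 0) \<bullet> vel k p +
     T (fst p) * weight k i p * pot k p / \<delta>\<^sup>2"
  have F: "?F p = T' (fst p) * weight k i p" for p
  proof -
    have "?F p = T' (fst p) * weight k i p + T (fst p) * (weight_t k i p + weight_x k i p \<bullet> vel k p) + T (fst p) * weight k i p * pot k p / \<delta>\<^sup>2"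
      by (simp add: algebra_simps)
    then show ?thesis unfolding weights_transport(1)[OF k i] by simp
  qed
  note I1 = transport_identity[OF k C]
  let ?p2 = "(pp k i)\<^sup>2"
  have p2: "?p2 \<noteq> 0" using dirac_pair.p_pos[OF pair[OF k i]] by simp
  have "(LINT p|M. (indicator X p *\<^sub>R ?F p) * r p) = (LINT p|M. ?p2 * (dens i p * T' (fst p)))"
  proof (rule integral_cong_AE)
    show "(\<lambda>p. (indicator X p *\<^sub>R ?F p) * r p) \<in> borel_measurable M" by (rule borel_measurable_integrable[OF I1(1)])
    show "(\<lambda>p. ?p2 * (dens i p * T' (fst p))) \<in> borel_measurable M"
      by (intro borel_measurable_times borel_measurable_const borel_measurable_integrable[OF integrable_dens_mult[OF i c]])
    show "AE p in M. (indicator X p *\<^sub>R ?F p) * r p = ?p2 * (dens i p * T' (fst p))"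
      using concentrated_on_curves
    proof eventually_elim
      case (elim p)
      show ?case
      proof (cases "r p = 0")
        case True
        then show ?thesis unfolding dens_def by simp
      next
        case False
        then obtain j where j: "j \<in> I" "p \<in> D.graph j" using elim by blast
        then have t: "fst p \<in> {0..1}" and pj: "p = (fst p, \<gamma> j (fst p))"
          unfolding D.graph_def by (auto simp: prod_eq_iff)
        show ?thesis
        proof (cases "j = i")
          case True
          have "weight k i p = ?p2 / mass i (fst p)" using weight_on_curve(1)[OF k i t] pj True by metis
          then show ?thesis unfolding F using elim j True by (simp add: dens_def)
        next
          case False
          have "weight k i p = 0" using weight_other_curve[OF k i j(1) _ t] False pj by metis
          moreover have "p \<notin> D.graph i"
          proof
            assume "p \<in> D.graph i"
            then have "\<gamma> i (fst p) = \<gamma> j (fst p)" using j(2) unfolding D.graph_def by auto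
            then show False using \<gamma>_disjoint[OF i j(1) _ t] False by blast
          qed
          ultimately show ?thesis unfolding F dens_def by simp
        qed
      qed
    qed
  qed
  also have "\<dots> = ?p2 * (LINT p|M. dens i p * T' (fst p))" by simp
  finally have e1: "(LINT p|M. (indicator X p *\<^sub>R ?F p) * r p) = ?p2 * (LINT p|M. dens i p * T' (fst p))" .
  have "(\<Sum>j\<in>I. h1 j * (T (fst (1::real, x1 j)) * weight k i (1, x1 j)) - h0 j * (T (fst (0::real, x0 j)) * weight k i (0, x0 j))) =
     h1 i * (T (fst (1::real, x1 i)) * weight k i (1, x1 i)) - h0 i * (T (fst (0::real, x0 i)) * weight k i (0, x0 i))"
  proof (rule sum_single[OF I(1) i])
    fix j assume "j \<in> I - {i}"
    then have j: "j \<in> I" "i \<noteq> j" by auto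
    have "weight k i (1, x1 j) = 0" "weight k i (0, x0 j) = 0"
      using weight_other_curve[OF k i j, of 1] weight_other_curve[OF k i j, of 0] \<gamma>_ends[OF j(1)] by simp_all
    then show "h1 j * (T (fst (1::real, x1 j)) * weight k i (1, x1 j)) - h0 j * (T (fst (0::real, x0 j)) * weight k i (0, x0 j)) = 0"
      by simp
  qed
  also have "\<dots> = ?p2 * (T 1 - T 0)"
  proof -
    have m: "mass i 0 = h0 i" "mass i 1 = h1 i" unfolding dirac_mass_def Let_def by simp_all
    have "weight k i (1, x1 i) = ?p2 / h1 i" "weight k i (0, x0 i) = ?p2 / h0 i"
      using weight_on_curve(1)[OF k i, of 1] weight_on_curve(1)[OF k i, of 0] \<gamma>_ends[OF i] m by simp_all
    then show ?thesis using pos[OF i] by (simp add: algebra_simps)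
  qed
  finally have "?p2 * (LINT p|M. dens i p * T' (fst p)) = ?p2 * (T 1 - T 0)"
    unfolding e1[symmetric] I1(2) .
  then show ?thesis using p2 by simp
qed

definition marginal where "marginal i = distr (density M (\<lambda>p. ennreal (dens i p))) (borel :: real measure) fst"

lemma dens_nonneg:
  assumes i: "i \<in> I" shows "AE p in M. 0 \<le> dens i p"
  using r_nonneg
proof eventually_elim
  case (elim p)
  show ?case
  proof (cases "p \<in> D.graph i")
    case True
    then have "0 < mass i (fst p)" unfolding D.graph_def using mass_pos[OF i] by blast
    then show ?thesis unfolding dens_def using elim True by simp
  qed (simp add: dens_def)
qed

lemma integrable_dens: assumes i: "i \<in> I" shows "integrable M (dens i)"
  using integrable_dens_mult[OF i, of "\<lambda>_. 1"] by simp

lemma fst_measurable: "fst \<in> measurable (density M f) (borel :: real measure)"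
proof -
  have "fst \<in> borel_measurable (borel :: (real \<times> 'a) measure)"
    by (intro borel_measurable_continuous_onI continuous_on_fst continuous_on_id)
  then show ?thesis using measurable_cong_sets[OF _ refl, of "density M f" borel borel] sM by simp
qed

lemma integral_marginal:
  fixes g :: "real \<Rightarrow> 'b::{banach, second_countable_topology}"
  assumes i: "i \<in> I" and g: "g \<in> borel_measurable borel"
  shows "(LINT t|marginal i. g t) = (LINT p|M. dens i p *\<^sub>R g (fst p))"
proof -
  have m: "(\<lambda>p. g (fst p)) \<in> borel_measurable M"
    using measurable_compose[OF fst_measurable[of "\<lambda>_. 1"] g] by (simp add: density_1)
  show ?thesis
    unfolding marginal_def integral_distr[OF fst_measurable g]
    by (rule integral_density[OF m borel_measurable_integrable[OF integrable_dens[OF i]] dens_nonneg[OF i]])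
qed

definition unit_time :: "real measure" where
  "unit_time = density lborel (\<lambda>t. ennreal (indicator {0..1} t))"

lemma integral_unit_time:
  fixes g :: "real \<Rightarrow> 'b::{banach, second_countable_topology}"
  assumes g: "g \<in> borel_measurable borel"
  shows "(LINT t|unit_time. g t) = (LINT t:{0..1}|lborel. g t)"
  unfolding unit_time_def set_lebesgue_integral_def
  by (rule integral_density) (use g in simp_all)

lemma real_distribution_unit_time: "real_distribution unit_time"
proof (rule real_distribution.intro)
  have "emeasure unit_time (space unit_time) = 1"
    unfolding unit_time_def by (simp add: emeasure_density ennreal_indicator)
  then show "prob_space unit_time" by (rule prob_spaceI)
  show "real_distribution_axioms unit_time" unfolding real_distribution_axioms_def unit_time_def by simp
qed

lemma real_distribution_marginal:
  assumes i: "i \<in> I" shows "real_distribution (marginal i)"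
proof (rule real_distribution.intro)
  have "(LINT p|M. dens i p * 1) = 1 - 0"
    by (rule time_marginal[OF i, of "\<lambda>t. t" "\<lambda>_. 1"]) (auto intro!: derivative_eq_intros)
  then have "(\<integral>\<^sup>+p. ennreal (dens i p) \<partial>M) = 1"
    using nn_integral_eq_integral[OF integrable_dens[OF i] dens_nonneg[OF i]] by simp
  then have "emeasure (density M (\<lambda>p. ennreal (dens i p))) (space (density M (\<lambda>p. ennreal (dens i p)))) = 1"
    using borel_measurable_integrable[OF integrable_dens[OF i]]
    by (simp add: emeasure_density cong: nn_integral_cong)
  then have "prob_space (density M (\<lambda>p. ennreal (dens i p)))" by (rule prob_spaceI)
  then show "prob_space (marginal i)" unfolding marginal_def by (rule prob_space.prob_space_distr) (rule fst_measurable)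
  show "real_distribution_axioms (marginal i)" unfolding real_distribution_axioms_def marginal_def by simp
qed

text \<open>The characteristic functions agree, as \<open>cos (s t)\<close> and \<open>sin (s t)\<close> have elementary antiderivatives, to which
\<open>time_marginal\<close> applies.\<close>

lemma marginal_eq:
  assumes i: "i \<in> I" shows "marginal i = unit_time"
proof (rule Levy_uniqueness[OF real_distribution_marginal[OF i] real_distribution_unit_time], rule ext)
  fix s :: real
  have mean: "(LINT t|marginal i. T' t) = (LINT t|unit_time. T' t)"
    if T: "\<And>t. (T has_real_derivative T' t) (at t)" and c: "continuous_on UNIV T'" for T T' :: "real \<Rightarrow> real"
  proof -
    have m: "T' \<in> borel_measurable borel" using c by (rule borel_measurable_continuous_onI)
    have c': "continuous_on {0..1} T'" using c continuous_on_subset by blast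
    have "(LINT t|marginal i. T' t) = T 1 - T 0"
      unfolding integral_marginal[OF i m] real_scaleR_def by (rule time_marginal[OF i T c'])
    also have "\<dots> = (LINT t:{0..1}|lborel. T' t)"
      unfolding set_lebesgue_integral_def
      by (rule integral_FTC_Icc[symmetric])
         (use T c' in \<open>auto intro: DERIV_subset simp flip: has_real_derivative_iff_has_vector_derivative\<close>)
    finally show ?thesis unfolding integral_unit_time[OF m] .
  qed
  show "char (marginal i) s = char unit_time s"
  proof (cases "s = 0")
    case True
    then show ?thesis
      using real_distribution.char_zero[OF real_distribution_marginal[OF i]]
        real_distribution.char_zero[OF real_distribution_unit_time] by simp
  next
    case False
    have c: "(LINT t|marginal i. cos (s * t)) = (LINT t|unit_time. cos (s * t))"
      by (rule mean[of "\<lambda>t. sin (s * t) / s"])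
         (use False in \<open>auto intro!: derivative_eq_intros continuous_intros\<close>)
    have d: "(LINT t|marginal i. sin (s * t)) = (LINT t|unit_time. sin (s * t))"
      by (rule mean[of "\<lambda>t. - cos (s * t) / s"])
         (use False in \<open>auto intro!: derivative_eq_intros continuous_intros\<close>)
    have parts: "char N s = Complex (LINT t|N. cos (s * t)) (LINT t|N. sin (s * t))" if N: "real_distribution N" for N
    proof -
      interpret real_distribution N by fact
      have int: "integrable N (\<lambda>t. iexp (s * t))" by (rule integrable_iexp) simp_all
      show ?thesis
        unfolding char_def using integral_Re[OF int] integral_Im[OF int]
        by (simp add: complex_eq_iff Re_exp Im_exp)
    qed
    show ?thesis
      unfolding parts[OF real_distribution_marginal[OF i]] parts[OF real_distribution_unit_time] c d ..
  qed
qed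

lemma minimizer_eq:
  assumes A: "A \<in> sets borel"
  shows "\<rho> A = (\<Sum>i\<in>I. dirac_geodesic \<delta> (h0 i) (x0 i) (h1 i) (x1 i) A)"
proof -
  define F where "F i t = indicator {0..1} t *\<^sub>R (indicator A (t, \<gamma> i t) * mass i t)" for i t
  have Fm: "F i \<in> borel_measurable borel" if i: "i \<in> I" for i
  proof -
    have "(\<lambda>t. (t, \<gamma> i t)) \<in> borel_measurable (restrict_space borel {0..1})"
      by (intro borel_measurable_continuous_on_restrict continuous_intros continuous_\<gamma>[OF i])
    from measurable_compose[OF this borel_measurable_indicator[OF A]]
    have "(\<lambda>t. indicator A (t, \<gamma> i t) :: real) \<in> borel_measurable (restrict_space borel {0..1})" .
    moreover have "mass i \<in> borel_measurable (restrict_space borel {0..1})"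
      by (rule borel_measurable_continuous_on_restrict[OF continuous_mass])
    ultimately have "(\<lambda>t. indicator A (t, \<gamma> i t) * mass i t) \<in> borel_measurable (restrict_space borel {0..1})"
      by (rule borel_measurable_times)
    then show ?thesis unfolding F_def by (subst (asm) borel_measurable_restrict_space_iff) simp_all
  qed
  have e: "dens i p *\<^sub>R F i (fst p) = indicator (A \<inter> D.graph i) p *\<^sub>R r p" if i: "i \<in> I" for i p
  proof (cases "p \<in> D.graph i")
    case True
    then have t: "fst p \<in> {0..1}" and pi: "p = (fst p, \<gamma> i (fst p))" unfolding D.graph_def by (auto simp: prod_eq_iff)
    have "indicator A (fst p, \<gamma> i (fst p)) = (indicator A p :: real)" using pi by simp
    then show ?thesis unfolding dens_def F_def using True t mass_pos[OF i t] by (simp add: indicator_inter_arith)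
  qed (simp add: dens_def)
  have gm: "D.graph i \<in> sets borel" if "i \<in> I" for i by (rule borel_compact[OF compact_graph[OF that]])
  have Ii: "integrable M (\<lambda>p. dens i p *\<^sub>R F i (fst p))" if i: "i \<in> I" for i
    unfolding e[OF i] using A gm[OF i] sM by (intro integrable_mult_indicator ri) simp
  have "\<rho> A = (LINT p|M. indicator A p *\<^sub>R r p)"
    using has_density_eq[OF densities(1) A] unfolding set_lebesgue_integral_def .
  also have "\<dots> = (LINT p|M. (\<Sum>i\<in>I. dens i p *\<^sub>R F i (fst p)))"
  proof (rule integral_cong_AE)
    show "(\<lambda>p. indicator A p *\<^sub>R r p) \<in> borel_measurable M"
      using A sM by (intro borel_measurable_integrable integrable_mult_indicator ri) simp
    show "(\<lambda>p. \<Sum>i\<in>I. dens i p *\<^sub>R F i (fst p)) \<in> borel_measurable M"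
      by (intro borel_measurable_integrable Bochner_Integration.integrable_sum Ii)
    show "AE p in M. indicator A p *\<^sub>R r p = (\<Sum>i\<in>I. dens i p *\<^sub>R F i (fst p))"
      using concentrated_on_curves
    proof eventually_elim
      case (elim p)
      show ?case
      proof (cases "r p = 0")
        case True
        then show ?thesis by (simp add: dens_def)
      next
        case False
        then obtain j where j: "j \<in> I" "p \<in> D.graph j" using elim by blast
        have "(\<Sum>i\<in>I. dens i p *\<^sub>R F i (fst p)) = dens j p *\<^sub>R F j (fst p)"
        proof (rule sum_single[OF I(1) j(1)])
          fix i assume "i \<in> I - {j}"
          then have i: "i \<in> I" "i \<noteq> j" by auto
          have "p \<notin> D.graph i"
          proof
            assume "p \<in> D.graph i"
            then have "\<gamma> i (fst p) = \<gamma> j (fst p)" "fst p \<in> {0..1}" using j(2) unfolding D.graph_def by auto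
            then show False using \<gamma>_disjoint[OF i(1) j(1) i(2)] by blast
          qed
          then show "dens i p *\<^sub>R F i (fst p) = 0" by (simp add: dens_def)
        qed
        also have "\<dots> = indicator A p *\<^sub>R r p" unfolding e[OF j(1)] using j(2) by (simp add: indicator_inter_arith)
        finally show ?thesis by simp
      qed
    qed
  qed
  also have "\<dots> = (\<Sum>i\<in>I. LINT p|M. dens i p *\<^sub>R F i (fst p))"
    by (rule Bochner_Integration.integral_sum[OF Ii])
  also have "\<dots> = (\<Sum>i\<in>I. dirac_geodesic \<delta> (h0 i) (x0 i) (h1 i) (x1 i) A)"
  proof (rule sum.cong[OF refl])
    fix i assume i: "i \<in> I"
    have "(LINT p|M. dens i p *\<^sub>R F i (fst p)) = (LINT t:{0..1}|lborel. F i t)"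
      unfolding integral_marginal[OF i Fm[OF i], symmetric] marginal_eq[OF i] by (rule integral_unit_time[OF Fm[OF i]])
    also have "\<dots> = (LINT t:{0..1}|lborel. indicator A (t, \<gamma> i t) * mass i t)"
      by (rule set_lebesgue_integral_cong) (simp_all add: F_def)
    also have "\<dots> = dirac_geodesic \<delta> (h0 i) (x0 i) (h1 i) (x1 i) A"
      by (rule dirac_path_geodesic[OF \<gamma>_path[OF i] A, symmetric])
    finally show "(LINT p|M. dens i p *\<^sub>R F i (fst p)) = dirac_geodesic \<delta> (h0 i) (x0 i) (h1 i) (x1 i) A" .
  qed
  finally show ?thesis .
qed

end

section \<open>The theorem\<close>

text \<open>Only the largest of the four distances is controlled, but the points of one pair are closer than \<open>R\<close>, so
the other distances differ from it by less than \<open>2R\<close>.\<close>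

lemma separation_from_max:
  fixes a b c d :: "'a::euclidean_space"
  assumes "norm (a - b) < R" "norm (c - d) < R"
    and "Max {norm (a - c), norm (a - d), norm (b - c), norm (b - d)} > 6 * R"
    and y: "y \<in> {a, b}" and z: "z \<in> {c, d}"
  shows "4 * R < norm (y - z)"
proof -
  have R: "0 < R" by (rule le_less_trans[OF norm_ge_zero assms(1)])
  obtain y' z' where yz: "y' \<in> {a, b}" "z' \<in> {c, d}" "6 * R < norm (y' - z')"
    using assms(3) by (auto simp: less_max_iff_disj)
  have "norm (y' - y) < R" using yz(1) y assms(1) R
    by (auto simp: norm_minus_commute)
  moreover have "norm (z - z') < R" using yz(2) z assms(2) R
    by (auto simp: norm_minus_commute)
  moreover have "norm (y' - z') \<le> norm (y' - y) + norm (y - z) + norm (z - z')"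
    using norm_triangle_ineq[of "y' - y" "y - z"] norm_triangle_ineq[of "y' - z" "z - z'"] by simp
  ultimately show ?thesis using yz(3) by linarith
qed

theorem mainTheorem6:
  fixes \<Omega> :: "'a::euclidean_space set" and \<delta> :: real and N :: nat
    and h\<^sub>0 h\<^sub>1 :: "nat \<Rightarrow> real" and x\<^sub>0 x\<^sub>1 :: "nat \<Rightarrow> 'a"
    and \<rho>\<^sub>0 \<rho>\<^sub>1 :: "'a set \<Rightarrow> real" and \<rho> :: "(real \<times> 'a) set \<Rightarrow> real"
  assumes "\<Omega> \<noteq> {}" and "open \<Omega>" and "bounded \<Omega>" and "convex \<Omega>"
    and "\<delta> > 0" and "N \<ge> 1"
    and "\<forall>i\<in>{1..N}. 0 \<le> h\<^sub>0 i \<and> 0 \<le> h\<^sub>1 i"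
    and "\<forall>i\<in>{1..N}. x\<^sub>0 i \<in> closure \<Omega> \<and> x\<^sub>1 i \<in> closure \<Omega>"
    and "\<forall>i\<in>{1..N}. norm (x\<^sub>0 i - x\<^sub>1 i) < pi * \<delta>"
    and "\<forall>i\<in>{1..N}. \<forall>j\<in>{1..N}. i \<noteq> j \<longrightarrow>
           Max {norm (x\<^sub>0 i - x\<^sub>0 j), norm (x\<^sub>0 i - x\<^sub>1 j),
                norm (x\<^sub>1 i - x\<^sub>0 j), norm (x\<^sub>1 i - x\<^sub>1 j)} > 6 * pi * \<delta>"
    and "\<rho>\<^sub>0 = (\<lambda>A. \<Sum>i=1..N. h\<^sub>0 i * dirac (x\<^sub>0 i) A)"
    and "\<rho>\<^sub>1 = (\<lambda>A. \<Sum>i=1..N. h\<^sub>1 i * dirac (x\<^sub>1 i) A)"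
    and "\<rho> = (\<lambda>A. \<Sum>i=1..N. dirac_geodesic \<delta> (h\<^sub>0 i) (x\<^sub>0 i) (h\<^sub>1 i) (x\<^sub>1 i) A)"
  shows "geodesic \<delta> \<Omega> \<rho>\<^sub>0 \<rho>\<^sub>1 \<rho> \<and>
    ((\<forall>i\<in>{1..N}. 0 < h\<^sub>0 i \<and> 0 < h\<^sub>1 i) \<longrightarrow>
       (\<forall>\<rho>'. geodesic \<delta> \<Omega> \<rho>\<^sub>0 \<rho>\<^sub>1 \<rho>' \<longrightarrow> \<rho>' = \<rho>))"
proof -
  note h = assms(7)[rule_format] and x = assms(8)[rule_format] and near = assms(9)[rule_format]
  define I where "I = {1..N}"
  interpret S: separated_pairs \<delta> I h\<^sub>0 h\<^sub>1 x\<^sub>0 x\<^sub>1 \<Omega>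
  proof
    fix i j y z assume ij: "i \<in> I" "j \<in> I" "i \<noteq> j" and yz: "y \<in> {x\<^sub>0 i, x\<^sub>1 i}" "z \<in> {x\<^sub>0 j, x\<^sub>1 j}"
    have "4 * (pi * \<delta>) < norm (y - z)"
      by (rule separation_from_max[OF near near _ yz]) (use assms(10) ij in \<open>auto simp: I_def mult.assoc\<close>)
    then show "4 * pi * \<delta> < norm (y - z)" by (simp add: mult.assoc)
  qed (use assms in \<open>auto simp: I_def\<close>)
  have \<rho>\<^sub>0: "\<rho>\<^sub>0 = S.\<rho>0" and \<rho>\<^sub>1: "\<rho>\<^sub>1 = S.\<rho>1"
    unfolding S.\<rho>0_def S.\<rho>1_def assms(11,12) by (simp_all only: I_def)
  have \<rho>: "\<rho> = (\<lambda>A. \<Sum>i\<in>I. dirac_geodesic \<delta> (h\<^sub>0 i) (x\<^sub>0 i) (h\<^sub>1 i) (x\<^sub>1 i) A)" unfolding I_def assms(13) ..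
  let ?V = "\<Sum>i\<in>I. pair_cost \<delta> (h\<^sub>0 i) (x\<^sub>0 i) (h\<^sub>1 i) (x\<^sub>1 i)"
  have "\<forall>i. \<exists>\<gamma> m w dm. i \<in> I \<longrightarrow> dirac_path \<delta> (h\<^sub>0 i) (x\<^sub>0 i) (h\<^sub>1 i) (x\<^sub>1 i) \<gamma> m w dm"
    using dirac_path_exists[OF S.\<delta> S.h(1) S.h(2) S.near] by blast
  then obtain \<gamma> m w dm where P: "\<And>i. i \<in> I \<Longrightarrow> dirac_path \<delta> (h\<^sub>0 i) (x\<^sub>0 i) (h\<^sub>1 i) (x\<^sub>1 i) (\<gamma> i) (m i) (w i) (dm i)"
    by metis
  have disj: "\<gamma> i t \<noteq> \<gamma> j t" if "i \<in> I" "j \<in> I" "i \<noteq> j" "t \<in> {0..1}" for i j t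
    using P[OF that(1)] P[OF that(2)] that(4) unfolding dirac_path_def
    by (intro S.segments_disjoint[OF that(1-3)]) blast+
  have "\<rho> \<in> nonneg_measures ({0..1} \<times> closure \<Omega>) \<and> (\<exists>\<omega> \<zeta>. (\<rho>, \<omega>, \<zeta>) \<in> CE \<Omega> \<rho>\<^sub>0 \<rho>\<^sub>1 \<and>
      action \<delta> \<Omega> (\<rho>, \<omega>, \<zeta>) = ennreal ?V)"
  proof (rule superposition_minimal_candidate[OF S.\<delta> assms(3,4) S.I(1) _ _ P disj])
    show "\<rho>\<^sub>0 = (\<lambda>A. \<Sum>i\<in>I. h\<^sub>0 i * dirac (x\<^sub>0 i) A)" "\<rho>\<^sub>1 = (\<lambda>A. \<Sum>i\<in>I. h\<^sub>1 i * dirac (x\<^sub>1 i) A)"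
      unfolding \<rho>\<^sub>0 \<rho>\<^sub>1 S.\<rho>0_def S.\<rho>1_def by (rule refl)+
  qed (use S.h S.x \<rho> in blast)+
  then obtain \<omega> \<zeta> where c: "\<rho> \<in> nonneg_measures ({0..1} \<times> closure \<Omega>)" "(\<rho>, \<omega>, \<zeta>) \<in> CE \<Omega> \<rho>\<^sub>0 \<rho>\<^sub>1"
    "action \<delta> \<Omega> (\<rho>, \<omega>, \<zeta>) = ennreal ?V" by blast
  have lower: "ennreal ?V \<le> action \<delta> \<Omega> \<mu>" if "\<mu> \<in> CE \<Omega> \<rho>\<^sub>0 \<rho>\<^sub>1" for \<mu>
    using that S.total_lower_bound unfolding \<rho>\<^sub>0 \<rho>\<^sub>1 by (cases \<mu>) auto
  have "is_arg_min (action \<delta> \<Omega>) (\<lambda>\<mu>. \<mu> \<in> CE \<Omega> \<rho>\<^sub>0 \<rho>\<^sub>1) (\<rho>, \<omega>, \<zeta>)"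
    unfolding is_arg_min_def using c(2,3) lower by (auto simp: not_less)
  then have geo: "geodesic \<delta> \<Omega> \<rho>\<^sub>0 \<rho>\<^sub>1 \<rho>" unfolding geodesic_def using c(1) by blast
  have "\<rho>' = \<rho>" if pos: "\<forall>i\<in>{1..N}. 0 < h\<^sub>0 i \<and> 0 < h\<^sub>1 i" and g: "geodesic \<delta> \<Omega> \<rho>\<^sub>0 \<rho>\<^sub>1 \<rho>'" for \<rho>'
  proof -
    obtain \<omega>' \<zeta>' where m: "is_arg_min (action \<delta> \<Omega>) (\<lambda>\<mu>. \<mu> \<in> CE \<Omega> \<rho>\<^sub>0 \<rho>\<^sub>1) (\<rho>', \<omega>', \<zeta>')"
      using g unfolding geodesic_def by blast
    have ce': "(\<rho>', \<omega>', \<zeta>') \<in> CE \<Omega> \<rho>\<^sub>0 \<rho>\<^sub>1" using m unfolding is_arg_min_def by simp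
    have "action \<delta> \<Omega> (\<rho>', \<omega>', \<zeta>') \<le> ennreal ?V"
      using m c(2,3) unfolding is_arg_min_def by (metis not_le)
    then have opt: "action \<delta> \<Omega> (\<rho>', \<omega>', \<zeta>') = ennreal ?V" using lower[OF ce'] by (rule antisym)
    obtain M r w z where td: "triple_density ({0..1} \<times> closure \<Omega>) M r w z (\<rho>', \<omega>', \<zeta>')"
      using CE_triple_density[OF ce'] by blast
    interpret positive_pairs \<delta> I h\<^sub>0 h\<^sub>1 x\<^sub>0 x\<^sub>1 \<Omega> by unfold_locales (use pos in \<open>auto simp: I_def\<close>)
    interpret minimizer \<delta> I h\<^sub>0 h\<^sub>1 x\<^sub>0 x\<^sub>1 \<Omega> \<rho>' \<omega>' \<zeta>' M r w z
      by unfold_locales (use ce' opt td in \<open>simp_all add: \<rho>\<^sub>0 \<rho>\<^sub>1 V_def\<close>)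
    show ?thesis
    proof
      fix A
      show "\<rho>' A = \<rho> A"
      proof (cases "A \<in> sets borel")
        case True
        then show ?thesis unfolding \<rho> by (rule minimizer_eq)
      next
        case False
        have "\<rho>' \<in> signed_measures ({0..1} \<times> closure \<Omega>)" "\<rho> \<in> signed_measures ({0..1} \<times> closure \<Omega>)"
          using ce' c(1) unfolding CE_def Let_def nonneg_measures_def by simp_all
        then show ?thesis using False unfolding signed_measures_def by simp
      qed
    qed
  qed
  then show ?thesis using geo by blast
qed

end
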